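(* Let $d\geq 4$ and $n\geq 2$ be integers, let $\tau(n,d-1)=\binom{n+d-2}{d-1}$, and let $H$ be the Hilbert vector of a full Perazzo algebra of socle degree $d$ and codimension $n+\tau(n,d-1)$ over $\mathbb{K}$. Then $H$ is minimal among the Hilbert vectors of all standard graded Artinian Gorenstein $\mathbb{K}$-algebras of socle degree $d$ and codimension $n+\tau(n,d-1)$ with respect to the partial order $\preceq$; that is, if $\widetilde{A}$ is such an algebra and $\mathrm{Hilb}(\widetilde{A})\preceq H$, then $\mathrm{Hilb}(\widetilde{A})=H$.
   Context: $\mathbb{K}$ is an algebraically closed field of characteristic $0$. A graded Artinian $\mathbb{K}$-algebra $A=\bigoplus_{i=0}^d A_i$ with $A_d\neq0$, a quotient of a polynomial ring in $m$ variables of degree $1$ by a homogeneous ideal $I$, has socle degree $d$ and Hilbert vector $\mathrm{Hilb}(A)=(1,h_1,\dots,h_d)$, $h_i=\dim_{\mathbb{K}}A_i$. It is standard if $I_1=0$, in which case $h_1=m$ is its codimension. It is Gorenstein if $\dim A_d=1$ and the multiplication $A_i\times A_{d-i}\to A_d\cong\mathbb{K}$ is a perfect pairing for each $i$; the Hilbert vector is then symmetric. For a homogeneous polynomial $f$, $\mathrm{Ann}(f)$ is the ideal of those polynomials in the partial derivatives with respect to the variables (constant coefficient differential operators) that annihilate $f$. Let $\{M_1,\dots,M_{\tau(n,d-1)}\}$ be the monic monomial basis of $\mathbb{K}[u_1,\dots,u_n]_{d-1}$. The full Perazzo polynomial of degree $d$ is $f=\sum_{i=1}^{\tau(n,d-1)}x_iM_i\in\mathbb{K}[x_1,\dots,x_{\tau(n,d-1)},u_1,\dots,u_n]$,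 and the associated full Perazzo algebra is $\mathbb{K}[X_1,\dots,X_{\tau(n,d-1)},U_1,\dots,U_n]/\mathrm{Ann}(f)$, where $X_i=\partial/\partial x_i$, $U_j=\partial/\partial u_j$. It is a standard graded Artinian Gorenstein algebra of socle degree $d$ and codimension $n+\tau(n,d-1)$. Partial order: for symmetric vectors of length $d+1$, $(1,h_1,h_2,\dots,h_2,h_1,1)\preceq(1,\widetilde{h}_1,\widetilde{h}_2,\dots,\widetilde{h}_2,\widetilde{h}_1,1)$ if $h_i\leq\widetilde{h}_i$ for every $i\in\{0,\dots,\lfloor d/2\rfloor\}$. *)

theory Defs
  imports
    "HOL-Library.Poly_Mapping"
    "HOL-Library.FuncSet"
    "HOL-Algebra.QuotRing"
    "HOL-Algebra.Embedded_Algebras"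
    "HOL-Computational_Algebra.Polynomial"
begin

section \<open>Polynomial rings in a set of variables\<close>

text \<open>
  A polynomial is a finitely supported map from exponent vectors to coefficients; multiplication
  is the convolution product of \<^theory>\<open>HOL-Library.Poly_Mapping\<close>.
\<close>

type_synonym ('v, 'k) mpoly = "('v \<Rightarrow>\<^sub>0 nat) \<Rightarrow>\<^sub>0 'k"

definition mdeg :: "('v \<Rightarrow>\<^sub>0 nat) \<Rightarrow> nat" where
  "mdeg \<alpha> = (\<Sum>v\<in>Poly_Mapping.keys \<alpha>. Poly_Mapping.lookup \<alpha> v)"

definition Const :: "'k \<Rightarrow> ('v, 'k::comm_ring_1) mpoly" where
  "Const c = Poly_Mapping.single 0 c"

definition Var :: "'v \<Rightarrow> ('v, 'k::comm_ring_1) mpoly" where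
  "Var v = Poly_Mapping.single (Poly_Mapping.single v 1) 1"

definition poly_ring :: "'v set \<Rightarrow> ('v, 'k::comm_ring_1) mpoly ring" where
  "poly_ring V =
     \<lparr>carrier = {p. \<forall>\<alpha>\<in>Poly_Mapping.keys p. Poly_Mapping.keys \<alpha> \<subseteq> V},
      monoid.mult = (*), one = 1, zero = 0, add = (+)\<rparr>"

lemma cring_poly_ring: "cring (poly_ring V :: ('v, 'k::comm_ring_1) mpoly ring)"
proof (rule cringI)
  show "abelian_group (poly_ring V :: ('v, 'k) mpoly ring)"
  proof (rule abelian_groupI)
    fix p q :: "('v, 'k) mpoly"
    assume "p \<in> carrier (poly_ring V)" "q \<in> carrier (poly_ring V)"
    then show "p \<oplus>\<^bsub>poly_ring V\<^esub> q \<in> carrier (poly_ring V)"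
      using Poly_Mapping.keys_add[of p q] by (auto simp: poly_ring_def)
  next
    fix p :: "('v, 'k) mpoly"
    assume "p \<in> carrier (poly_ring V)"
    then show "\<exists>q\<in>carrier (poly_ring V). q \<oplus>\<^bsub>poly_ring V\<^esub> p = \<zero>\<^bsub>poly_ring V\<^esub>"
      by (intro bexI[of _ "- p"]) (auto simp: poly_ring_def)
  qed (auto simp: poly_ring_def algebra_simps)
  show "comm_monoid (poly_ring V :: ('v, 'k) mpoly ring)"
  proof (rule comm_monoidI)
    fix p q :: "('v, 'k) mpoly"
    assume pq: "p \<in> carrier (poly_ring V)" "q \<in> carrier (poly_ring V)"
    have "Poly_Mapping.keys \<gamma> \<subseteq> V" if g: "\<gamma> \<in> Poly_Mapping.keys (p * q)" for \<gamma>
    proof -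
      obtain \<alpha> \<beta> where ab: "\<alpha> \<in> Poly_Mapping.keys p" "\<beta> \<in> Poly_Mapping.keys q" "\<gamma> = \<alpha> + \<beta>"
        using Poly_Mapping.keys_mult[of p q] g by blast
      have "Poly_Mapping.keys \<gamma> \<subseteq> Poly_Mapping.keys \<alpha> \<union> Poly_Mapping.keys \<beta>"
        unfolding ab(3) by (rule Poly_Mapping.keys_add)
      then show ?thesis
        using ab pq by (auto simp: poly_ring_def)
    qed
    then show "p \<otimes>\<^bsub>poly_ring V\<^esub> q \<in> carrier (poly_ring V)"
      by (auto simp: poly_ring_def)
  qed (auto simp: poly_ring_def algebra_simps)
qed (auto simp: poly_ring_def algebra_simps)

definition homog_polys :: "'v set \<Rightarrow> nat \<Rightarrow> ('v, 'k::comm_ring_1) mpoly set" where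
  "homog_polys V i =
     {p \<in> carrier (poly_ring V). \<forall>\<alpha>\<in>Poly_Mapping.keys p. mdeg \<alpha> = i}"

definition homog_component :: "nat \<Rightarrow> ('v, 'k::comm_ring_1) mpoly \<Rightarrow> ('v, 'k) mpoly" where
  "homog_component i p =
     (\<Sum>\<alpha> | \<alpha> \<in> Poly_Mapping.keys p \<and> mdeg \<alpha> = i.
        Poly_Mapping.single \<alpha> (Poly_Mapping.lookup p \<alpha>))"

definition homogeneous_ideal :: "'v set \<Rightarrow> ('v, 'k::comm_ring_1) mpoly set \<Rightarrow> bool" where
  "homogeneous_ideal V I \<longleftrightarrow>
     ideal I (poly_ring V) \<and> (\<forall>p\<in>I. \<forall>i. homog_component i p \<in> I)"


section \<open>Graded quotients and Hilbert vectors\<close>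

text \<open>
  The graded algebra presented by \<open>V\<close> and \<open>I\<close> is the library quotient
  \<open>poly_ring V Quot I\<close>, whose elements are cosets. Its grading is the image of the standard
  grading, and the ground field sits inside it as the set of classes of constants;
  \<open>ring.dim\<close> is the dimension over that embedded field.
\<close>

definition graded_alg :: "'v set \<Rightarrow> ('v, 'k::comm_ring_1) mpoly set \<Rightarrow> ('v, 'k) mpoly set ring"
  where "graded_alg V I = poly_ring V Quot I"

definition scalars :: "'v set \<Rightarrow> ('v, 'k::comm_ring_1) mpoly set \<Rightarrow> ('v, 'k) mpoly set set"
  where "scalars V I = (\<lambda>c. I +>\<^bsub>poly_ring V\<^esub> Const c) ` UNIV"

definition piece :: "'v set \<Rightarrow> ('v, 'k::comm_ring_1) mpoly set \<Rightarrow> nat \<Rightarrow> ('v, 'k) mpoly set set"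
  where "piece V I i = (\<lambda>p. I +>\<^bsub>poly_ring V\<^esub> p) ` homog_polys V i"

definition hilbert_fun :: "'v set \<Rightarrow> ('v, 'k::comm_ring_1) mpoly set \<Rightarrow> nat \<Rightarrow> nat" where
  "hilbert_fun V I i = ring.dim (graded_alg V I) (scalars V I) (piece V I i)"

definition hilbert_vector :: "nat \<Rightarrow> 'v set \<Rightarrow> ('v, 'k::comm_ring_1) mpoly set \<Rightarrow> nat list" where
  "hilbert_vector d V I = map (hilbert_fun V I) [0..<d+1]"

text \<open>
  The order is meant for symmetric vectors, so only the first half of the entries is compared.
\<close>

definition hilbert_le :: "nat list \<Rightarrow> nat list \<Rightarrow> bool" (infix "\<preceq>\<^sub>H" 50) where
  "h \<preceq>\<^sub>H h' \<longleftrightarrow>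
     length h = length h' \<and> (\<forall>i \<le> (length h - 1) div 2. h ! i \<le> h' ! i)"


section \<open>Standard graded Artinian Gorenstein algebras\<close>

definition linear_maps :: "('a, 'm) ring_scheme \<Rightarrow> 'a set \<Rightarrow> 'a set \<Rightarrow> 'a set \<Rightarrow> ('a \<Rightarrow> 'a) set" where
  "linear_maps A K V W =
     {\<phi> \<in> V \<rightarrow>\<^sub>E W.
        (\<forall>x\<in>V. \<forall>y\<in>V. \<phi> (x \<oplus>\<^bsub>A\<^esub> y) = \<phi> x \<oplus>\<^bsub>A\<^esub> \<phi> y) \<and>
        (\<forall>c\<in>K. \<forall>x\<in>V. \<phi> (c \<otimes>\<^bsub>A\<^esub> x) = c \<otimes>\<^bsub>A\<^esub> \<phi> x)}"

text \<open>
  Multiplication \<open>V \<times> W \<rightarrow> Z\<close> is a perfect pairing if both induced maps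
  \<open>V \<rightarrow> Hom(W, Z)\<close> and \<open>W \<rightarrow> Hom(V, Z)\<close> are bijective.
\<close>

definition perfect_pairing ::
    "('a, 'm) ring_scheme \<Rightarrow> 'a set \<Rightarrow> 'a set \<Rightarrow> 'a set \<Rightarrow> 'a set \<Rightarrow> bool" where
  "perfect_pairing A K V W Z \<longleftrightarrow>
     bij_betw (\<lambda>a. \<lambda>b\<in>W. a \<otimes>\<^bsub>A\<^esub> b) V (linear_maps A K W Z) \<and>
     bij_betw (\<lambda>b. \<lambda>a\<in>V. a \<otimes>\<^bsub>A\<^esub> b) W (linear_maps A K V Z)"

definition artinian_socle_degree :: "'v set \<Rightarrow> ('v, 'k::comm_ring_1) mpoly set \<Rightarrow> nat \<Rightarrow> bool" where
  "artinian_socle_degree V I d \<longleftrightarrow>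
     piece V I d \<noteq> {\<zero>\<^bsub>graded_alg V I\<^esub>} \<and> (\<forall>i>d. piece V I i = {\<zero>\<^bsub>graded_alg V I\<^esub>})"

text \<open>
  By the condition that \<open>I\<close> has no nonzero linear form, the codimension of such an algebra
  is the number of variables \<open>card V\<close>.
\<close>

definition standard_AG :: "'v set \<Rightarrow> ('v, 'k::comm_ring_1) mpoly set \<Rightarrow> nat \<Rightarrow> bool" where
  "standard_AG V I d \<longleftrightarrow>
     finite V \<and>
     homogeneous_ideal V I \<and>
     I \<inter> homog_polys V 1 = {0} \<and>
     artinian_socle_degree V I d \<and>
     hilbert_fun V I d = 1 \<and>
     (\<forall>i\<le>d. perfect_pairing (graded_alg V I) (scalars V I)
                (piece V I i) (piece V I (d - i)) (piece V I d))"


section \<open>Constant coefficient differential operators\<close>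

definition partial :: "'v \<Rightarrow> ('v, 'k::comm_ring_1) mpoly \<Rightarrow> ('v, 'k) mpoly" where
  "partial v p =
     (\<Sum>\<alpha>\<in>Poly_Mapping.keys p.
        Poly_Mapping.single (\<alpha> - Poly_Mapping.single v 1)
          (of_nat (Poly_Mapping.lookup \<alpha> v) * Poly_Mapping.lookup p \<alpha>))"

lemma lookup_partial:
  "Poly_Mapping.lookup (partial v p) \<beta> =
     of_nat (Poly_Mapping.lookup \<beta> v + 1) * Poly_Mapping.lookup p (\<beta> + Poly_Mapping.single v 1)"
proof -
  let ?t = "\<lambda>\<alpha>. of_nat (Poly_Mapping.lookup \<alpha> v) * Poly_Mapping.lookup p \<alpha>"
  let ?e = "Poly_Mapping.single v (1::nat)"
  have eq: "\<alpha> = \<beta> + ?e" if "\<alpha> - ?e = \<beta>" "Poly_Mapping.lookup \<alpha> v \<noteq> 0" for \<alpha>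
    using that by (auto intro!: poly_mapping_eqI
        simp: Poly_Mapping.lookup_add Poly_Mapping.lookup_minus Poly_Mapping.lookup_single when_def)
  have "Poly_Mapping.lookup (partial v p) \<beta> =
      (\<Sum>\<alpha>\<in>Poly_Mapping.keys p. if \<alpha> - ?e = \<beta> then ?t \<alpha> else 0)"
    unfolding partial_def Poly_Mapping.lookup_sum
    by (intro sum.cong refl) (simp add: Poly_Mapping.lookup_single when_def)
  also have "\<dots> = (\<Sum>\<alpha>\<in>Poly_Mapping.keys p. if \<alpha> = \<beta> + ?e then ?t \<alpha> else 0)"
  proof (rule sum.cong)
    fix \<alpha>
    show "(if \<alpha> - ?e = \<beta> then ?t \<alpha> else 0) = (if \<alpha> = \<beta> + ?e then ?t \<alpha> else 0)"
    proof (cases "Poly_Mapping.lookup \<alpha> v = 0")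
      case False
      then have "\<alpha> - ?e = \<beta> \<longleftrightarrow> \<alpha> = \<beta> + ?e"
        using eq[of \<alpha>] by (metis add_diff_cancel_right')
      then show ?thesis by simp
    qed simp
  qed simp
  also have "\<dots> = ?t (\<beta> + ?e)"
    by (simp add: in_keys_iff)
  finally show ?thesis
    by (simp add: Poly_Mapping.lookup_add)
qed

lemma partial_commute: "partial v (partial w p) = partial w (partial v p)"
  by (rule poly_mapping_eqI, cases "v = w")
     (auto simp: lookup_partial Poly_Mapping.lookup_add Poly_Mapping.lookup_single algebra_simps)

definition deriv_monom :: "('v \<Rightarrow>\<^sub>0 nat) \<Rightarrow> ('v, 'k::comm_ring_1) mpoly \<Rightarrow> ('v, 'k) mpoly" where
  "deriv_monom \<alpha> p =
     Finite_Set.fold (\<lambda>v. partial v ^^ Poly_Mapping.lookup \<alpha> v) p (Poly_Mapping.keys \<alpha>)"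

text \<open>The fold does not depend on an order of the variables.\<close>

lemma comp_fun_commute_partial_funpow:
  "comp_fun_commute (\<lambda>v. (partial v :: ('v, 'k::comm_ring_1) mpoly \<Rightarrow> _) ^^ k v)"
proof -
  interpret comp_fun_commute "partial :: 'v \<Rightarrow> ('v, 'k) mpoly \<Rightarrow> _"
    by standard (auto simp: fun_eq_iff partial_commute)
  show ?thesis
    by (rule comp_fun_commute_funpow)
qed

definition apply_op :: "('v, 'k::comm_ring_1) mpoly \<Rightarrow> ('v, 'k) mpoly \<Rightarrow> ('v, 'k) mpoly" where
  "apply_op D p =
     (\<Sum>\<alpha>\<in>Poly_Mapping.keys D. Const (Poly_Mapping.lookup D \<alpha>) * deriv_monom \<alpha> p)"

text \<open>The variable \<open>v\<close> of an operator stands for the partial derivative with respect to \<open>v\<close>.\<close>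

definition Ann :: "'v set \<Rightarrow> ('v, 'k::comm_ring_1) mpoly \<Rightarrow> ('v, 'k) mpoly set" where
  "Ann V p = {D \<in> carrier (poly_ring V). apply_op D p = 0}"


section \<open>Full Perazzo algebras\<close>

definition monomials :: "nat \<Rightarrow> nat \<Rightarrow> (nat \<Rightarrow>\<^sub>0 nat) set" where
  "monomials n k = {\<alpha>. Poly_Mapping.keys \<alpha> \<subseteq> {..<n} \<and> mdeg \<alpha> = k}"

definition tau :: "nat \<Rightarrow> nat \<Rightarrow> nat" where
  "tau n k = (n + k - 1) choose k"

text \<open>
  The variables \<open>x\<^sub>1, \<dots>, x\<^sub>\<tau>\<close> are indexed by the monomials themselves: \<open>Inl M\<close> is the variable
  multiplying the monomial \<open>M\<close>, and \<open>Inr j\<close> with \<open>j < n\<close> is \<open>u\<close> with index \<open>j + 1\<close>.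
\<close>

definition perazzo_vars :: "nat \<Rightarrow> nat \<Rightarrow> ((nat \<Rightarrow>\<^sub>0 nat) + nat) set" where
  "perazzo_vars n d = Inl ` monomials n (d - 1) \<union> Inr ` {..<n}"

definition perazzo_poly :: "nat \<Rightarrow> nat \<Rightarrow> ((nat \<Rightarrow>\<^sub>0 nat) + nat, 'k::comm_ring_1) mpoly" where
  "perazzo_poly n d =
     (\<Sum>M\<in>monomials n (d - 1). Var (Inl M) * (\<Prod>j<n. Var (Inr j) ^ Poly_Mapping.lookup M j))"

definition perazzo_ideal :: "nat \<Rightarrow> nat \<Rightarrow> ((nat \<Rightarrow>\<^sub>0 nat) + nat, 'k::comm_ring_1) mpoly set" where
  "perazzo_ideal n d = Ann (perazzo_vars n d) (perazzo_poly n d)"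

end

theory Submission
  imports Defs "HOL-Library.Function_Algebras"
begin

text \<open>
  A Gorenstein algebra \<open>A\<close> of socle degree \<open>d\<close> is given by a functional \<open>\<Phi>\<close> in degree \<open>d\<close>,
  and \<open>h\<^sub>i\<close> is the rank of the pairing \<open>(p, q) \<mapsto> \<Phi> (p q)\<close> in degrees \<open>i\<close> and \<open>d - i\<close>. For
  the full Perazzo algebra \<open>h\<^sub>i = \<tau>(n, i) + \<tau>(n, d - i)\<close>. Assume that \<open>h\<^sub>1\<close> has this value and
  the other \<open>h\<^sub>i\<close> are at most this. Take a general linear form \<open>l\<close>, put \<open>m = n - 1\<close>, and let
  \<open>Z\<close> be the kernel of \<open>l\<close> on \<open>A\<^sub>1\<close>. The hypothesis on \<open>h\<^sub>1 - h\<^sub>2\<close>, together with a form of the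
  theorems of Green and Macaulay at binomial values, gives \<open>dim (A\<^sub>j Z) \<ge> \<tau>(m, d - 1 - j)\<close>. This
  bounds \<open>h\<^sub>1\<close> from below by \<open>\<Sum>\<^sub>k \<tau>(m, k) + \<rho>\<close>, summed over \<open>2 \<le> k < d\<close>, where \<open>\<rho>\<close> is the
  rank of the form \<open>\<Phi> (l\<^sup>d\<^sup>-\<^sup>2 x y)\<close>. For a second general form \<open>b\<close> the space \<open>b\<^sup>d\<^sup>-\<^sup>2 Z\<close>, of
  dimension \<open>\<epsilon>\<close> say, is isotropic for it and orthogonal to \<open>l\<close>, so \<open>\<rho> \<ge> 2 \<epsilon> + 1\<close> and hence
  \<open>\<epsilon> \<le> m\<close>. Counting the fundamental forms of the map given by \<open>b \<mapsto> b\<^sup>d\<^sup>-\<^sup>1 Z\<close> yields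
  \<open>dim Z \<le> \<tau>(\<epsilon>, d - 1)\<close>. So \<open>dim Z = \<tau>(m, d - 1)\<close>, and the functional \<open>q \<mapsto> \<Phi> (l q)\<close> of
  degree \<open>d - 1\<close> satisfies the same assumptions.
\<close>

section \<open>Finite-dimensional subspaces and generic rank\<close>

text \<open>The induction is on \<open>d\<close>. Upper bounds pass to \<open>\<Phi> (l q)\<close>
  by themselves: with \<open>n = m + 1\<close>, the estimate for \<open>A\<^sub>j Z\<close> says
  that \<open>l\<close> maps degree \<open>j\<close> onto a space at least
  \<open>\<tau>(m, j + 1)\<close> smaller than degree \<open>j + 1\<close>, and
  \<open>\<tau>(n, j + 1) - \<tau>(m, j + 1) = \<tau>(n, j)\<close>. What does not pass is the
  equality in degree 1. It needs an upper bound for \<open>dim Z\<close>, while the estimates of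
  Macaulay and Green bound \<open>Z\<close> only from below. The quadratic form supplies it: the sum
  over \<open>2 \<le> k < d\<close> uses up \<open>h\<^sub>1\<close> except for
  \<open>2 (m + 1)\<close>, and this remainder must hold the rank \<open>2 \<epsilon> + 1\<close>.
  Two cases stand apart: \<open>d = 3\<close>, where symmetry decides, and \<open>m = 1\<close> with
  \<open>Z = 0\<close>, where the growth argument has nothing to work on and the Hilbert function is
  constant. "General" always means: true at all but finitely many points of each line through a
  point where it is true. For the Perazzo algebra only the upper bound on its Hilbert function is
  proved. Equality comes from the comparison itself, since the other algebra lies below it and
  attains the bound.\<close>

text \<open>
  Definitions made in \<open>vector_space\<close> itself would be captured by its interpretation for real vector
  spaces, whose qualifier is optional.
\<close>

locale vspace = vector_space
begin

text \<open>\<open>dim\<close> is the cardinality of a basis, hence 0 for an infinite one, and the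
  spaces of functions and polynomials below are infinite-dimensional. Dimension counts are guarded
  by this hypothesis.\<close>

definition fin_span :: "'b set \<Rightarrow> bool" where
  "fin_span W \<longleftrightarrow> (\<exists>B. finite B \<and> W \<subseteq> span B)"

lemma fin_span_mono: "fin_span W \<Longrightarrow> W' \<subseteq> W \<Longrightarrow> fin_span W'"
  unfolding fin_span_def by blast

lemma fin_span_basis:
  assumes "fin_span W"
  obtains B where "finite B" "B \<subseteq> W" "independent B" "W \<subseteq> span B" "card B = dim W"
proof -
  obtain B where B: "B \<subseteq> W" "independent B" "W \<subseteq> span B" "card B = dim W"
    using basis_exists by blast
  obtain C where C: "finite C" "W \<subseteq> span C"
    using assms unfolding fin_span_def by blast
  have "finite B"
    using independent_span_bound[OF C(1) B(2)] B(1) C(2) by blast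
  with B that show thesis by blast
qed

lemma independent_card_le_dim_fin:
  assumes "fin_span W" "independent B" "B \<subseteq> W"
  shows "finite B \<and> card B \<le> dim W"
proof -
  obtain C where C: "finite C" "C \<subseteq> W" "independent C" "W \<subseteq> span C" "card C = dim W"
    using fin_span_basis[OF assms(1)] by blast
  then show ?thesis
    using independent_span_bound[OF C(1) assms(2)] assms(3) by auto
qed

lemma dim_mono_fin:
  assumes "fin_span W" "U \<subseteq> W"
  shows "dim U \<le> dim W"
proof -
  obtain B where "B \<subseteq> U" "independent B" "U \<subseteq> span B" "card B = dim U"
    using basis_exists by blast
  then show ?thesis
    using independent_card_le_dim_fin[OF assms(1), of B] assms(2) by auto
qed

lemma dim_eq_0_fin:
  assumes "fin_span W" "dim W = 0"
  shows "W \<subseteq> {0}"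
proof -
  obtain C where "finite C" "C \<subseteq> W" "independent C" "W \<subseteq> span C" "card C = dim W"
    using fin_span_basis[OF assms(1)] by blast
  then show ?thesis using assms(2) by auto
qed

lemma dim_subset_0: "W \<subseteq> {0} \<Longrightarrow> dim W = 0"
  using dim_le_card[of W "{}"] by simp

lemma fin_span_image_span: "finite B \<Longrightarrow> fin_span (span B)"
  unfolding fin_span_def by blast

text \<open>An indexed family rather than a set: vectors moving along a curve may coincide for some
  parameter, and the family then has to count as dependent.\<close>

definition indep_fam :: "nat \<Rightarrow> (nat \<Rightarrow> 'b) \<Rightarrow> bool" where
  "indep_fam R x \<longleftrightarrow> (\<forall>c. (\<Sum>i<R. scale (c i) (x i)) = 0 \<longrightarrow> (\<forall>i<R. c i = 0))"

lemma dim_ge_iff_indep_fam: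
  assumes "fin_span W"
  shows "R \<le> dim W \<longleftrightarrow> (\<exists>x. (\<forall>i<R. x i \<in> W) \<and> indep_fam R x)"
proof
  assume R: "R \<le> dim W"
  obtain B where B: "finite B" "B \<subseteq> W" "independent B" "W \<subseteq> span B" "card B = dim W"
    using fin_span_basis[OF assms] by blast
  obtain x where x: "bij_betw x {..<card B} B"
    using ex_bij_betw_nat_finite[OF B(1)] by (auto simp: atLeast0LessThan)
  have inj: "inj_on x {..<R}"
    using x R B(5) by (metis bij_betw_def inj_on_subset lessThan_subset_iff)
  have im: "x ` {..<R} \<subseteq> B"
    using x R B(5) by (metis bij_betw_def image_mono lessThan_subset_iff)
  have "indep_fam R x"
    unfolding indep_fam_def
  proof (intro allI impI)
    fix c i
    assume c: "(\<Sum>i<R. scale (c i) (x i)) = 0" and i: "i < R"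
    let ?u = "\<lambda>b. c (the_inv_into {..<R} x b)"
    have "(\<Sum>b\<in>x ` {..<R}. scale (?u b) b) = (\<Sum>i<R. scale (c i) (x i))"
      using inj by (simp add: sum.reindex the_inv_into_f_f)
    then have "?u (x i) = 0"
      using independentD[OF B(3) _ im, of ?u "x i"] c i by auto
    then show "c i = 0"
      using inj i by (simp add: the_inv_into_f_f)
  qed
  then show "\<exists>x. (\<forall>i<R. x i \<in> W) \<and> indep_fam R x"
    using im B(2) by blast
next
  assume "\<exists>x. (\<forall>i<R. x i \<in> W) \<and> indep_fam R x"
  then obtain x where x: "\<forall>i<R. x i \<in> W" "indep_fam R x" by blast
  have inj: "inj_on x {..<R}"
  proof (rule inj_onI, rule ccontr)
    fix i j assume ij: "i \<in> {..<R}" "j \<in> {..<R}" "x i = x j" "i \<noteq> j"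
    let ?c = "\<lambda>k. (if k = i then 1 else 0 :: 'a) - (if k = j then 1 else 0)"
    have "(\<Sum>k<R. scale (?c k) (x k)) =
        (\<Sum>k<R. (if k = i then x k else 0) - (if k = j then x k else 0))"
      by (intro sum.cong refl) (auto simp: scale_left_diff_distrib)
    also have "\<dots> = 0"
      using ij by (simp add: sum_subtractf)
    finally have "?c i = 0"
      by (rule x(2)[unfolded indep_fam_def, rule_format]) (use ij(1) in simp)
    then show False using ij(4) by simp
  qed
  have "independent (x ` {..<R})"
  proof (rule independent_if_scalars_zero)
    fix f b
    assume f: "(\<Sum>b\<in>x ` {..<R}. scale (f b) b) = 0" and b: "b \<in> x ` {..<R}"
    then have "(\<Sum>i<R. scale (f (x i)) (x i)) = 0"
      using inj by (simp add: sum.reindex)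
    then have "\<forall>i<R. f (x i) = 0"
      using x(2)[unfolded indep_fam_def, rule_format, of "\<lambda>i. f (x i)"] by blast
    with b show "f b = 0" by blast
  qed simp
  then have "card (x ` {..<R}) \<le> dim W"
    using independent_card_le_dim_fin[OF assms] x(1) by blast
  then show "R \<le> dim W"
    using inj by (simp add: card_image)
qed

end

section \<open>Rank, nullity and finitely spanned images\<close>

locale vspace_pair = vs1: vspace s1 + vs2: vspace s2
  for s1 :: "'a::field \<Rightarrow> 'b::ab_group_add \<Rightarrow> 'b" and s2 :: "'a \<Rightarrow> 'c::ab_group_add \<Rightarrow> 'c"
begin

sublocale vector_space_pair s1 s2 ..

lemma fin_span_image:
  assumes "Vector_Spaces.linear s1 s2 f" "vs1.fin_span W"
  shows "vs2.fin_span (f ` W)"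
proof -
  obtain B where B: "finite B" "W \<subseteq> vs1.span B"
    using assms(2) unfolding vs1.fin_span_def by blast
  show ?thesis
    unfolding vs2.fin_span_def
    using linear_spans_image[OF assms(1) B(2)] B(1) by (intro exI[of _ "f ` B"]) simp
qed

lemma rank_nullity:
  assumes lin: "Vector_Spaces.linear s1 s2 f" and sub: "vs1.subspace W" and fin: "vs1.fin_span W"
  shows "vs1.dim W = vs2.dim (f ` W) + vs1.dim {x \<in> W. f x = 0}"
proof -
  interpret f: Vector_Spaces.linear s1 s2 f by fact
  let ?K = "{x \<in> W. f x = 0}"
  obtain A where A: "finite A" "A \<subseteq> ?K" "vs1.independent A" "?K \<subseteq> vs1.span A" "card A = vs1.dim ?K"
    using vs1.fin_span_basis[OF vs1.fin_span_mono[OF fin, of ?K]] by blast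
  obtain B where B: "A \<subseteq> B" "B \<subseteq> W" "vs1.independent B" "W \<subseteq> vs1.span B"
    using vs1.maximal_independent_subset_extend[of A W] A by blast
  have finB: "finite B" and cardB: "card B = vs1.dim W"
    using vs1.independent_card_le_dim_fin[OF fin B(3,2)] vs1.basis_card_eq_dim[OF B(2,4,3)] by auto
  let ?C = "B - A"
  have indC: "vs1.independent ?C"
    using B(3) vs1.independent_mono by blast
  have spanC: "vs1.span ?C \<subseteq> W"
    using B(2) vs1.span_minimal[OF _ sub, of ?C] by blast
  have inj: "inj_on f (vs1.span ?C)"
  proof (rule f.inj_on_iff_eq_0[THEN iffD2, rule_format])
    fix x assume x: "x \<in> vs1.span ?C" "f x = 0"
    then have xA: "x \<in> vs1.span A" using A(4) spanC by blast
    have "vs1.representation B x = vs1.representation ?C x"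
      by (rule vs1.representation_extend[OF B(3) x(1)]) auto
    moreover have "vs1.representation B x = vs1.representation A x"
      by (rule vs1.representation_extend[OF B(3) xA B(1)])
    ultimately have "vs1.representation A x = (\<lambda>b. 0)"
      using vs1.representation_ne_zero by (metis DiffD2)
    then show "x = 0"
      using vs1.sum_nonzero_representation_eq[OF A(3) xA] by simp
  qed simp
  have ind: "vs2.independent (f ` ?C)"
    by (rule f.independent_injective_image[OF indC inj])
  have "f ` W \<subseteq> vs2.span (f ` B)"
    using linear_spans_image[OF lin B(4)] .
  also have "\<dots> \<subseteq> vs2.span (f ` ?C)"
  proof (rule vs2.span_minimal[OF _ vs2.subspace_span], rule subsetI)
    fix y assume "y \<in> f ` B"
    then obtain b where b: "b \<in> B" "y = f b" by blast
    show "y \<in> vs2.span (f ` ?C)"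
    proof (cases "b \<in> A")
      case True
      then have "y = 0" using A(2) b(2) by blast
      then show ?thesis by (simp add: vs2.span_zero)
    next
      case False
      then show ?thesis using b by (intro vs2.span_base) simp
    qed
  qed
  finally have "card (f ` ?C) = vs2.dim (f ` W)"
    using B(2) by (intro vs2.basis_card_eq_dim ind) auto
  moreover have "card (f ` ?C) = card ?C"
    using inj vs1.span_superset by (intro card_image) (blast intro: inj_on_subset)
  moreover have "card ?C = card B - card A"
    using A(1) B(1) by (simp add: card_Diff_subset)
  moreover have "card A \<le> card B" using B(1) finB card_mono by blast
  ultimately show ?thesis using cardB A(5) by simp
qed

end

section \<open>Functions as vectors, and semicontinuity of rank along polynomial curves\<close>

definition fscale :: "'k::field \<Rightarrow> ('a \<Rightarrow> 'k) \<Rightarrow> 'a \<Rightarrow> 'k" where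
  "fscale c f = (\<lambda>x. c * f x)"

lemma fscale_apply: "fscale c f x = c * f x"
  by (simp add: fscale_def)

lemma sum_fun_apply: "(\<Sum>i\<in>A. f i) x = (\<Sum>i\<in>A. f i x :: 'k::comm_monoid_add)"
  by (induction A rule: infinite_finite_induct) auto

text \<open>Ranks are measured in spaces of scalar-valued functions: a class in a quotient is
  replaced by the function that it induces by pairing.\<close>

global_interpretation fn: vspace "fscale :: 'k::field \<Rightarrow> ('a \<Rightarrow> 'k) \<Rightarrow> _"
  by standard (auto simp: fun_eq_iff fscale_apply algebra_simps)

text \<open>Polynomial at each point \<open>q\<close> separately, without a common bound on the
  degrees: a rank condition involves finitely many points only.\<close>

definition poly_curve :: "('k::field \<Rightarrow> 'a \<Rightarrow> 'k) \<Rightarrow> bool" where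
  "poly_curve v \<longleftrightarrow> (\<forall>q. \<exists>p. \<forall>t. v t q = poly p t)"

lemma poly_curve_diff: "poly_curve v \<Longrightarrow> poly_curve w \<Longrightarrow> poly_curve (\<lambda>t r. v t r - w t r)"
  unfolding poly_curve_def by (metis poly_diff)

lemma poly_curve_mult: "poly_curve (\<lambda>t r. v t q) \<Longrightarrow> poly_curve w \<Longrightarrow> poly_curve (\<lambda>t r. v t q * w t r)"
  unfolding poly_curve_def by (metis poly_mult)

lemma fn_indep_fam_iff:
  "fn.indep_fam R x \<longleftrightarrow> (\<forall>c. (\<forall>q. (\<Sum>i<R. c i * x i q) = 0) \<longrightarrow> (\<forall>i<R. c i = 0))"
  by (simp add: fn.indep_fam_def fun_eq_iff sum_fun_apply fscale_apply)

text \<open>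
  Induction step: if the last vector does not vanish at the point \<open>q\<close>, subtracting multiples of it
  from the others makes these vanish at \<open>q\<close>.
\<close>

lemma indep_fam_cofinite:
  fixes v :: "nat \<Rightarrow> 'k::field \<Rightarrow> 'a \<Rightarrow> 'k"
  assumes "\<And>i. i < R \<Longrightarrow> poly_curve (v i)" "fn.indep_fam R (\<lambda>i. v i t0)"
  shows "finite {t. \<not> fn.indep_fam R (\<lambda>i. v i t)}"
  using assms
proof (induction R arbitrary: v)
  case 0
  then show ?case by (simp add: fn_indep_fam_iff)
next
  case (Suc R)
  have "\<exists>q. v R t0 q \<noteq> 0"
  proof (rule ccontr)
    assume "\<nexists>q. v R t0 q \<noteq> 0"
    then have "\<forall>q. (\<Sum>i<Suc R. (if i = R then 1 else 0) * v i t0 q) = 0"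
      by (simp add: if_distribR if_distrib cong: if_cong)
    then show False
      using Suc.prems(2)[unfolded fn_indep_fam_iff, rule_format, of
          "\<lambda>i. if i = R then 1 else 0" R] by simp
  qed
  then obtain q where q: "v R t0 q \<noteq> 0" by blast
  define w where "w i t = (\<lambda>r. v R t q * v i t r - v i t q * v R t r)" for i t
  have elim: "(\<Sum>i<R. c i * w i t r) =
      v R t q * (\<Sum>i<Suc R. c i * v i t r) - (\<Sum>i<Suc R. c i * v i t q) * v R t r" for c t r
    unfolding w_def by (simp add: algebra_simps sum_subtractf sum_distrib_left sum_distrib_right)
  have "finite {t. \<not> fn.indep_fam R (\<lambda>i. w i t)}"
  proof (rule Suc.IH)
    fix i assume "i < R"
    then have "poly_curve (v i)" "poly_curve (v R)" using Suc.prems(1) by auto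
    then show "poly_curve (w i)"
      unfolding w_def by (intro poly_curve_diff poly_curve_mult) (auto simp: poly_curve_def)
  next
    show "fn.indep_fam R (\<lambda>i. w i t0)"
      unfolding fn_indep_fam_iff
    proof (intro allI impI)
      fix c i assume c: "\<forall>r. (\<Sum>i<R. c i * w i t0 r) = 0" and i: "i < R"
      let ?d = "\<lambda>i. if i < R then v R t0 q * c i else - (\<Sum>i<R. c i * v i t0 q)"
      have "(\<Sum>i<Suc R. ?d i * v i t0 r) = (\<Sum>i<R. c i * w i t0 r)" for r
        unfolding w_def
        by (simp add: algebra_simps sum_subtractf sum_distrib_left sum_distrib_right)
      then have "?d i = 0"
        using c i Suc.prems(2)[unfolded fn_indep_fam_iff, rule_format, of ?d i] by simp
      then show "c i = 0" using q i by simp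
    qed
  qed
  moreover have "finite {t. v R t q = 0}"
  proof -
    obtain p where p: "\<forall>t. v R t q = poly p t"
      using Suc.prems(1)[of R] unfolding poly_curve_def by blast
    then have "p \<noteq> 0" using q by auto
    then show ?thesis using poly_roots_finite p by simp
  qed
  moreover have "{t. \<not> fn.indep_fam (Suc R) (\<lambda>i. v i t)} \<subseteq>
      {t. \<not> fn.indep_fam R (\<lambda>i. w i t)} \<union> {t. v R t q = 0}"
  proof (rule subsetI, rule ccontr)
    fix t assume t: "t \<in> {t. \<not> fn.indep_fam (Suc R) (\<lambda>i. v i t)}"
      "t \<notin> {t. \<not> fn.indep_fam R (\<lambda>i. w i t)} \<union> {t. v R t q = 0}"
    have "c i = 0" if c: "\<forall>r. (\<Sum>i<Suc R. c i * v i t r) = 0" and i: "i < Suc R" for c i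
    proof -
      have "\<forall>r. (\<Sum>i<R. c i * w i t r) = 0" using c elim by simp
      then have 0: "\<forall>i<R. c i = 0" using t(2) unfolding fn_indep_fam_iff by blast
      moreover have "c R = 0" using 0 c[rule_format, of q] t(2) by simp
      ultimately show ?thesis using i less_Suc_eq by auto
    qed
    then show False using t(1) unfolding fn_indep_fam_iff by blast
  qed
  ultimately show ?case by (meson finite_UnI finite_subset)
qed

text \<open>Lower semicontinuity of the rank: \<open>R\<close> elements with independent images at
  \<open>t0\<close> keep independent images at all but finitely many \<open>t\<close>.\<close>

lemma dim_ge_cofinite:
  fixes L :: "'k::field \<Rightarrow> 'b \<Rightarrow> 'a \<Rightarrow> 'k"
  assumes "\<And>t. fn.fin_span (L t ` X)" "\<And>x. x \<in> X \<Longrightarrow> poly_curve (\<lambda>t. L t x)" "R \<le> fn.dim (L t0 ` X)"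
  shows "finite {t. \<not> R \<le> fn.dim (L t ` X)}"
proof -
  obtain y where y: "\<forall>i<R. y i \<in> L t0 ` X" "fn.indep_fam R y"
    using assms(3) fn.dim_ge_iff_indep_fam[OF assms(1)] by blast
  then have "\<forall>i. \<exists>x. i < R \<longrightarrow> x \<in> X \<and> y i = L t0 x" by blast
  then obtain x where x: "\<And>i. i < R \<Longrightarrow> x i \<in> X" "\<And>i. i < R \<Longrightarrow> y i = L t0 (x i)" by metis
  have "fn.indep_fam R (\<lambda>i. L t0 (x i))"
    using y(2) x(2) by (simp add: fn.indep_fam_def)
  then have "finite {t. \<not> fn.indep_fam R (\<lambda>i. L t (x i))}"
    using x(1) assms(2) by (intro indep_fam_cofinite[where ?t0.0 = t0]) auto
  moreover have "{t. \<not> R \<le> fn.dim (L t ` X)} \<subseteq> {t. \<not> fn.indep_fam R (\<lambda>i. L t (x i))}"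
  proof (rule Collect_mono, rule impI, erule contrapos_nn)
    fix t assume "fn.indep_fam R (\<lambda>i. L t (x i))"
    then show "R \<le> fn.dim (L t ` X)"
      unfolding fn.dim_ge_iff_indep_fam[OF assms(1)] using x(1)
      by (intro exI[of _ "\<lambda>i. L t (x i)"]) simp
  qed
  ultimately show ?thesis by (rule rev_finite_subset)
qed

context vspace
begin

sublocale fnp: vspace_pair scale fscale ..

lemma linear_fnI:
  assumes "\<And>x y q. f (x + y) q = f x q + f y q" "\<And>c x q. f (scale c x) q = c * f x q"
  shows "Vector_Spaces.linear scale fscale f"
  using assms
  by (intro Vector_Spaces.linear_iff[THEN iffD2])
    (auto simp: fun_eq_iff fscale_apply vector_space_axioms fn.vector_space_axioms)

text \<open>By rank-nullity the rank depends on the kernel alone. This permits changing the set of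
  points on which the functions are tested.\<close>

lemma rank_eq_of_kernel_eq:
  fixes f :: "'b \<Rightarrow> 'i \<Rightarrow> 'a" and g :: "'b \<Rightarrow> 'j \<Rightarrow> 'a"
  assumes "Vector_Spaces.linear scale fscale f" "Vector_Spaces.linear scale fscale g"
    and "subspace W" "fin_span W" and "\<And>x. x \<in> W \<Longrightarrow> f x = 0 \<longleftrightarrow> g x = 0"
  shows "fn.dim (f ` W) = fn.dim (g ` W)"
proof -
  have "{x \<in> W. f x = 0} = {x \<in> W. g x = 0}" using assms(5) by blast
  then show ?thesis
    using fnp.rank_nullity[OF assms(1,3,4)] fnp.rank_nullity[OF assms(2,3,4)] by simp
qed

text \<open>Finite differences \<open>p(2t) - 2\<^sup>N p(t)\<close> lower the degree.\<close>

lemma coeffs_in_subspace: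
  fixes u :: "nat \<Rightarrow> 'b"
  assumes char0: "\<And>m n :: nat. (of_nat m :: 'a) = of_nat n \<longleftrightarrow> m = n"
    and sub: "subspace R" and "\<And>t. (\<Sum>i\<le>N. scale (t ^ i) (u i)) \<in> R" and "i \<le> N"
  shows "u i \<in> R"
  using assms(3,4)
proof (induction N arbitrary: u i)
  case 0
  from 0(1)[of 0] 0(2) show ?case by simp
next
  case (Suc N)
  have two: "(2 :: 'a) ^ k = of_nat (2 ^ k)" for k by simp
  define w where "w k = scale (2 ^ k - 2 ^ Suc N) (u k)" for k
  have w: "w k \<in> R" if "k \<le> N" for k
  proof (rule Suc.IH[OF _ that])
    fix t
    have "(\<Sum>i\<le>N. scale (t ^ i) (w i)) = (\<Sum>i\<le>Suc N. scale (t ^ i) (w i))"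
      by (simp add: w_def)
    also have "\<dots> = (\<Sum>i\<le>Suc N. scale ((2 * t) ^ i) (u i) - scale (2 ^ Suc N) (scale (t ^ i) (u i)))"
    proof (rule sum.cong[OF refl])
      fix i
      have "t ^ i * (2 ^ i - 2 ^ Suc N) = (2 * t) ^ i - 2 ^ Suc N * t ^ i"
        by (simp add: power_mult_distrib algebra_simps)
      then show "scale (t ^ i) (w i) = scale ((2 * t) ^ i) (u i) - scale (2 ^ Suc N) (scale
          (t ^ i) (u i))"
        by (simp only: w_def scale_scale scale_left_diff_distrib[symmetric])
    qed
    also have "\<dots> = (\<Sum>i\<le>Suc N. scale ((2 * t) ^ i) (u i)) -
        scale (2 ^ Suc N) (\<Sum>i\<le>Suc N. scale (t ^ i) (u i))"
      by (simp only: sum_subtractf scale_sum_right)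
    also have "\<dots> \<in> R"
      by (intro subspace_diff sub subspace_scale Suc.prems(1))
    finally show "(\<Sum>i\<le>N. scale (t ^ i) (w i)) \<in> R" .
  qed
  have low: "u k \<in> R" if "k \<le> N" for k
  proof -
    have "(2 :: 'a) ^ k \<noteq> 2 ^ Suc N"
      unfolding two char0 using that
          by (metis Suc_n_not_le_n one_less_numeral_iff power_inject_exp semiring_norm(76))
    then have "scale (inverse (2 ^ k - 2 ^ Suc N)) (w k) = u k"
      unfolding w_def by simp
    then show ?thesis using subspace_scale[OF sub w[OF that]] by metis
  qed
  have "u (Suc N) = (\<Sum>i\<le>Suc N. scale (1 ^ i) (u i)) - (\<Sum>i\<le>N. u i)"
    by simp
  also have "\<dots> \<in> R"
    using low by (intro subspace_diff sub Suc.prems(1) subspace_sum) auto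
  finally show ?case
    using low Suc.prems(2) le_Suc_eq by auto
qed

end

section \<open>Row rank and column rank\<close>

context vspace_pair
begin

text \<open>Take a basis of the rows, realised by elements \<open>z c\<close> of \<open>X\<close>.
  Testing \<open>y\<close> against these finitely many elements has the same kernel as testing
  against all of \<open>X\<close>, and its rank is at most their number.\<close>

lemma bilinear_rank_le:
  fixes B :: "'b \<Rightarrow> 'c \<Rightarrow> 'a"
  assumes add1: "\<And>x x' y. B (x + x') y = B x y + B x' y" and sc1: "\<And>c x y. B (s1 c x) y = c * B x y"
    and add2: "\<And>x y y'. B x (y + y') = B x y + B x y'" and sc2: "\<And>c x y. B x (s2 c y) = c * B x y"
    and X: "vs1.fin_span X" and Y: "vs2.subspace Y" "vs2.fin_span Y"
  shows "fn.dim ((\<lambda>y x. if x \<in> X then B x y else 0) ` Y)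
    \<le> fn.dim ((\<lambda>x y. if y \<in> Y then B x y else 0) ` X)"
proof -
  let ?f = "\<lambda>x y. if y \<in> Y then B x y else 0" and ?g = "\<lambda>y x. if x \<in> X then B x y else 0"
  have "fn.fin_span (?f ` X)"
    by (rule vs1.fnp.fin_span_image[OF vs1.linear_fnI X]) (auto simp: add1 sc1)
  then obtain C where C: "finite C" "C \<subseteq> ?f ` X" "fn.independent C" "?f ` X \<subseteq> fn.span C"
      "card C = fn.dim (?f ` X)"
    using fn.fin_span_basis by blast
  then have "\<forall>c\<in>C. \<exists>x\<in>X. c = ?f x" by blast
  then obtain z where z: "\<And>c. c \<in> C \<Longrightarrow> z c \<in> X" "\<And>c. c \<in> C \<Longrightarrow> c = ?f (z c)" by metis
  let ?M = "\<lambda>y c. if c \<in> C then B (z c) y else 0"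
  have "fn.dim (?g ` Y) = fn.dim (?M ` Y)"
  proof (rule vs2.rank_eq_of_kernel_eq[OF _ _ Y])
    fix y assume y: "y \<in> Y"
    show "?g y = 0 \<longleftrightarrow> ?M y = 0"
    proof
      assume g: "?g y = 0"
      show "?M y = 0"
      proof
        fix c show "?M y c = 0 c"
          using z(1)[of c] fun_cong[OF g, of "z c"] by auto
      qed
    next
      assume M: "?M y = 0"
      have C0: "C \<subseteq> {h. h y = 0}"
      proof
        fix c assume c: "c \<in> C"
        have "c y = ?f (z c) y" using z(2)[OF c] by metis
        also have "\<dots> = 0" using fun_cong[OF M, of c] c y by simp
        finally show "c \<in> {h. h y = 0}" by simp
      qed
      have sub: "fn.subspace {h. h y = 0}"
        by (rule fn.subspaceI) (auto simp: fscale_apply)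
      show "?g y = 0"
      proof
        fix x
        have "x \<in> X \<Longrightarrow> ?f x \<in> fn.span C" using C(4) by blast
        then have "x \<in> X \<Longrightarrow> ?f x y = 0"
          using fn.span_minimal[OF C0 sub] by blast
        then show "?g y x = 0 x" using y by simp
      qed
    qed
  qed (auto intro!: vs2.linear_fnI simp: add2 sc2)
  also have "\<dots> \<le> card ((\<lambda>c d. if d = c then 1 else 0 :: 'a) ` C)"
  proof (rule fn.dim_le_card, rule subsetI)
    fix h assume "h \<in> ?M ` Y"
    then obtain y where h: "h = ?M y" by blast
    have "h = (\<Sum>c\<in>C. fscale (h c) (\<lambda>d. if d = c then 1 else 0))"
    proof
      fix d
      have "(\<Sum>c\<in>C. h c * (if d = c then 1 else 0)) = (if d \<in> C then h d else 0)"
        using C(1) by (simp add: if_distrib cong: if_cong)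
      then show "h d = (\<Sum>c\<in>C. fscale (h c) (\<lambda>d. if d = c then 1 else 0)) d"
        by (simp add: sum_fun_apply fscale_apply h)
    qed
    also have "\<dots> \<in> fn.span ((\<lambda>c d. if d = c then 1 else 0 :: 'a) ` C)"
      by (intro fn.span_sum fn.span_scale fn.span_base) blast
    finally show "h \<in> fn.span ((\<lambda>c d. if d = c then 1 else 0 :: 'a) ` C)" .
  qed (use C(1) in simp)
  also have "\<dots> \<le> card C" using C(1) by (rule card_image_le)
  finally show ?thesis using C(5) by simp
qed

end

lemma (in vspace_pair) bilinear_rank_eq:
  fixes B :: "'b \<Rightarrow> 'c \<Rightarrow> 'a"
  assumes add1: "\<And>x x' y. B (x + x') y = B x y + B x' y" and sc1: "\<And>c x y. B (s1 c x) y = c * B x y"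
    and add2: "\<And>x y y'. B x (y + y') = B x y + B x y'" and sc2: "\<And>c x y. B x (s2 c y) = c * B x y"
    and X: "vs1.subspace X" "vs1.fin_span X" and Y: "vs2.subspace Y" "vs2.fin_span Y"
  shows "fn.dim ((\<lambda>y x. if x \<in> X then B x y else 0) ` Y)
    = fn.dim ((\<lambda>x y. if y \<in> Y then B x y else 0) ` X)"
proof (rule antisym)
  interpret sw: vspace_pair s2 s1 ..
  show "fn.dim ((\<lambda>x y. if y \<in> Y then B x y else 0) ` X)
    \<le> fn.dim ((\<lambda>y x. if x \<in> X then B x y else 0) ` Y)"
    by (rule sw.bilinear_rank_le) (auto simp: assms)
qed (rule bilinear_rank_le; auto simp: assms)

text \<open>The Cauchy product, for an operator polynomial \<open>\<Sum> t ^ j L j\<close> applied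
  to a vector polynomial \<open>\<Sum> t ^ i y i\<close>.\<close>

lemma sum_mult_regroup:
  fixes a :: "nat \<Rightarrow> nat \<Rightarrow> 'k::comm_ring_1"
  assumes "\<And>j i. j > N \<Longrightarrow> a j i = 0" "\<And>j i. i > K \<Longrightarrow> a j i = 0"
  shows "(\<Sum>j\<le>N. \<Sum>i\<le>K. t ^ (i + j) * a j i) = (\<Sum>k\<le>N+K. t ^ k * (\<Sum>j\<le>k. a j (k - j)))"
proof -
  have "(\<Sum>j\<le>N. \<Sum>i\<le>K. t ^ (i + j) * a j i) = (\<Sum>(j, i)\<in>{..N} \<times> {..K}. t ^ (i + j) * a j i)"
    by (simp add: sum.cartesian_product)
  also have "\<dots> = (\<Sum>(j, i)\<in>{(j, i). j + i \<le> N + K}. t ^ (i + j) * a j i)"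
  proof (rule sum.mono_neutral_left)
    have "{(j, i). j + i \<le> N + K} \<subseteq> {..N+K} \<times> {..N+K}" by auto
    then show "finite {(j, i). j + i \<le> N + K}" by (rule finite_subset) simp
  next
    show "\<forall>x\<in>{(j, i). j + i \<le> N + K} - {..N} \<times> {..K}. (case x of (j, i) \<Rightarrow> t ^ (i + j) * a j i) = 0"
    proof
      fix x assume x: "x \<in> {(j, i). j + i \<le> N + K} - {..N} \<times> {..K}"
      obtain j i where ji: "x = (j, i)" by (cases x)
      with x have "j > N \<or> i > K" by auto
      then show "(case x of (j, i) \<Rightarrow> t ^ (i + j) * a j i) = 0" using assms ji by auto
    qed
  qed auto
  also have "\<dots> = (\<Sum>k\<le>N+K. \<Sum>j\<le>k. t ^ (k - j + j) * a j (k - j))"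
    by (rule sum.triangle_reindex_eq)
  also have "\<dots> = (\<Sum>k\<le>N+K. t ^ k * (\<Sum>j\<le>k. a j (k - j)))"
    by (intro sum.cong refl) (simp add: sum_distrib_left)
  finally show ?thesis .
qed

section \<open>Extending a kernel vector along a polynomial family of maps\<close>

context vspace
begin

text \<open>
  If the next obstruction were outside the image of \<open>L 0\<close>, the curve \<open>t \<mapsto> L(t) (\<Sum> t\<^sup>i y\<^sub>i)\<close>,
  divided by \<open>t\<^sup>K\<^sup>+\<^sup>1\<close>, would raise the rank of \<open>L(t)\<close> above its value at \<open>t = 0\<close>.
\<close>

lemma kernel_chain:
  fixes L :: "nat \<Rightarrow> 'b \<Rightarrow> 'i \<Rightarrow> 'a"
  assumes inf: "infinite (UNIV :: 'a set)"
    and lin: "\<And>j. Vector_Spaces.linear scale fscale (L j)"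
    and L0: "\<And>j x. j > N \<Longrightarrow> L j x = 0"
    and X: "subspace X" "fin_span X"
    and rank: "\<And>t. fn.dim ((\<lambda>x q. \<Sum>j\<le>N. t ^ j * L j x q) ` X) \<le> fn.dim (L 0 ` X)"
    and z: "z \<in> X" "L 0 z = 0"
  shows "\<exists>y. y 0 = z \<and> (\<forall>k. y k \<in> X) \<and> (\<forall>k\<le>K. \<forall>q. (\<Sum>j\<le>k. L j (y (k - j)) q) = 0)"
proof (induction K)
  case 0
  show ?case
    by (rule exI[of _ "\<lambda>_. z"]) (use z in auto)
next
  case (Suc K)
  then obtain y0 where y0: "y0 0 = z" "\<And>k. y0 k \<in> X"
    "\<And>k q. k \<le> K \<Longrightarrow> (\<Sum>j\<le>k. L j (y0 (k - j)) q) = 0" by blast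
  \<comment> \<open>Cut off after \<open>K\<close>, so that the coefficients of the image vanish up
    to \<open>K\<close> and the first obstruction is \<open>c (Suc K)\<close>.\<close>
  define y where "y = (\<lambda>k. if k \<le> K then y0 k else 0)"
  have yX: "y k \<in> X" for k using y0(2) subspace_0[OF X(1)] by (simp add: y_def)
  define c where "c k q = (\<Sum>j\<le>k. L j (y (k - j)) q)" for k q
  have c0: "c k q = 0" if "k \<le> K" for k q
  proof -
    have "c k q = (\<Sum>j\<le>k. L j (y0 (k - j)) q)"
      unfolding c_def y_def using that by (intro sum.cong refl) auto
    then show ?thesis using y0(3)[OF that] by simp
  qed
  define Lt where "Lt t = (\<lambda>x q. \<Sum>j\<le>N. t ^ j * L j x q)" for t
  note ladd = module_hom.add[OF Vector_Spaces.linear.axioms(3)[OF lin]]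
  note lscale = module_hom.scale[OF Vector_Spaces.linear.axioms(3)[OF lin]]
  note lsum = module_hom.sum[OF Vector_Spaces.linear.axioms(3)[OF lin]]
  have Lt_lin: "Vector_Spaces.linear scale fscale (Lt t)" for t
    by (rule linear_fnI)
      (auto simp: Lt_def ladd lscale fscale_apply algebra_simps sum.distrib sum_distrib_left)
  have Lt0: "Lt 0 = L 0"
    by (intro ext) (simp add: Lt_def power_0_left if_distrib if_distribR cong: if_cong)
  define g where "g t q = (\<Sum>k\<le>N+K. if k \<le> K then 0 else t ^ (k - Suc K) * c k q)" for t q
  have Lt_sum: "Lt t (\<Sum>i\<le>K. scale (t ^ i) (y i)) q = t ^ Suc K * g t q" for t q
  proof -
    have "Lt t (\<Sum>i\<le>K. scale (t ^ i) (y i)) q = (\<Sum>j\<le>N. \<Sum>i\<le>K. t ^ (i + j) * L j (y i) q)"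
      by (simp add: Lt_def lsum lscale sum_fun_apply fscale_apply sum_distrib_left power_add
          mult_ac)
    also have "\<dots> = (\<Sum>k\<le>N+K. t ^ k * c k q)"
      unfolding c_def
      by (rule sum_mult_regroup)
        (auto simp: L0 y_def module_hom.zero[OF Vector_Spaces.linear.axioms(3)[OF lin]])
    also have "\<dots> = t ^ Suc K * g t q"
      unfolding g_def sum_distrib_left
    proof (rule sum.cong[OF refl])
      fix k
      show "t ^ k * c k q = t ^ Suc K * (if k \<le> K then 0 else t ^ (k - Suc K) * c k q)"
      proof (cases "k \<le> K")
        case False
        then have "t ^ k = t ^ Suc K * t ^ (k - Suc K)"
          by (metis le_add_diff_inverse not_less_eq_eq power_add)
        then show ?thesis using False by simp
      qed (simp add: c0)
    qed
    finally show ?thesis .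
  qed
  have g_in: "g t \<in> Lt t ` X" if "t \<noteq> 0" for t
  proof -
    let ?x = "scale (inverse (t ^ Suc K)) (\<Sum>i\<le>K. scale (t ^ i) (y i))"
    have "?x \<in> X" by (intro subspace_scale subspace_sum X yX)
    moreover have "Lt t ?x = g t"
    proof
      fix q
      have "Lt t ?x q = inverse (t ^ Suc K) * (t ^ Suc K * g t q)"
        by (simp only: module_hom.scale[OF Vector_Spaces.linear.axioms(3)[OF Lt_lin]] fscale_apply
            Lt_sum)
      then show "Lt t ?x q = g t q"
        using that by (simp add: mult.assoc[symmetric] del: power_Suc)
    qed
    ultimately show ?thesis by (rule rev_image_eqI[OF _ sym])
  qed
  have finL: "fn.fin_span (Lt t ` X)" for t
    using fnp.fin_span_image[OF Lt_lin X(2)] .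
  have "g 0 \<in> Lt 0 ` X"
  proof (rule ccontr)
    assume notin: "g 0 \<notin> Lt 0 ` X"
    define R where "R = fn.dim (Lt 0 ` X)"
    obtain w where w: "\<forall>i<R. w i \<in> Lt 0 ` X" "fn.indep_fam R w"
      using fn.dim_ge_iff_indep_fam[OF finL, of R] R_def by blast
    then have "\<forall>i. \<exists>x. i < R \<longrightarrow> x \<in> X \<and> w i = Lt 0 x" by blast
    then obtain x where x: "\<And>i. i < R \<Longrightarrow> x i \<in> X" "\<And>i. i < R \<Longrightarrow> w i = Lt 0 (x i)" by metis
    define v where "v i t = (if i < R then Lt t (x i) else g t)" for i t
    have "fn.indep_fam (Suc R) (\<lambda>i. v i 0)"
      unfolding fn.indep_fam_def
    proof (intro allI impI)
      fix a i assume a: "(\<Sum>i<Suc R. fscale (a i) (v i 0)) = 0" and i: "i < Suc R"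
      have eq: "(\<Sum>i<R. fscale (a i) (w i)) + fscale (a R) (g 0) = 0"
        using a x(2) by (simp add: v_def)
      have "a R = 0"
      proof (rule ccontr)
        assume aR: "a R \<noteq> 0"
        have "g 0 = fscale (- inverse (a R)) (\<Sum>i<R. fscale (a i) (w i))"
        proof
          fix q
          have "(\<Sum>i<R. fscale (a i) (w i)) q + a R * g 0 q = 0"
            using fun_cong[OF eq, of q] by (simp add: fscale_apply)
          then show "g 0 q = fscale (- inverse (a R)) (\<Sum>i<R. fscale (a i) (w i)) q"
            using aR by (simp add: fscale_apply field_simps add_eq_0_iff)
        qed
        also have "\<dots> \<in> Lt 0 ` X"
          by (intro fn.subspace_scale fn.subspace_sum)
            (use w(1) in \<open>auto intro!: fn.subspace_scale
              module_hom.subspace_image[OF Vector_Spaces.linear.axioms(3)[OF Lt_lin] X(1)]\<close>)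
        finally show False using notin by blast
      qed
      moreover have "(\<Sum>i<R. fscale (a i) (w i)) = 0"
        using eq calculation by (simp add: fn.scale_zero_left)
      ultimately show "a i = 0"
        using w(2) i unfolding fn.indep_fam_def by (metis less_antisym)
    qed
    moreover have "poly_curve (v i)" for i
    proof -
      have "\<exists>p. \<forall>t. Lt t (x i) q = poly p t" for q
        by (rule exI[of _ "\<Sum>j\<le>N. monom (L j (x i) q) j"])
          (simp add: Lt_def poly_sum poly_monom mult.commute)
      moreover have "\<exists>p. \<forall>t. g t q = poly p t" for q
        by (rule exI[of _ "\<Sum>k\<le>N+K. if k \<le> K then 0 else monom (c k q) (k - Suc K)"])
          (auto simp: g_def poly_sum poly_monom mult.commute intro!: sum.cong)
      ultimately show ?thesis
        by (cases "i < R") (simp_all add: poly_curve_def v_def)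
    qed
    ultimately have "finite {t. \<not> fn.indep_fam (Suc R) (\<lambda>i. v i t)}"
      by (intro indep_fam_cofinite)
    then have "finite (insert 0 {t. \<not> fn.indep_fam (Suc R) (\<lambda>i. v i t)})" by simp
    then obtain t where t: "t \<noteq> 0" "fn.indep_fam (Suc R) (\<lambda>i. v i t)"
      using inf by (metis (mono_tags, lifting) ex_new_if_finite insertI1 insertI2 mem_Collect_eq)
    then have "Suc R \<le> fn.dim (Lt t ` X)"
      unfolding fn.dim_ge_iff_indep_fam[OF finL]
      using x(1) g_in by (intro exI[of _ "\<lambda>i. v i t"]) (auto simp: v_def)
    then show False
      using rank[folded Lt_def, of t] unfolding R_def Lt0 by simp
  qed
  \<comment> \<open>For \<open>N = 0\<close> the sum in \<open>g\<close> ends at \<open>K\<close>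
    and misses the index \<open>Suc K\<close>; there \<open>c (Suc K)\<close> vanishes because
    \<open>L 0\<close> is applied to \<open>y (Suc K) = 0\<close>.\<close>
  moreover have g0: "g 0 q = c (Suc K) q" for q
  proof (cases "N = 0")
    case True
    have "c (Suc K) q = 0"
      unfolding c_def
    proof (rule sum.neutral, rule ballI)
      fix j
      show "L j (y (Suc K - j)) q = 0"
        by (cases j) (simp_all add: y_def L0 True module_hom.zero[OF
            Vector_Spaces.linear.axioms(3)[OF lin]])
    qed
    then show ?thesis by (simp add: g_def True)
  next
    case False
    have "g 0 q = (\<Sum>k\<le>N+K. if k = Suc K then c k q else 0)"
      unfolding g_def
      by (intro sum.cong refl) (auto simp: power_0_left dest: le_antisym)
    also have "\<dots> = c (Suc K) q"
      using False by simp
    finally show ?thesis .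
  qed
  ultimately have "c (Suc K) \<in> L 0 ` X"
    unfolding Lt0 by (metis ext)
  then obtain x where x: "x \<in> X" "c (Suc K) = L 0 x" by blast
  \<comment> \<open>Since \<open>L 0 x\<close> is the obstruction, the new entry \<open>- x\<close>
    cancels it and leaves the earlier equations alone.\<close>
  define y' where "y' = y(Suc K := - x)"
  have "(\<Sum>j\<le>k. L j (y' (k - j)) q) = 0" if "k \<le> Suc K" for k q
  proof (cases "k = Suc K")
    case False
    then have "(\<Sum>j\<le>k. L j (y' (k - j)) q) = c k q"
      unfolding c_def y'_def using that by (intro sum.cong refl) auto
    then show ?thesis using c0[of k q] that False by simp
  next
    case True
    have "(\<Sum>j\<le>k. L j (y' (k - j)) q) = L 0 (- x) q + (\<Sum>j\<le>K. L (Suc j) (y' (K - j)) q)"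
      unfolding True by (subst sum.atMost_Suc_shift) (simp add: y'_def)
    also have "(\<Sum>j\<le>K. L (Suc j) (y' (K - j)) q) = (\<Sum>j\<le>K. L (Suc j) (y (K - j)) q)"
      by (intro sum.cong refl) (auto simp: y'_def)
    also have "\<dots> = c (Suc K) q"
      unfolding c_def
      by (subst sum.atMost_Suc_shift)
        (simp add: y_def module_hom.zero[OF Vector_Spaces.linear.axioms(3)[OF lin]])
    finally show ?thesis
      by (simp add: x(2) module_hom.neg[OF Vector_Spaces.linear.axioms(3)[OF lin]])
  qed
  moreover have "y' 0 = z" using y0(1) by (simp add: y'_def y_def)
  moreover have "y' k \<in> X" for k
    using yX x(1) subspace_neg[OF X(1)] by (simp add: y'_def)
  ultimately show ?case by blast
qed

end

section \<open>Graded algebras and graded functionals\<close>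

text \<open>The homogeneous pieces of a polynomial ring, kept as subsets of one ring. Generation by
  \<open>S 1\<close> is what inductions on the degree and polarization rest on.\<close>

locale standard_graded = vspace scale
  for scale :: "'k::field_char_0 \<Rightarrow> 's::comm_ring_1 \<Rightarrow> 's" +
  fixes S :: "nat \<Rightarrow> 's set"
  assumes scale_mult: "scale c x * y = scale c (x * y)"
    and S_0: "S 0 = span {1}"
    and S_Suc: "S (Suc i) = span {a * s | a s. a \<in> S 1 \<and> s \<in> S i}"
    and fin_S1: "fin_span (S 1)"
begin

lemma mult_scale: "x * scale c y = scale c (x * y)"
  using scale_mult[of c y x] by (simp add: mult.commute)

lemma linear_mult: "Vector_Spaces.linear scale scale ((*) a)"
  by (intro Vector_Spaces.linear_iff[THEN iffD2])
    (simp add: vector_space_axioms distrib_left mult_scale)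

lemma subspace_S [simp]: "subspace (S i)"
proof (cases i)
  case 0
  show ?thesis unfolding 0 S_0 by (rule subspace_span)
next
  case (Suc j)
  show ?thesis unfolding Suc S_Suc[of j] by (rule subspace_span)
qed

lemma S_mult_Suc: "a \<in> S 1 \<Longrightarrow> s \<in> S i \<Longrightarrow> a * s \<in> S (Suc i)"
  unfolding S_Suc by (rule span_base) blast

lemma span_times:
  assumes "x \<in> span A" "y \<in> span B"
  shows "x * y \<in> span {a * b | a b. a \<in> A \<and> b \<in> B}" (is "_ \<in> span ?P")
proof -
  have "a * y \<in> span ?P" if "a \<in> A" for a
    using assms(2)
  proof (induction rule: span_induct)
    case base
    show ?case by (rule subspaceI) (auto simp: span_zero span_add span_scale distrib_left
        mult_scale)
  next
    case (step b)
    then show ?case using that by (intro span_base) blast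
  qed
  with assms(1) show ?thesis
  proof (induction rule: span_induct)
    case base
    show ?case by (rule subspaceI) (auto simp: span_zero span_add span_scale distrib_right
        scale_mult)
  qed blast
qed

lemma fin_span_times:
  assumes "fin_span U" "fin_span W"
  shows "fin_span (span {a * b | a b. a \<in> U \<and> b \<in> W})"
proof -
  obtain A B where AB: "finite A" "U \<subseteq> span A" "finite B" "W \<subseteq> span B"
    using assms unfolding fin_span_def by blast
  let ?P = "{a * b | a b. a \<in> A \<and> b \<in> B}"
  have "?P = (\<lambda>(a, b). a * b) ` (A \<times> B)" by auto
  then have "finite ?P" using AB by simp
  moreover have "span {a * b | a b. a \<in> U \<and> b \<in> W} \<subseteq> span ?P"
    using AB span_times by (intro span_minimal) blast+
  ultimately show ?thesis unfolding fin_span_def by blast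
qed

lemma fin_S [simp]: "fin_span (S i)"
proof (induction i)
  case 0
  show ?case by (simp add: S_0 fin_span_image_span)
next
  case (Suc i)
  then show ?case unfolding S_Suc by (rule fin_span_times[OF fin_S1])
qed

lemma S_induct [consumes 1, case_names sub prod]:
  assumes "s \<in> S (Suc i)" "subspace {x. P x}" "\<And>a x. a \<in> S 1 \<Longrightarrow> x \<in> S i \<Longrightarrow> P (a * x)"
  shows "P s"
proof -
  have "S (Suc i) \<subseteq> {x. P x}"
    unfolding S_Suc by (rule span_minimal[OF _ assms(2)]) (use assms(3) in blast)
  then show ?thesis using assms(1) by blast
qed

lemma S_times: "x \<in> S i \<Longrightarrow> y \<in> S j \<Longrightarrow> x * y \<in> S (i + j)"
proof (induction i arbitrary: x)
  case 0
  then obtain c where "x = scale c 1" by (auto simp: S_0 span_singleton)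
  then show ?case using 0(2) subspace_scale[OF subspace_S] by (simp add: scale_mult)
next
  case (Suc i)
  from Suc.prems(1) show ?case
  proof (induction rule: S_induct)
    case sub
    show ?case
      using subspace_add[OF subspace_S] subspace_scale[OF subspace_S] subspace_0[OF subspace_S]
      by (intro subspaceI) (auto simp: distrib_right scale_mult)
  next
    case (prod a x)
    then show ?case using S_mult_Suc Suc.IH[OF _ Suc.prems(2)] by (simp add: mult.assoc)
  qed
qed

lemma one_in_S: "1 \<in> S 0"
  by (simp add: S_0 span_base)

lemma S_power: "v \<in> S 1 \<Longrightarrow> v ^ i \<in> S i"
  by (induction i) (use one_in_S S_mult_Suc in auto)

lemma S1_line: "x \<in> S 1 \<Longrightarrow> y \<in> S 1 \<Longrightarrow> x + scale t y \<in> S 1"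
  by (intro subspace_add subspace_scale subspace_S)

lemma power_line: "(x + scale t y) ^ k = (\<Sum>j\<le>k. scale (t ^ j) (of_nat (k choose j) *
    (x ^ (k - j) * y ^ j)))"
proof -
  have "(scale t y) ^ j = scale (t ^ j) (y ^ j)" for j
    by (induction j) (simp_all add: scale_mult mult_scale)
  then have "(scale t y + x) ^ k = (\<Sum>j\<le>k. scale (t ^ j) (of_nat (k choose j) *
      (x ^ (k - j) * y ^ j)))"
    unfolding binomial_ring
    by (intro sum.cong refl) (simp add: scale_mult mult_scale mult_ac)
  then show ?thesis by (simp add: add.commute)
qed

lemma scale_of_nat: "scale (of_nat m) x = of_nat m * x"
  by (induction m) (simp_all add: scale_left_distrib distrib_right)

lemma subspace_of_nat_cancel:
  assumes "subspace R" "m > 0" "of_nat m * x \<in> R"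
  shows "x \<in> R"
proof -
  have "scale (inverse (of_nat m)) (of_nat m * x) = x"
    using assms(2) by (simp add: scale_of_nat[symmetric])
  then show ?thesis using subspace_scale[OF assms(1,3)] by metis
qed

text \<open>For \<open>a\<close> and \<open>v\<close> in \<open>S 1\<close> the product
  \<open>v ^ i * a\<close> is, up to the factor \<open>i + 1\<close>, the coefficient of
  \<open>t\<close> in the power \<open>i + 1\<close> of \<open>v + t a\<close>, so it lies in
  \<open>R\<close> by \<open>coeffs_in_subspace\<close>. By induction the subspace of all
  \<open>y\<close> with \<open>a * y \<in> R\<close> contains \<open>S i\<close>.\<close>

lemma polarization:
  assumes "subspace R" "\<And>v. v \<in> S 1 \<Longrightarrow> v ^ i \<in> R" "s \<in> S i"
  shows "s \<in> R"
  using assms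
proof (induction i arbitrary: R s)
  case 0
  then have "1 \<in> R" using subspace_0[OF subspace_S, of 1] by fastforce
  then show ?case using 0(1,3) span_minimal[of "{1}" R] by (auto simp: S_0)
next
  case (Suc i)
  have "a * x \<in> R" if a: "a \<in> S 1" and x: "x \<in> S i" for a x
  proof -
    have sub: "subspace {y. a * y \<in> R}"
      using Suc.prems(1)
      by (intro subspaceI) (auto simp: subspace_0 distrib_left subspace_add mult_scale
          subspace_scale)
    have "v ^ i \<in> {y. a * y \<in> R}" if v: "v \<in> S 1" for v
    proof -
      have "of_nat (Suc i choose 1) * (v ^ (Suc i - 1) * a ^ 1) \<in> R"
      proof (rule coeffs_in_subspace[OF _ Suc.prems(1), where i = 1 and N = "Suc i"])
        fix t
        show "(\<Sum>j\<le>Suc i. scale (t ^ j) (of_nat (Suc i choose j) * (v ^ (Suc i - j) * a ^ j))) \<in> R"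
          unfolding power_line[symmetric] by (rule Suc.prems(2)[OF S1_line[OF v a]])
      qed auto
      then have "v ^ i * a \<in> R"
        using subspace_of_nat_cancel[OF Suc.prems(1), of "Suc i"] by simp
      then show ?thesis by (simp add: mult.commute)
    qed
    from Suc.IH[OF sub this x] show ?thesis by simp
  qed
  with Suc.prems(3,1) show ?case by (elim S_induct) auto
qed

end

text \<open>The last assumption expresses that \<open>\<Phi>\<close> lives in degree
  \<open>d\<close>: whether an element of degree \<open>i\<close> is orthogonal to the whole ring is
  decided in degree \<open>d - i\<close>. With test elements from the whole ring the kernel of
  \<open>ev\<close> is an ideal.\<close>

locale graded_functional = standard_graded scale S
  for scale :: "'k::field_char_0 \<Rightarrow> 's::comm_ring_1 \<Rightarrow> 's" and S +
  fixes \<Phi> :: "'s \<Rightarrow> 'k" and d :: nat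
  assumes \<Phi>_add: "\<Phi> (x + y) = \<Phi> x + \<Phi> y" and \<Phi>_scale: "\<Phi> (scale c x) = c * \<Phi> x"
    and \<Phi>_graded: "i \<le> d \<Longrightarrow> s \<in> S i \<Longrightarrow> (\<And>q. q \<in> S (d - i) \<Longrightarrow> \<Phi> (s * q) = 0) \<Longrightarrow> \<Phi> (s * q) = 0"
begin

text \<open>
  The functional \<open>ev s\<close> represents the class of \<open>s\<close> in the Gorenstein quotient, so \<open>D W\<close> is the
  dimension of the image of \<open>W\<close> there and \<open>D (S i)\<close> is the value of its Hilbert function.
\<close>

definition ev :: "'s \<Rightarrow> 's \<Rightarrow> 'k" where
  "ev s = (\<lambda>q. \<Phi> (s * q))"

definition D :: "'s set \<Rightarrow> nat" where
  "D W = fn.dim (ev ` W)"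

lemma \<Phi>_0 [simp]: "\<Phi> 0 = 0"
  using \<Phi>_scale[of 0 0] by simp

lemma \<Phi>_minus: "\<Phi> (- x) = - \<Phi> x"
  using \<Phi>_add[of x "- x"] by (simp add: add_eq_0_iff)

lemma linear_ev: "Vector_Spaces.linear scale fscale ev"
  by (rule linear_fnI) (simp_all add: ev_def distrib_right \<Phi>_add scale_mult \<Phi>_scale)

lemma linear_ev_mult: "Vector_Spaces.linear scale fscale (\<lambda>x. ev (a * x))"
  by (rule linear_fnI) (simp_all add: ev_def distrib_left distrib_right \<Phi>_add mult_scale
      scale_mult \<Phi>_scale)

lemma ev_eq_0_iff: "ev s = 0 \<longleftrightarrow> (\<forall>q. \<Phi> (s * q) = 0)"
  by (auto simp: ev_def fun_eq_iff)

lemma ev_mult_0: "ev x = 0 \<Longrightarrow> ev (a * x) = 0"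
  unfolding ev_eq_0_iff by (metis mult.assoc mult.commute)

lemma ev_mult_cong: "ev x = ev y \<Longrightarrow> ev (a * x) = ev (a * y)"
  by (simp add: ev_def fun_eq_iff) (metis mult.assoc mult.commute)

lemma ev_graded:
  assumes "i \<le> d" "s \<in> S i"
  shows "ev s = 0 \<longleftrightarrow> (\<forall>q\<in>S (d - i). \<Phi> (s * q) = 0)"
  using \<Phi>_graded[OF assms] by (auto simp: ev_eq_0_iff)

lemma subspace_ev_kernel: "subspace W \<Longrightarrow> subspace {w \<in> W. ev (a * w) = 0}"
  by (intro subspaceI)
    (auto simp: subspace_0 subspace_add subspace_scale ev_eq_0_iff distrib_left distrib_right \<Phi>_add
      mult_scale scale_mult \<Phi>_scale)

lemma subspace_times: "subspace W \<Longrightarrow> subspace ((*) a ` W)"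
  using module_hom.subspace_image[OF Vector_Spaces.linear.axioms(3)[OF linear_mult]] .

lemma fin_times: "fin_span W \<Longrightarrow> fin_span ((*) a ` W)"
proof -
  interpret p: vspace_pair scale scale ..
  show "fin_span W \<Longrightarrow> fin_span ((*) a ` W)"
    by (rule p.fin_span_image[OF linear_mult])
qed

lemma fin_ev: "fin_span W \<Longrightarrow> fn.fin_span (ev ` W)"
  by (rule fnp.fin_span_image[OF linear_ev])

lemma D_mono: "W \<subseteq> W' \<Longrightarrow> fin_span W' \<Longrightarrow> D W \<le> D W'"
  unfolding D_def by (intro fn.dim_mono_fin fin_ev image_mono)

lemma D_eq_0I: "(\<And>w. w \<in> W \<Longrightarrow> ev w = 0) \<Longrightarrow> D W = 0"
  unfolding D_def by (rule fn.dim_subset_0) auto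

lemma D_eq_0D: "D W = 0 \<Longrightarrow> fin_span W \<Longrightarrow> w \<in> W \<Longrightarrow> ev w = 0"
  unfolding D_def using fn.dim_eq_0_fin[OF fin_ev] by blast

text \<open>Rank-nullity for \<open>ev w\<close> and for \<open>ev (a * w)\<close>. The elements
  with \<open>ev w = 0\<close> lie in both kernels and cancel.\<close>

lemma D_split:
  assumes "subspace W" "fin_span W"
  shows "D W = D ((*) a ` W) + D {w \<in> W. ev (a * w) = 0}"
proof -
  let ?K = "{w \<in> W. ev (a * w) = 0}"
  have "dim W = D W + dim {w \<in> W. ev w = 0}"
    unfolding D_def by (rule fnp.rank_nullity[OF linear_ev assms])
  moreover have "dim W = D ((*) a ` W) + dim ?K"
    using fnp.rank_nullity[OF linear_ev_mult assms] by (simp add: D_def image_image)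
  moreover have "dim ?K = D ?K + dim {w \<in> ?K. ev w = 0}"
    unfolding D_def
    by (rule fnp.rank_nullity[OF linear_ev subspace_ev_kernel[OF assms(1)] fin_span_mono[OF
        assms(2)]]) auto
  moreover have "{w \<in> ?K. ev w = 0} = {w \<in> W. ev w = 0}"
    using ev_mult_0 by blast
  ultimately show ?thesis by simp
qed

lemma D_pairing:
  assumes "i \<le> d" "W \<subseteq> S i" "subspace W"
  shows "D W = fn.dim ((\<lambda>q w. if w \<in> W then \<Phi> (w * q) else 0) ` S (d - i))"
proof -
  interpret p: vspace_pair scale scale ..
  have fin: "fin_span W" using fin_span_mono[OF fin_S assms(2)] .
  have "D W = fn.dim ((\<lambda>w q. if q \<in> S (d - i) then \<Phi> (w * q) else 0) ` W)"
    unfolding D_def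
  proof (rule rank_eq_of_kernel_eq[OF linear_ev _ assms(3) fin])
    fix w assume "w \<in> W"
    then have "ev w = 0 \<longleftrightarrow> (\<forall>q\<in>S (d - i). \<Phi> (w * q) = 0)"
      using ev_graded[OF assms(1)] assms(2) by blast
    then show "ev w = 0 \<longleftrightarrow> (\<lambda>q. if q \<in> S (d - i) then \<Phi> (w * q) else 0) = 0"
      by (auto simp: fun_eq_iff)
  qed (rule linear_fnI; simp add: distrib_right \<Phi>_add scale_mult \<Phi>_scale)
  also have "\<dots> = fn.dim ((\<lambda>q w. if w \<in> W then \<Phi> (w * q) else 0) ` S (d - i))"
    by (rule p.bilinear_rank_eq[symmetric])
      (simp_all add: distrib_right distrib_left \<Phi>_add scale_mult mult_scale \<Phi>_scale assms(3) fin)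
  finally show ?thesis .
qed

text \<open>Row rank equals column rank for the pairing between degrees \<open>i\<close> and
  \<open>d - i\<close>.\<close>

lemma D_sym:
  assumes "i \<le> d"
  shows "D (S i) = D (S (d - i))"
proof -
  have "D (S i) = fn.dim ((\<lambda>q w. if w \<in> S i then \<Phi> (w * q) else 0) ` S (d - i))"
    using D_pairing[OF assms] by simp
  also have "\<dots> = D (S (d - i))"
    unfolding D_def
  proof (rule rank_eq_of_kernel_eq[OF _ linear_ev])
    fix q assume "q \<in> S (d - i)"
    then have "ev q = 0 \<longleftrightarrow> (\<forall>w\<in>S i. \<Phi> (q * w) = 0)"
      using ev_graded[of "d - i" q] assms by simp
    then show "(\<lambda>w. if w \<in> S i then \<Phi> (w * q) else 0) = 0 \<longleftrightarrow> ev q = 0"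
      by (auto simp: fun_eq_iff mult.commute)
  qed (auto intro!: linear_fnI simp: distrib_left \<Phi>_add mult_scale \<Phi>_scale)
  finally show ?thesis .
qed

text \<open>This functional belongs to the quotient of \<open>A\<close> by the annihilator of
  \<open>a\<close>. By \<open>D_mult\<close> its Hilbert function counts the images of
  multiplication by \<open>a\<close>.\<close>

lemma graded_functional_mult:
  assumes "a \<in> S 1" "d \<ge> 1"
  shows "graded_functional scale S (\<lambda>q. \<Phi> (a * q)) (d - 1)"
proof unfold_locales
  fix i s q
  assume i: "i \<le> d - 1" and s: "s \<in> S i" and z: "\<And>q. q \<in> S (d - 1 - i) \<Longrightarrow> \<Phi> (a * (s * q)) = 0"
  have "\<Phi> ((a * s) * q) = 0"
    by (rule \<Phi>_graded[of "Suc i"]) (use i s z assms S_mult_Suc in \<open>auto simp: mult.assoc\<close>)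
  then show "\<Phi> (a * (s * q)) = 0" by (simp add: mult.assoc)
qed (simp_all add: distrib_left \<Phi>_add mult_scale \<Phi>_scale)

lemma D_mult:
  assumes "a \<in> S 1" "d \<ge> 1"
  shows "graded_functional.D (\<lambda>q. \<Phi> (a * q)) W = D ((*) a ` W)"
proof -
  interpret g: graded_functional scale S "\<lambda>q. \<Phi> (a * q)" "d - 1"
      by (rule graded_functional_mult[OF assms])
  show ?thesis
    by (simp add: g.D_def D_def g.ev_def ev_def image_image mult.assoc)
qed

lemma poly_curve_line: "\<exists>p. \<forall>t. \<Phi> ((x + scale t y) ^ k * z) = poly p t"
proof (induction k arbitrary: z)
  case 0
  show ?case by (rule exI[of _ "[:\<Phi> z:]"]) simp
next
  case (Suc k)
  obtain p q where "\<forall>t. \<Phi> ((x + scale t y) ^ k * (x * z)) = poly p t"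
    "\<forall>t. \<Phi> ((x + scale t y) ^ k * (y * z)) = poly q t"
    using Suc by meson
  moreover have "(x + scale t y) ^ Suc k * z =
      (x + scale t y) ^ k * (x * z) + scale t ((x + scale t y) ^ k * (y * z))" for t
    by (simp add: algebra_simps scale_mult mult_scale)
  ultimately have "\<forall>t. \<Phi> ((x + scale t y) ^ Suc k * z) = poly (p + [:0, 1:] * q) t"
    by (simp add: \<Phi>_add \<Phi>_scale)
  then show ?case by blast
qed

lemma D_line_cofinite:
  assumes "fin_span W" "R \<le> D ((\<lambda>w. x ^ k * w) ` W)"
  shows "finite {t. \<not> R \<le> D ((\<lambda>w. (x + scale t y) ^ k * w) ` W)}"
proof -
  have *: "D ((\<lambda>w. a * w) ` W) = fn.dim ((\<lambda>w. ev (a * w)) ` W)" for a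
    by (simp add: D_def image_image)
  show ?thesis
    unfolding *
  proof (rule dim_ge_cofinite[where ?t0.0 = 0])
    show "fn.fin_span ((\<lambda>w. ev ((x + scale t y) ^ k * w)) ` W)" for t
      by (rule fnp.fin_span_image[OF linear_ev_mult assms(1)])
    show "poly_curve (\<lambda>t. ev ((x + scale t y) ^ k * w))" for w
      using poly_curve_line[of x y k] by (simp add: poly_curve_def ev_def mult.assoc)
  qed (use assms(2) in \<open>simp add: *\<close>)
qed

end

section \<open>Generic hyperplane restriction\<close>

lemma tau_0 [simp]: "tau n 0 = 1"
  by (simp add: tau_def)

lemma tau_zero [simp]: "k \<ge> 1 \<Longrightarrow> tau 0 k = 0"
  by (simp add: tau_def)

lemma tau_one [simp]: "tau (Suc 0) k = 1"
  by (simp add: tau_def)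

lemma tau_deg_one [simp]: "tau n (Suc 0) = n"
  by (simp add: tau_def)

lemma tau_Suc_Suc: "tau (Suc m) (Suc k) = tau m (Suc k) + tau (Suc m) k"
  by (simp add: tau_def add.commute)

text \<open>Extend \<open>f b\<close> to a basis of the image and lift the other basis vectors to
  \<open>C\<close>. The size of \<open>C\<close>, one less than the rank, is the number of variables
  left once \<open>b\<close> and the kernel act by zero.\<close>

lemma (in vspace_pair) complement_of_kernel:
  assumes lin: "Vector_Spaces.linear s1 s2 f" and W: "vs1.subspace W" "vs1.fin_span W"
    and b: "b \<in> W" "f b \<noteq> 0"
  obtains C where "finite C" "C \<subseteq> W" "Suc (card C) = vs2.dim (f ` W)"
    "W \<subseteq> vs1.span (C \<union> insert b {x \<in> W. f x = 0})"
proof -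
  interpret f: Vector_Spaces.linear s1 s2 f by fact
  obtain B where B: "{f b} \<subseteq> B" "B \<subseteq> f ` W" "vs2.independent B" "f ` W \<subseteq> vs2.span B"
    using vs2.maximal_independent_subset_extend[of "{f b}" "f ` W"] b by auto
  have finB: "finite B" and cardB: "card B = vs2.dim (f ` W)"
    using vs2.independent_card_le_dim_fin[OF fin_span_image[OF lin W(2)] B(3,2)]
      vs2.basis_card_eq_dim[OF B(2,4,3)] by auto
  have "\<forall>y\<in>B. \<exists>x\<in>W. f x = y" using B(2) by blast
  then obtain g where g: "\<And>y. y \<in> B \<Longrightarrow> g y \<in> W" "\<And>y. y \<in> B \<Longrightarrow> f (g y) = y" by metis
  let ?C = "g ` (B - {f b})"
  have "inj_on g (B - {f b})" using g(2) by (metis DiffD1 inj_onI)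
  then have "card ?C = card B - 1"
    using finB B(1) by (simp add: card_image)
  moreover have "card B > 0" using finB B(1) by (auto simp: card_gt_0_iff)
  ultimately have card: "Suc (card ?C) = vs2.dim (f ` W)" using cardB by simp
  let ?Z = "?C \<union> insert b {x \<in> W. f x = 0}"
  have "x \<in> vs1.span ?Z" if x: "x \<in> W" for x
  proof -
    have sub: "?C \<union> {b} \<subseteq> W" using g(1) b(1) by auto
    have "B \<subseteq> f ` (?C \<union> {b})" using g(2) by force
    then have "f x \<in> f ` vs1.span (?C \<union> {b})"
      using B(4) x vs2.span_mono[of B "f ` (?C \<union> {b})"] unfolding f.span_image by blast
    then obtain y where y: "y \<in> vs1.span (?C \<union> {b})" "f x = f y" by blast
    have "y \<in> W" using vs1.span_minimal[OF sub W(1)] y(1) by blast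
    then have "x - y \<in> {x \<in> W. f x = 0}"
      using x y(2) W(1) by (simp add: vs1.subspace_diff f.diff)
    then have "x - y \<in> vs1.span ?Z" by (intro vs1.span_base) blast
    moreover have "y \<in> vs1.span ?Z"
      using y(1) vs1.span_mono[of "?C \<union> {b}" ?Z] by blast
    ultimately have "(x - y) + y \<in> vs1.span ?Z" by (rule vs1.span_add)
    then show ?thesis by simp
  qed
  then show thesis
    using that[of ?C] card finB g(1) by auto
qed

context graded_functional
begin

text \<open>Read the line through \<open>x\<close> and \<open>y\<close> from either end: each
  property fails at finitely many of its points only. This stands in for the fact that two nonempty
  open sets meet.\<close>

lemma common_point:
  assumes "\<And>x y. P x \<Longrightarrow> finite {t. \<not> P (x + scale t y)}"
    and "\<And>x y. Q x \<Longrightarrow> finite {t. \<not> Q (x + scale t y)}"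
    and "x \<in> S 1" "y \<in> S 1" "P x" "Q y"
  obtains z where "z \<in> S 1" "P z" "Q z"
proof -
  have "finite {t. \<not> P (x + scale t (y - x))}" by (rule assms(1)[OF assms(5)])
  moreover have "finite {t. \<not> Q (x + scale t (y - x))}"
  proof -
    have "x + scale t (y - x) = y + scale (1 - t) (x - y)" for t
      by (simp add: scale_left_diff_distrib scale_right_diff_distrib algebra_simps)
    then have "{t. \<not> Q (x + scale t (y - x))} = (\<lambda>s. 1 - s) -` {s. \<not> Q (y + scale s (x - y))}"
      by auto
    moreover have "inj (\<lambda>s :: 'k. 1 - s)" by (auto intro: injI)
    ultimately show ?thesis
      using finite_vimageI[OF assms(2)[OF assms(6), of "x - y"]] by metis
  qed
  ultimately have "finite ({t. \<not> P (x + scale t (y - x))} \<union> {t. \<not> Q (x + scale t (y - x))})"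
    by simp
  then obtain t where "P (x + scale t (y - x))" "Q (x + scale t (y - x))"
    using ex_new_if_finite[OF infinite_UNIV_char_0[where 'a = 'k]] by blast
  moreover have "x + scale t (y - x) \<in> S 1"
    using assms(3,4) by (intro S1_line subspace_diff subspace_S)
  ultimately show thesis using that by blast
qed

text \<open>The socle sits in degree \<open>d\<close>: test elements of degree
  \<open>d - i > 0\<close> are sums of products with a linear factor, and that factor can be moved
  over to \<open>s\<close>.\<close>

lemma ev_nonzero_step:
  assumes "i < d" "s \<in> S i" "\<And>a. a \<in> S 1 \<Longrightarrow> ev (a * s) = 0"
  shows "ev s = 0"
  unfolding ev_graded[OF less_imp_le[OF assms(1)] assms(2)]
proof
  fix q assume "q \<in> S (d - i)"
  moreover have "d - i = Suc (d - i - 1)" using assms(1) by simp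
  ultimately have "q \<in> S (Suc (d - i - 1))" by simp
  then show "\<Phi> (s * q) = 0"
  proof (induction rule: S_induct)
    case sub
    show ?case by (intro subspaceI) (auto simp: distrib_left mult_scale \<Phi>_add \<Phi>_scale)
  next
    case (prod a x)
    then have "\<Phi> (a * s * x) = 0" using assms(3)[of a] unfolding ev_eq_0_iff by blast
    then show ?case by (simp add: mult_ac)
  qed
qed

lemma D_pos: "fin_span G \<Longrightarrow> w \<in> G \<Longrightarrow> ev w \<noteq> 0 \<Longrightarrow> 1 \<le> D G"
  using D_eq_0D[of G w] by (cases "D G") auto

lemma D_S0_le: "D (S 0) \<le> 1"
proof -
  have "ev ` S 0 \<subseteq> fn.span {ev 1}"
    unfolding S_0 using fnp.linear_span_image[OF linear_ev, of "{1}"] by auto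
  then show ?thesis unfolding D_def using fn.dim_le_card[of "ev ` S 0" "{ev 1}"] by simp
qed

section \<open>Bounds of Macaulay and Green type at binomial values\<close>

definition ker_in :: "'s \<Rightarrow> 's set \<Rightarrow> 's set" where
  "ker_in a G = {g \<in> G. ev (a * g) = 0}"

lemma ker_in_subspace: "subspace G \<Longrightarrow> subspace (ker_in a G)"
  unfolding ker_in_def by (rule subspace_ev_kernel)

lemma ker_in_subset: "ker_in a G \<subseteq> G"
  by (auto simp: ker_in_def)

lemma D_split_ker: "subspace G \<Longrightarrow> fin_span G \<Longrightarrow> D G = D ((*) a ` G) + D (ker_in a G)"
  unfolding ker_in_def by (rule D_split)

lemma times_subset: "a \<in> S j \<Longrightarrow> G \<subseteq> S i \<Longrightarrow> (*) a ` G \<subseteq> S (j + i)"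
  using S_times by blast

lemma times_image_commute: "(*) a ` (*) b ` G = (*) b ` (*) a ` (G :: 's set)"
  unfolding image_image by (rule image_cong[OF refl]) (rule mult.left_commute)

lemma D_line_cofinite_1:
  assumes "fin_span W" "R \<le> D ((*) x ` W)"
  shows "finite {t. \<not> R \<le> D ((*) (x + scale t y) ` W)}"
  using D_line_cofinite[OF assms(1), of R x 1 y] assms(2) by simp

text \<open>
  With elements of \<open>S (d - k)\<close> read as forms of degree \<open>k\<close> and multiplication by \<open>a\<close> as a derivative,
  these are instances of the theorems of Macaulay and Green at the binomial value \<open>\<tau>(m, k)\<close>.
\<close>

definition rank_descends :: "nat \<Rightarrow> nat \<Rightarrow> bool" where
  "rank_descends m k \<longleftrightarrow> (\<forall>i G. i + k = d \<longrightarrow> subspace G \<longrightarrow> G \<subseteq> S i \<longrightarrow> tau m k \<le> D G \<longrightarrow>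
     (\<exists>a\<in>S 1. tau m (k - 1) \<le> D ((*) a ` G)))"

definition green_bound :: "nat \<Rightarrow> nat \<Rightarrow> bool" where
  "green_bound m k \<longleftrightarrow> (\<forall>i G. i + k = d \<longrightarrow> subspace G \<longrightarrow> G \<subseteq> S i \<longrightarrow>
     (\<forall>a\<in>S 1. tau (m - 1) k \<le> D (ker_in a G)) \<longrightarrow> tau m k \<le> D G)"

text \<open>A nonzero class below the socle degree is not killed by all linear forms, and rank 1
  asks for no more.\<close>

lemma rank_descends_base:
  assumes "tau m (k - 1) = 1" "1 \<le> tau m k" "k \<ge> 1"
  shows "rank_descends m k"
  unfolding rank_descends_def
proof (intro allI impI)
  fix i G assume G: "i + k = d" "subspace G" "G \<subseteq> S i" "tau m k \<le> D G"
  then have fin: "fin_span G" using fin_span_mono fin_S by blast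
  obtain w where w: "w \<in> G" "ev w \<noteq> 0"
    using D_eq_0I[of G] G(4) assms(2) by fastforce
  then obtain a where a: "a \<in> S 1" "ev (a * w) \<noteq> 0"
    using ev_nonzero_step[of i w] G assms(3) by force
  then have "1 \<le> D ((*) a ` G)"
    using w(1) by (intro D_pos[OF fin_times[OF fin], of "a * w"]) auto
  then show "\<exists>a\<in>S 1. tau m (k - 1) \<le> D ((*) a ` G)" using a(1) assms(1) by auto
qed

lemma green_bound_base:
  assumes "m \<ge> 2"
  shows "green_bound m 1"
  unfolding green_bound_def
proof (intro allI impI)
  fix i G assume G: "i + 1 = d" "subspace G" "G \<subseteq> S i"
    "\<forall>a\<in>S 1. tau (m - 1) 1 \<le> D (ker_in a G)"
  then have fin: "fin_span G" using fin_span_mono fin_S by blast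
  have K: "m - 1 \<le> D (ker_in a G)" if "a \<in> S 1" for a
    using G(4) that by simp
  \<comment> \<open>The linear form 0 is among the \<open>a\<close>, and \<open>ker_in 0 G\<close>
    is all of \<open>G\<close>; so \<open>G\<close> has rank at least \<open>m - 1\<close>.\<close>
  have "0 \<in> S 1" using subspace_0[OF subspace_S] .
  then have "1 \<le> D G"
    using K[of 0] D_split_ker[OF G(2) fin, of 0] assms by linarith
  then obtain w where w: "w \<in> G" "ev w \<noteq> 0"
    using D_eq_0I[of G] by fastforce
  then obtain a where a: "a \<in> S 1" "ev (a * w) \<noteq> 0"
    using ev_nonzero_step[of i w] G by force
  then have "1 \<le> D ((*) a ` G)"
    using w(1) by (intro D_pos[OF fin_times[OF fin], of "a * w"]) auto
  then show "tau m 1 \<le> D G"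
    using K[OF a(1)] D_split_ker[OF G(2) fin, of a] assms by simp
qed

text \<open>
  Comparing \<open>a G\<close> with its kernel under \<open>b\<close>, where \<open>b\<close> is chosen for a maximising \<open>a\<^sub>0\<close> and \<open>a\<close> is
  generic afterwards.
\<close>

lemma green_bound_step:
  assumes "rank_descends (m - 1) k" "green_bound m (k - 1)" "k \<ge> 2"
    and G: "i + k = d" "subspace G" "G \<subseteq> S i" "\<forall>a\<in>S 1. tau (m - 1) k \<le> D (ker_in a G)"
  shows "\<exists>a\<in>S 1. tau m (k - 1) \<le> D ((*) a ` G)"
proof (rule ccontr)
  assume neg: "\<not> ?thesis"
  have fin: "fin_span G" using fin_span_mono fin_S G(3) by blast
  have S10: "0 \<in> S 1" using subspace_0[OF subspace_S] .
  have "\<exists>a0. a0 \<in> S 1 \<and> (\<forall>a. a \<in> S 1 \<longrightarrow> D ((*) a ` G) \<le> D ((*) a0 ` G))"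
    by (rule ex_has_greatest_nat[where P = "\<lambda>a. a \<in> S 1" and k = 0 and b =
        "tau m (k - 1)", OF S10]) (use neg in force)
  then obtain a0 where a0: "a0 \<in> S 1" "\<And>a. a \<in> S 1 \<Longrightarrow> D ((*) a ` G) \<le> D ((*) a0 ` G)" by blast
  define M where "M = D ((*) a0 ` G)"
  define r where "r = tau (m - 1) (k - 1)"
  have "\<not> tau m (k - 1) \<le> M" using neg a0(1) M_def by blast
  moreover have "(*) a0 ` G \<subseteq> S (Suc i)" using times_subset[OF a0(1) G(3)] by simp
  moreover have "Suc i + (k - 1) = d" using G(1) assms(3) by simp
  \<comment> \<open>\<open>green_bound\<close> in degree \<open>k - 1\<close> read backwards: the
    image of \<open>G\<close> under \<open>a0\<close> is too small, so some \<open>b\<close> has a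
    small kernel on it.\<close>
  ultimately have "\<not> (\<forall>b\<in>S 1. tau (m - 1) (k - 1) \<le> D (ker_in b ((*) a0 ` G)))"
    using assms(2) subspace_times[OF G(2), of a0] unfolding green_bound_def M_def by blast
  then obtain b where b: "b \<in> S 1" "D (ker_in b ((*) a0 ` G)) < r"
    unfolding r_def by force
  have M1: "M < D ((*) a0 ` (*) b ` G) + r"
    using D_split_ker[OF subspace_times[OF G(2)] fin_times[OF fin], of a0 b] b(2)
    unfolding M_def times_image_commute[of a0 b] by linarith
  let ?H = "ker_in b G"
  have "subspace ?H" "?H \<subseteq> S i" "tau (m - 1) k \<le> D ?H"
    using ker_in_subspace[OF G(2)] ker_in_subset[of b G] G(3,4) b(1) by blast+
  then obtain a2 where a2: "a2 \<in> S 1" "r \<le> D ((*) a2 ` ?H)"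
    using assms(1) G(1) unfolding rank_descends_def r_def by blast
  have finH: "fin_span ?H" using fin_span_mono[OF fin ker_in_subset] .
  \<comment> \<open>For such \<open>a\<close> the image of \<open>a G\<close> under \<open>b\<close>
    has rank at least \<open>M + 1 - r\<close>, and the part of \<open>a G\<close> killed by
    \<open>b\<close>, which contains \<open>a ?H\<close>, has rank at least \<open>r\<close>.
    Together they exceed the maximum \<open>M\<close>.\<close>
  obtain a where a: "a \<in> S 1" "M + 1 - r \<le> D ((*) a ` (*) b ` G)" "r \<le> D ((*) a ` ?H)"
  proof (rule common_point[of "\<lambda>a. M + 1 - r \<le> D ((*) a ` (*) b ` G)"
      "\<lambda>a. r \<le> D ((*) a ` ?H)" a0 a2])
    show "M + 1 - r \<le> D ((*) a0 ` (*) b ` G)" using M1 by linarith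
  qed (use a0(1) a2 D_line_cofinite_1[OF fin_times[OF fin]] D_line_cofinite_1[OF finH] in auto)
  have "(*) a ` ?H \<subseteq> ker_in b ((*) a ` G)"
    using ev_mult_0[of _ a] by (auto simp: ker_in_def mult.left_commute)
  then have "r \<le> D (ker_in b ((*) a ` G))"
    using a(3) D_mono[OF _ fin_span_mono[OF fin_times[OF fin] ker_in_subset]] le_trans by blast
  then have "M + 1 \<le> D ((*) a ` G)"
    using a(2) D_split_ker[OF subspace_times[OF G(2)] fin_times[OF fin], of a b]
    unfolding times_image_commute[of b a] by linarith
  then show False using a0(2)[OF a(1)] by (simp add: M_def)
qed

text \<open>Induction on \<open>k\<close> for both, with an inner induction on \<open>m\<close> for
  \<open>rank_descends\<close>: if all kernels are large, \<open>green_bound_step\<close> provides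
  \<open>a\<close>; otherwise some \<open>a\<close> has a small kernel and a large image by Pascal's
  rule. For \<open>green_bound\<close>, add the image and the kernel of the \<open>a\<close> so
  provided.\<close>

lemma rank_descends_and_green_bound: "k \<ge> 1 \<Longrightarrow> (\<forall>m\<ge>1. rank_descends m k) \<and> (\<forall>m\<ge>2. green_bound m k)"
proof (induction k rule: nat_induct_at_least)
  case base
  show ?case using rank_descends_base[of _ 1] green_bound_base by simp
next
  case (Suc k)
  have step: "\<exists>a\<in>S 1. tau (Suc m) k \<le> D ((*) a ` G)"
    if "rank_descends m (Suc k)" "m \<ge> 1" "i + Suc k = d" "subspace G" "G \<subseteq> S i"
      "\<forall>a\<in>S 1. tau m (Suc k) \<le> D (ker_in a G)" for m i G
    using green_bound_step[of "Suc m" "Suc k" i G] that Suc by simp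
  have rank_descends: "rank_descends (Suc m) (Suc k)" for m
  proof (induction m)
    case 0
    show ?case by (rule rank_descends_base) auto
  next
    case (Suc m)
    show ?case
      unfolding rank_descends_def
    proof (intro allI impI)
      fix i G assume G: "i + Suc k = d" "subspace G" "G \<subseteq> S i" "tau (Suc (Suc m)) (Suc k) \<le> D G"
      have fin: "fin_span G" using fin_span_mono fin_S G(3) by blast
      show "\<exists>a\<in>S 1. tau (Suc (Suc m)) (Suc k - 1) \<le> D ((*) a ` G)"
      proof (cases "\<forall>a\<in>S 1. tau (Suc m) (Suc k) \<le> D (ker_in a G)")
        case True
        then show ?thesis using step[OF Suc _ G(1-3)] by simp
      next
        case False
        then obtain a where a: "a \<in> S 1" "D (ker_in a G) < tau (Suc m) (Suc k)" by force
        have "tau (Suc (Suc m)) k \<le> D ((*) a ` G)"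
          using D_split_ker[OF G(2) fin, of a] a(2) G(4) tau_Suc_Suc[of "Suc m" k] by linarith
        then show ?thesis using a(1) by auto
      qed
    qed
  qed
  have "green_bound (Suc m) (Suc k)" if m: "m \<ge> 1" for m
    unfolding green_bound_def
  proof (intro allI impI)
    fix i G assume G: "i + Suc k = d" "subspace G" "G \<subseteq> S i"
      "\<forall>a\<in>S 1. tau (Suc m - 1) (Suc k) \<le> D (ker_in a G)"
    have fin: "fin_span G" using fin_span_mono fin_S G(3) by blast
    have "rank_descends m (Suc k)" using rank_descends[of "m - 1"] m by simp
    then obtain a where a: "a \<in> S 1" "tau (Suc m) k \<le> D ((*) a ` G)"
      using step[OF _ m G(1-3)] G(4) by auto
    moreover have "tau m (Suc k) \<le> D (ker_in a G)" using G(4) a(1) by simp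
    ultimately show "tau (Suc m) (Suc k) \<le> D G"
      using D_split_ker[OF G(2) fin, of a] tau_Suc_Suc[of m k] by linarith
  qed
  then have "green_bound m (Suc k)" if "m \<ge> 2" for m
    using that by (metis Suc_le_D Suc_le_mono numeral_2_eq_2 One_nat_def)
  moreover have "rank_descends m (Suc k)" if "m \<ge> 1" for m
    using rank_descends[of "m - 1"] that by simp
  ultimately show ?case by blast
qed

text \<open>Dually, \<open>W\<close> consists of forms of degree \<open>k\<close> in the variables
  \<open>C\<close>, since those in \<open>K\<close> act by zero. Splitting by one variable
  \<open>c\<close> reproduces Pascal's rule: the image loses a degree, the kernel loses a
  variable.\<close>

lemma D_le_tau:
  assumes "finite C" "i + k = d" "W \<subseteq> S i" "subspace W" "C \<subseteq> S 1" "S 1 \<subseteq> span (C \<union> K)"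
    and "k \<ge> 1 \<Longrightarrow> \<forall>w\<in>W. \<forall>x\<in>K. ev (x * w) = 0"
  shows "D W \<le> tau (card C) k"
  using assms
proof (induction k arbitrary: i W C K)
  case 0
  then have "D W \<le> D (S d)" by (intro D_mono) auto
  also have "\<dots> \<le> 1" using D_sym[of d] D_S0_le by simp
  finally show ?case by simp
next
  case (Suc k)
  note outer = Suc.IH
  from Suc.prems(1) Suc.prems(2-7) show ?case
  proof (induction C arbitrary: W K rule: finite_induct)
    case empty
    have "ev w = 0" if w: "w \<in> W" for w
    proof (rule ev_nonzero_step[of i])
      have "\<forall>x\<in>{} \<union> K. ev (x * w) = 0" using empty.prems(6) w by (simp add: zero_fun_def)
      then have "{} \<union> K \<subseteq> {a. ev (a * w) = 0}" by blast
      moreover have "subspace {a. ev (a * w) = 0}"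
        by (rule subspaceI) (auto simp: distrib_right ev_eq_0_iff scale_mult \<Phi>_scale \<Phi>_add)
      ultimately have "S 1 \<subseteq> {a. ev (a * w) = 0}"
        using empty.prems(5) span_minimal by blast
      then show "ev (a * w) = 0" if "a \<in> S 1" for a using that by blast
    qed (use empty.prems w in auto)
    then show ?case using D_eq_0I by simp
  next
    case (insert c C)
    have c: "c \<in> S 1" using insert.prems by blast
    have fin: "fin_span W" using fin_span_mono[OF fin_S insert.prems(2)] .
    have "D ((*) c ` W) \<le> tau (card (insert c C)) k"
    proof (rule outer[of "insert c C" "Suc i" _ K])
      show "(*) c ` W \<subseteq> S (Suc i)" using times_subset[OF c insert.prems(2)] by simp
      show "\<forall>w\<in>(*) c ` W. \<forall>x\<in>K. ev (x * w) = 0"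
      proof (intro ballI)
        fix w x assume "w \<in> (*) c ` W" and x: "x \<in> K"
        then obtain w' where w': "w' \<in> W" "w = c * w'" by blast
        then have "ev (x * w') = 0" using insert.prems(6) x by (simp add: zero_fun_def)
        then have "ev (c * (x * w')) = 0" by (rule ev_mult_0)
        then show "ev (x * w) = 0" by (simp only: w'(2) mult.left_commute)
      qed
    qed (use insert in \<open>auto intro: subspace_times\<close>)
    moreover have "D (ker_in c W) \<le> tau (card C) (Suc k)"
    proof (rule insert.IH[of _ "insert c K"])
      show "\<forall>w\<in>ker_in c W. \<forall>x\<in>insert c K. ev (x * w) = 0"
        using insert.prems(6) by (auto simp: ker_in_def)
    qed (use insert.prems ker_in_subset[of c W] ker_in_subspace in auto)
    ultimately show ?case
      using D_split_ker[OF insert.prems(3) fin, of c] insert.hyps tau_Suc_Suc[of "card C" k] by simp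
  qed
qed

text \<open>The products \<open>c * w\<close> lie in degree \<open>d - 1\<close>, where linear forms
  suffice as test elements.\<close>

lemma pairing_rank:
  assumes G: "i + k = d" "subspace G" "G \<subseteq> S i" and c: "c \<in> S (k - 1)" "k \<ge> 1"
  shows "fn.dim ((\<lambda>x w. if w \<in> G then \<Phi> (w * (c * x)) else 0) ` S 1) = D ((*) c ` G)"
proof -
  have sub: "(*) c ` G \<subseteq> S (d - 1)"
    using times_subset[OF c(1) G(3)] G(1) c(2) by (simp add: add.commute)
  have "1 \<le> d" using G(1) c(2) by simp
  then have 1: "d - (d - 1) = 1" by simp
  have "D ((*) c ` G) = fn.dim ((\<lambda>q w. if w \<in> (*) c ` G then \<Phi> (w * q) else 0) ` S 1)"
    using D_pairing[OF _ sub subspace_times[OF G(2)]] unfolding 1 by simp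
  also have "\<dots> = fn.dim ((\<lambda>x w. if w \<in> G then \<Phi> (w * (c * x)) else 0) ` S 1)"
  proof (rule rank_eq_of_kernel_eq)
    fix x
    show "(\<lambda>w. if w \<in> (*) c ` G then \<Phi> (w * x) else 0) = 0 \<longleftrightarrow>
        (\<lambda>w. if w \<in> G then \<Phi> (w * (c * x)) else 0) = 0"
      by (auto simp: fun_eq_iff mult_ac)
  qed (auto intro!: linear_fnI simp: distrib_left \<Phi>_add mult_scale \<Phi>_scale)
  finally show ?thesis by simp
qed

lemma power_line_\<Phi>:
  "\<Phi> (w * ((b + scale t v) ^ k * x)) = (\<Sum>j\<le>k. t ^ j * \<Phi> (w * (of_nat (k choose j) *
      (b ^ (k - j) * v ^ j) * x)))"
proof -
  have functional_sum: "\<Phi> (sum f A) = (\<Sum>a\<in>A. \<Phi> (f a))" for f and A :: "nat set"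
    by (induction A rule: infinite_finite_induct) (simp_all add: \<Phi>_add)
  show ?thesis
    unfolding power_line sum_distrib_right sum_distrib_left functional_sum
    by (simp add: scale_mult mult_scale \<Phi>_scale)
qed

text \<open>
  At a point \<open>b\<close> where the map \<open>p \<mapsto> (w \<mapsto> \<Phi> (w p\<^sup>k))\<close> has maximal rank \<open>\<epsilon>\<close>, filter \<open>G\<close> by the
  kernels of the powers of \<open>b\<close>. The graded pieces are the fundamental forms of the image: they only
  depend on \<open>\<epsilon> - 1\<close> variables, since they annihilate \<open>b\<close> and the kernel of the differential.
\<close>

lemma D_le_tau_rank:
  assumes k: "k \<ge> 1" and G: "i + k = d" "subspace G" "G \<subseteq> S i"
  obtains b where "b \<in> S 1" "D G \<le> tau (D ((*) (b ^ (k - 1)) ` G)) k"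
proof (cases "D G = 0")
  case True
  then show thesis using that[of 0] subspace_0[OF subspace_S, of 1] by simp
next
  case False
  have fin: "fin_span G" using fin_span_mono fin_S G(3) by blast
  have S10: "0 \<in> S 1" using subspace_0[OF subspace_S] .
  have powS: "b ^ (k - 1) \<in> S (k - 1)" if "b \<in> S 1" for b using S_power[OF that] .
  have bound: "D ((*) (b ^ j) ` G) \<le> D (S (j + i))" if "b \<in> S 1" for b j
    using times_subset[OF S_power[OF that] G(3)] by (intro D_mono) auto
  have "\<exists>b0. b0 \<in> S 1 \<and> (\<forall>b. b \<in> S 1 \<longrightarrow> D ((*) (b ^ (k - 1)) ` G) \<le> D ((*) (b0 ^ (k - 1)) ` G))"
    by (rule ex_has_greatest_nat[where P = "\<lambda>a. a \<in> S 1" and k = 0 and b =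
        "Suc (D (S (k - 1 + i)))", OF S10])
      (use bound le_imp_less_Suc in blast)
  then obtain b0 where b0: "b0 \<in> S 1"
    "\<And>b. b \<in> S 1 \<Longrightarrow> D ((*) (b ^ (k - 1)) ` G) \<le> D ((*) (b0 ^ (k - 1)) ` G)" by blast
  define \<epsilon> where "\<epsilon> = D ((*) (b0 ^ (k - 1)) ` G)"
  have "\<exists>b\<in>S 1. \<exists>z\<in>G. \<Phi> (b ^ k * z) \<noteq> 0"
  proof (rule ccontr)
    assume neg: "\<not> ?thesis"
    have "ev z = 0" if z: "z \<in> G" for z
    proof -
      have "\<Phi> (z * q) = 0" if "q \<in> S k" for q
      proof -
        have "q \<in> {q. \<Phi> (z * q) = 0}"
        proof (rule polarization[OF _ _ that])
          show "subspace {q. \<Phi> (z * q) = 0}"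
            by (rule subspaceI) (auto simp: distrib_left \<Phi>_add mult_scale \<Phi>_scale)
          show "v ^ k \<in> {q. \<Phi> (z * q) = 0}" if "v \<in> S 1" for v
            using neg that z by (auto simp: mult.commute)
        qed
        then show ?thesis by simp
      qed
      then show ?thesis using ev_graded[of i z] G z by auto
    qed
    then have "D G = 0" by (rule D_eq_0I)
    with False show False by simp
  qed
  then obtain b1 where b1: "b1 \<in> S 1" "\<exists>z\<in>G. \<Phi> (b1 ^ k * z) \<noteq> 0" by blast
  obtain b where b: "b \<in> S 1" "\<epsilon> \<le> D ((*) (b ^ (k - 1)) ` G)" "\<exists>z\<in>G. \<Phi> (b ^ k * z) \<noteq> 0"
  proof (rule common_point[of "\<lambda>b. \<epsilon> \<le> D ((*) (b ^ (k - 1)) ` G)"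
      "\<lambda>b. \<exists>z\<in>G. \<Phi> (b ^ k * z) \<noteq> 0" b0 b1])
    fix x y assume "\<exists>z\<in>G. \<Phi> (x ^ k * z) \<noteq> 0"
    then obtain z where z: "z \<in> G" "\<Phi> (x ^ k * z) \<noteq> 0" by blast
    obtain p where p: "\<forall>t. \<Phi> ((x + scale t y) ^ k * z) = poly p t" using poly_curve_line by blast
    then have "poly p 0 \<noteq> 0" using z(2) p[rule_format, of 0] by simp
    then have "p \<noteq> 0" by auto
    then have "finite {t. poly p t = 0}" by (rule poly_roots_finite)
    moreover have "{t. \<not> (\<exists>z\<in>G. \<Phi> ((x + scale t y) ^ k * z) \<noteq> 0)} \<subseteq> {t. poly p t = 0}"
      using p z(1) by auto
    ultimately show "finite {t. \<not> (\<exists>z\<in>G. \<Phi> ((x + scale t y) ^ k * z) \<noteq> 0)}"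
        by (rule rev_finite_subset)
  qed (use b0 b1 D_line_cofinite[OF fin] \<epsilon>_def in auto)
  have eps: "\<epsilon> = D ((*) (b ^ (k - 1)) ` G)"
    using b(2) b0(2)[OF b(1)] \<epsilon>_def by simp
  define \<mu> where "\<mu> = (\<lambda>x w. if w \<in> G then \<Phi> (w * (b ^ (k - 1) * x)) else 0)"
  have lin\<mu>: "Vector_Spaces.linear scale fscale \<mu>"
    by (rule linear_fnI) (auto simp: \<mu>_def distrib_left \<Phi>_add mult_scale \<Phi>_scale)
  have rank\<mu>: "fn.dim (\<mu> ` S 1) = \<epsilon>"
    unfolding \<mu>_def eps by (rule pairing_rank[OF G powS[OF b(1)] k])
  obtain z0 where z0: "z0 \<in> G" "\<Phi> (b ^ k * z0) \<noteq> 0" using b(3) by blast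
  have "b ^ (k - 1) * b = b ^ k" using k by (metis One_nat_def Suc_pred' less_eq_Suc_le power_Suc2)
  then have "\<mu> b z0 \<noteq> 0" using z0 by (simp add: \<mu>_def mult.commute)
  then have "\<mu> b \<noteq> 0" by auto
  \<comment> \<open>\<open>b\<close> is not in the kernel of \<open>\<mu>\<close>, so besides
    \<open>b\<close> and that kernel only \<open>\<epsilon> - 1\<close> further linear forms are
    needed.\<close>
  then obtain C where C: "finite C" "C \<subseteq> S 1" "Suc (card C) = \<epsilon>"
    "S 1 \<subseteq> span (C \<union> insert b {x \<in> S 1. \<mu> x = 0})"
    using fnp.complement_of_kernel[OF lin\<mu> subspace_S fin_S b(1)] rank\<mu> by metis
  have piece: "D (ker_in b ((*) (b ^ j) ` G)) \<le> tau (card C) (k - j)" if j: "j + 2 \<le> k" for j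
  proof (rule D_le_tau[OF C(1) _ _ _ C(2,4)])
    show "j + i + (k - j) = d" using j G(1) by simp
    show "ker_in b ((*) (b ^ j) ` G) \<subseteq> S (j + i)"
      using ker_in_subset times_subset[OF S_power[OF b(1)] G(3)] by blast
    show "subspace (ker_in b ((*) (b ^ j) ` G))"
      by (intro ker_in_subspace subspace_times G(2))
    have "ev (x * w) = 0" if w: "w \<in> ker_in b ((*) (b ^ j) ` G)" and x: "x \<in> S 1" "\<mu> x = 0" for w x
    proof -
      obtain z where z: "z \<in> G" "w = b ^ j * z" "ev (b * (b ^ j * z)) = 0"
        using w by (auto simp: ker_in_def)
      \<comment> \<open>The degree complementary to that of \<open>x * w\<close>:
        \<open>Suc (j + i) + I = d\<close>.\<close>
      define I where "I = k - 1 - j"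
      have wS: "x * w \<in> S (Suc (j + i))"
        using S_mult_Suc[OF x(1), of w "j + i"] z S_times[OF S_power[OF b(1)]] G(3) by blast
      have "\<Phi> (x * w * q) = 0" if q: "q \<in> S I" for q
      proof -
        have "q \<in> {q. \<Phi> (x * w * q) = 0}"
        proof (rule polarization[OF _ _ q])
          show "subspace {q. \<Phi> (x * w * q) = 0}"
            by (rule subspaceI) (auto simp: distrib_left \<Phi>_add mult_scale \<Phi>_scale)
          fix v assume v: "v \<in> S 1"
          \<comment> \<open>The coefficients in \<open>t\<close> of the differential at
            \<open>b + t v\<close>. Its rank there is at most \<open>\<epsilon>\<close>, its value
            at \<open>b\<close>, so the kernel vector \<open>x\<close> extends along the
            line.\<close>
          define L where "L l = (\<lambda>x w. if w \<in> G then
            \<Phi> (w * (of_nat ((k - 1) choose l) * (b ^ (k - 1 - l) * v ^ l) * x)) else 0)" for l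
          have Lt: "(\<lambda>x q. \<Sum>j\<le>k - 1. t ^ j * L j x q) =
              (\<lambda>x w. if w \<in> G then \<Phi> (w * ((b + scale t v) ^ (k - 1) * x)) else 0)" for t
            by (auto simp: L_def power_line_\<Phi> fun_eq_iff)
          have L0: "L 0 = \<mu>" by (auto simp: L_def \<mu>_def fun_eq_iff)
          have "\<exists>y. y 0 = x \<and> (\<forall>k. y k \<in> S 1) \<and> (\<forall>m\<le>I. \<forall>q. (\<Sum>j\<le>m. L j (y (m - j)) q) = 0)"
          proof (rule kernel_chain[where N = "k - 1"])
            show "infinite (UNIV :: 'k set)" by (rule infinite_UNIV_char_0)
            show "Vector_Spaces.linear scale fscale (L j)" for j
              by (rule linear_fnI) (auto simp: L_def distrib_left \<Phi>_add mult_scale \<Phi>_scale)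
            show "L j x = 0" if "j > k - 1" for j x
              using that by (auto simp: L_def binomial_eq_0 fun_eq_iff)
            show "fn.dim ((\<lambda>x q. \<Sum>j\<le>k - 1. t ^ j * L j x q) ` S 1) \<le> fn.dim (L 0 ` S 1)" for t
              unfolding Lt L0 rank\<mu> pairing_rank[OF G powS[OF S1_line[OF b(1) v]] k]
              using b0(2)[OF S1_line[OF b(1) v]] \<epsilon>_def by simp
            show "L 0 x = 0" using x(2) L0 by simp
          qed (use x(1) in auto)
          then obtain y where y: "y 0 = x" "\<And>m q. m \<le> I \<Longrightarrow> (\<Sum>j\<le>m. L j (y (m - j)) q) = 0" by blast
          \<comment> \<open>For \<open>l < I\<close> the exponent of \<open>b\<close> in
            \<open>L l\<close> is at least \<open>j + 1\<close>; so \<open>b * (b ^ j * z)\<close>,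
            which is killed, can be split off. Only the term \<open>l = I\<close> survives.\<close>
          have vanish: "L l (y (I - l)) z = 0" if "l < I" for l
          proof -
            have "k - 1 - l = (k - 2 - l - j) + Suc j" using that j by (simp add: I_def)
            then have "b ^ (k - 1 - l) = b ^ (k - 2 - l - j) * (b * b ^ j)"
              by (metis power_Suc power_add)
            then have "z * (of_nat ((k - 1) choose l) * (b ^ (k - 1 - l) * v ^ l) * y (I - l)) =
              (b * (b ^ j * z)) * (of_nat ((k - 1) choose l) * (b ^ (k - 2 - l - j) * v ^ l) * y
                  (I - l))"
              by (simp add: mult_ac)
            then show ?thesis using z(3) unfolding L_def ev_eq_0_iff by simp
          qed
          have "(\<Sum>l\<le>I. L l (y (I - l)) z) = L I (y 0) z"
            using vanish by (subst sum.remove[of _ I]) (auto intro!: sum.neutral)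
          then have "L I x z = 0" using y(2)[of I z] y(1) by simp
          moreover have "k - 1 - I = j" using j by (simp add: I_def)
          ultimately have "\<Phi> (z * (of_nat ((k - 1) choose I) * (b ^ j * v ^ I) * x)) = 0"
            using z(1) by (simp add: L_def)
          moreover have "z * (of_nat ((k - 1) choose I) * (b ^ j * v ^ I) * x) =
              scale (of_nat ((k - 1) choose I)) (z * (b ^ j * v ^ I * x))"
            unfolding scale_of_nat by (simp only: mult_ac)
          ultimately have "of_nat ((k - 1) choose I) * \<Phi> (z * (b ^ j * v ^ I * x)) = 0"
            by (simp only: \<Phi>_scale)
          moreover have "(k - 1) choose I \<noteq> 0" using j by (simp add: I_def)
          ultimately show "v ^ I \<in> {q. \<Phi> (x * w * q) = 0}"
            by (simp add: z(2) mult_ac)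
        qed
        then show ?thesis by simp
      qed
      moreover have "d - Suc (j + i) = I" "Suc (j + i) \<le> d" using j G(1) by (auto simp: I_def)
      ultimately show ?thesis using ev_graded[OF _ wS] by simp
    qed
    moreover have "ev (b * w) = 0" if "w \<in> ker_in b ((*) (b ^ j) ` G)" for w
      using that by (simp add: ker_in_def)
    ultimately show "\<forall>w\<in>ker_in b ((*) (b ^ j) ` G). \<forall>x\<in>insert b {x \<in> S 1. \<mu> x = 0}. ev (x * w) = 0"
      by blast
  qed
  \<comment> \<open>The pieces are added by Pascal's rule, from the power \<open>k - 1\<close> of
    \<open>b\<close>, where the rank is \<open>\<epsilon> = tau \<epsilon> 1\<close>, down to the
    power 0.\<close>
  have "D ((*) (b ^ (k - Suc m)) ` G) \<le> tau \<epsilon> (Suc m)" if "m < k" for m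
    using that
  proof (induction m)
    case 0
    then show ?case using eps by simp
  next
    case (Suc m)
    let ?j = "k - Suc (Suc m)"
    have "(*) b ` (*) (b ^ ?j) ` G = (*) (b ^ (k - Suc m)) ` G"
    proof -
      have "k - Suc m = Suc ?j" using Suc.prems by simp
      then show ?thesis by (simp add: image_image mult.assoc)
    qed
    then have "D ((*) (b ^ ?j) ` G) = D ((*) (b ^ (k - Suc m)) ` G) + D (ker_in b
        ((*) (b ^ ?j) ` G))"
      using D_split_ker[OF subspace_times[OF G(2)] fin_times[OF fin], of "b ^ ?j" b] by simp
    moreover have "D (ker_in b ((*) (b ^ ?j) ` G)) \<le> tau (card C) (Suc (Suc m))"
      using piece[of ?j] Suc.prems by simp
    ultimately show ?case
      using Suc tau_Suc_Suc[of "card C" "Suc m"] C(3) by simp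
  qed
  from this[of "k - 1"] have "D G \<le> tau \<epsilon> k" using k by simp
  then show thesis using that[OF b(1)] eps by simp
qed

end

section \<open>The minimality theorem for graded functionals\<close>

lemma tau_mono: "a \<le> b \<Longrightarrow> tau a k \<le> tau b k"
  by (simp add: tau_def binomial_right_mono)

lemma tau_two: "tau 2 k = Suc k"
  by (simp add: tau_def)

text \<open>Pascal's rule iterated. The terms of degrees 0 and 1 are split off because the spaces
  \<open>G j\<close> with \<open>j < d - 2\<close> account for the degrees from 2 on.\<close>

lemma tau_eq_sum: "K \<ge> 1 \<Longrightarrow> tau (Suc m) K = Suc m + (\<Sum>k=2..K. tau m k)"
proof (induction K rule: nat_induct_at_least)
  case base
  show ?case by simp
next
  case (Suc K)
  then show ?case by (simp add: tau_Suc_Suc)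
qed

lemma (in vspace) dim_insert_ge:
  assumes "fin_span X" "subspace U" "U \<subseteq> X" "v \<in> X" "v \<notin> U"
  shows "Suc (dim U) \<le> dim X"
proof -
  obtain B where B: "finite B" "B \<subseteq> U" "independent B" "U \<subseteq> span B" "card B = dim U"
    using fin_span_basis[OF fin_span_mono[OF assms(1,3)]] by blast
  have "span B \<subseteq> U" using B(2) assms(2) by (rule span_minimal)
  then have v: "v \<notin> span B" using assms(5) by blast
  then have "independent (insert v B)" using B(3) by (rule independent_insertI)
  then have "card (insert v B) \<le> dim X"
    using independent_card_le_dim_fin[OF assms(1)] B(2) assms(3,4) by blast
  moreover have "v \<notin> B" using v span_base by blast
  ultimately show ?thesis using B(1,5) by simp
qed

context graded_functional
begin

lemma \<Phi>_diff: "\<Phi> (x - y) = \<Phi> x - \<Phi> y"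
  using \<Phi>_add[of x "- y"] \<Phi>_minus[of y] by simp

text \<open>The quotient of \<open>A\<close> by \<open>a A\<close> in degree \<open>i\<close> is
  dual to the annihilator of \<open>a\<close> in degree \<open>d - i\<close>. This combines the
  symmetries for \<open>\<Phi>\<close> and for \<open>\<Phi> (a * q)\<close>.\<close>

lemma D_decompose:
  assumes "a \<in> S 1" "1 \<le> i" "i \<le> d"
  shows "D (S i) = D ((*) a ` S (i - 1)) + D (ker_in a (S (d - i)))"
proof -
  have d1: "d \<ge> 1" using assms by simp
  interpret g: graded_functional scale S "\<lambda>q. \<Phi> (a * q)" "d - 1"
      by (rule graded_functional_mult[OF assms(1) d1])
  have "D ((*) a ` S (d - i)) = D ((*) a ` S (i - 1))"
    using g.D_sym[of "d - i"] assms(2,3) by (simp add: D_mult[OF assms(1) d1])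
  then show ?thesis
    using D_sym[OF assms(3)] D_split_ker[OF subspace_S fin_S, of "d - i" a] by simp
qed

text \<open>If \<open>\<Phi> (v ^ d)\<close> vanished for all \<open>v\<close>, then by polarization
  \<open>\<Phi>\<close> would vanish on \<open>S d\<close>, and no linear form would survive in the
  quotient. So each condition holds somewhere, and \<open>common_point\<close> joins them.\<close>

lemma general_element:
  assumes "D (S 1) \<ge> 1" "d \<ge> 1"
  obtains l where "l \<in> S 1" "\<And>a. a \<in> S 1 \<Longrightarrow> D ((*) a ` S 1) \<le> D ((*) l ` S 1)" "\<Phi> (l ^ d) \<noteq> 0"
proof -
  have S10: "0 \<in> S 1" using subspace_0[OF subspace_S] .
  have bound: "D ((*) a ` S 1) \<le> D (S (1 + 1))" if "a \<in> S 1" for a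
    using times_subset[OF that subset_refl] by (intro D_mono) auto
  have "\<exists>l. l \<in> S 1 \<and> (\<forall>a. a \<in> S 1 \<longrightarrow> D ((*) a ` S 1) \<le> D ((*) l ` S 1))"
    by (rule ex_has_greatest_nat[where P = "\<lambda>a. a \<in> S 1" and k = 0 and b =
        "Suc (D (S (1 + 1)))", OF S10])
      (use bound le_imp_less_Suc in blast)
  then obtain l0 where l0: "l0 \<in> S 1" "\<And>a. a \<in> S 1 \<Longrightarrow> D ((*) a ` S 1) \<le> D ((*) l0 ` S 1)" by blast
  have "\<exists>v\<in>S 1. \<Phi> (v ^ d) \<noteq> 0"
  proof (rule ccontr)
    assume neg: "\<not> ?thesis"
    have "\<Phi> q = 0" if "q \<in> S d" for q
    proof -
      have "q \<in> {q. \<Phi> q = 0}"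
        by (rule polarization[OF _ _ that]) (use neg in \<open>auto intro!: subspaceI simp: \<Phi>_add
            \<Phi>_scale\<close>)
      then show ?thesis by simp
    qed
    then have "ev s = 0" if "s \<in> S 1" for s
      using ev_graded[OF assms(2) that] S_times[OF that, of _ "d - 1"] assms(2) by auto
    then have "D (S 1) = 0" by (rule D_eq_0I)
    then show False using assms(1) by simp
  qed
  then obtain l1 where l1: "l1 \<in> S 1" "\<Phi> (l1 ^ d) \<noteq> 0" by blast
  obtain l where "l \<in> S 1" "D ((*) l0 ` S 1) \<le> D ((*) l ` S 1)" "\<Phi> (l ^ d) \<noteq> 0"
  proof (rule common_point[of "\<lambda>l. D ((*) l0 ` S 1) \<le> D ((*) l ` S 1)" "\<lambda>l. \<Phi> (l ^ d) \<noteq> 0" l0 l1])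
    fix x y assume x: "\<Phi> (x ^ d) \<noteq> 0"
    obtain p where p: "\<forall>t. \<Phi> ((x + scale t y) ^ d * 1) = poly p t" using poly_curve_line by blast
    then have "poly p 0 \<noteq> 0" using x p[rule_format, of 0] by simp
    then have "p \<noteq> 0" by auto
    then show "finite {t. \<not> \<Phi> ((x + scale t y) ^ d) \<noteq> 0}"
      using poly_roots_finite p by simp
  qed (use l0 l1 D_line_cofinite_1[OF fin_S] in auto)
  then show thesis using that l0(2) le_trans by blast
qed

end

section \<open>The kernel of a general linear form and the ideal that it generates\<close>

locale general_linear_form = graded_functional scale S \<Phi> d
  for scale :: "'k::field_char_0 \<Rightarrow> 's::comm_ring_1 \<Rightarrow> 's" and S \<Phi> d +
  fixes l :: 's
  assumes l: "l \<in> S 1" and l_max: "\<And>a. a \<in> S 1 \<Longrightarrow> D ((*) a ` S 1) \<le> D ((*) l ` S 1)"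
    and l_power: "\<Phi> (l ^ d) \<noteq> 0"
begin

definition Z :: "'s set" where
  "Z = ker_in l (S 1)"

lemma Z_subspace: "subspace Z" and Z_subset: "Z \<subseteq> S 1" and Z_ev: "z \<in> Z \<Longrightarrow> ev (l * z) = 0"
  unfolding Z_def using ker_in_subspace ker_in_subset by (auto simp: ker_in_def)

text \<open>Solves \<open>(l - t b) (\<Sum> t ^ k y k) = 0\<close> up to order \<open>K\<close> with
  constant term \<open>z\<close>. A solution exists because the rank of \<open>l\<close> is maximal
  in the pencil.\<close>

lemma chain:
  assumes "z \<in> Z" "b \<in> S 1"
  obtains y where "y 0 = z" "\<And>k. y k \<in> S 1" "\<And>k. k < K \<Longrightarrow> ev (l * y (Suc k)) = ev (b * y k)"
proof -
  define L where "L j = (if j = 0 then (\<lambda>x. ev (l * x)) else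
      if j = 1 then (\<lambda>x. ev ((- b) * x)) else (\<lambda>x. 0))"
    for j :: nat
  have Lt: "(\<Sum>j\<le>1. t ^ j * L j x q) = ev ((l + scale t (- b)) * x) q" for t x q
    by (simp add: L_def ev_def left_diff_distrib scale_mult \<Phi>_diff \<Phi>_minus \<Phi>_scale)
  have "\<exists>y. y 0 = z \<and> (\<forall>k. y k \<in> S 1) \<and> (\<forall>k\<le>K. \<forall>q. (\<Sum>j\<le>k. L j (y (k - j)) q) = 0)"
  proof (rule kernel_chain[where N = 1])
    show "infinite (UNIV :: 'k set)" by (rule infinite_UNIV_char_0)
    show "Vector_Spaces.linear scale fscale (L j)" for j
      using linear_ev_mult[of l] linear_ev_mult[of "- b"] by (simp add: L_def linear_fnI)
    show "L j x = 0" if "j > 1" for j x using that by (simp add: L_def)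
    show "fn.dim ((\<lambda>x q. \<Sum>j\<le>1. t ^ j * L j x q) ` S 1) \<le> fn.dim (L 0 ` S 1)" for t
      using l_max[OF S1_line[OF l subspace_neg[OF subspace_S assms(2)], of t]]
      unfolding Lt by (simp add: L_def D_def image_image)
    show "L 0 z = 0" using Z_ev[OF assms(1)] by (simp add: L_def)
  qed (use assms Z_subset in auto)
  then obtain y where y: "y 0 = z" "\<And>k. y k \<in> S 1" "\<And>k q. k \<le> K \<Longrightarrow> (\<Sum>j\<le>k. L j (y (k - j)) q) = 0"
    by blast
  have "ev (l * y (Suc k)) = ev (b * y k)" if "k < K" for k
  proof
    fix q
    have "(\<Sum>j\<le>Suc k. L j (y (Suc k - j)) q) = L 0 (y (Suc k)) q + L 1 (y k) q + (\<Sum>j<k. L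
        (Suc (Suc j)) (y (k - Suc j)) q)"
      by (simp only: sum.atMost_Suc_shift lessThan_Suc_atMost[symmetric] sum.lessThan_Suc_shift)
          simp
    also have "\<dots> = ev (l * y (Suc k)) q - ev (b * y k) q"
      by (simp add: L_def ev_def \<Phi>_minus)
    finally show "ev (l * y (Suc k)) q = ev (b * y k) q" using y(3)[of "Suc k" q] that by simp
  qed
  then show thesis using that y by blast
qed

lemma chain_power:
  assumes "y 0 = z" "\<And>k. k < K \<Longrightarrow> ev (l * y (Suc k)) = ev (b * y k)" "k \<le> K"
  shows "ev (b ^ k * z) = ev (l ^ k * y k)"
  using assms(3)
proof (induction k)
  case 0
  then show ?case using assms(1) by simp
next
  case (Suc k)
  then have "ev (b * (b ^ k * z)) = ev (b * (l ^ k * y k))" by (intro ev_mult_cong) simp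
  also have "\<dots> = ev (l ^ k * (b * y k))" by (simp only: mult.left_commute)
  also have "\<dots> = ev (l ^ k * (l * y (Suc k)))"
    using assms(2)[of k] Suc.prems by (intro ev_mult_cong) simp
  finally show ?case by (simp add: mult_ac)
qed

text \<open>The factor \<open>l\<close> moves from \<open>y'\<close> to \<open>z\<close>, which it
  kills. This is the source of the isotropy below.\<close>

lemma chain_annihilates:
  assumes "ev (l * y') = ev (b * y)" "z \<in> Z"
  shows "ev (b * (z * y)) = 0"
proof -
  have "ev (z * (b * y)) = ev (z * (l * y'))" using assms(1) by (intro ev_mult_cong) simp
  also have "\<dots> = ev (y' * (l * z))" by (simp only: mult_ac)
  also have "\<dots> = 0" using ev_mult_0[OF Z_ev[OF assms(2)]] .
  finally show ?thesis by (simp only: mult_ac)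
qed

definition G :: "nat \<Rightarrow> 's set" where
  "G j = span {s * z | s z. s \<in> S j \<and> z \<in> Z}"

lemma G_subspace: "subspace (G j)"
  by (simp add: G_def)

lemma G_subset: "G j \<subseteq> ker_in l (S (Suc j))"
  unfolding G_def
proof (rule span_minimal)
  show "{s * z | s z. s \<in> S j \<and> z \<in> Z} \<subseteq> ker_in l (S (Suc j))"
  proof clarify
    fix s z assume sz: "s \<in> S j" "z \<in> Z"
    have "s * z \<in> S (Suc j)" using S_times[OF sz(1), of z 1] sz(2) Z_subset by auto
    moreover have "ev (l * (s * z)) = 0"
      using ev_mult_0[OF Z_ev[OF sz(2)], of s] by (simp only: mult.left_commute)
    ultimately show "s * z \<in> ker_in l (S (Suc j))" by (simp add: ker_in_def)
  qed
qed (rule ker_in_subspace[OF subspace_S])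

lemma G_subset_S: "G j \<subseteq> S (Suc j)"
  using G_subset ker_in_subset by blast

lemma fin_G: "fin_span (G j)"
  using fin_span_mono[OF fin_S G_subset_S] .

lemma times_G: "a \<in> S 1 \<Longrightarrow> (*) a ` G j \<subseteq> G (Suc j)"
proof -
  assume a: "a \<in> S 1"
  have "G j \<subseteq> {x. a * x \<in> G (Suc j)}"
    unfolding G_def[of j]
  proof (rule span_minimal)
    show "{s * z | s z. s \<in> S j \<and> z \<in> Z} \<subseteq> {x. a * x \<in> G (Suc j)}"
    proof clarify
      fix s z assume "s \<in> S j" "z \<in> Z"
      then show "a * (s * z) \<in> G (Suc j)"
        unfolding G_def mult.assoc[symmetric] using S_mult_Suc[OF a] by (intro span_base) blast
    qed
    show "subspace {x. a * x \<in> G (Suc j)}"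
      using G_subspace[of "Suc j"]
      by (intro subspaceI) (auto simp: subspace_0 distrib_left subspace_add mult_scale
          subspace_scale)
  qed
  then show ?thesis by blast
qed

lemma G_0: "G 0 = Z"
proof
  show "G 0 \<subseteq> Z" using G_subset[of 0] by (simp add: Z_def)
  show "Z \<subseteq> G 0"
    unfolding G_def using one_in_S by (intro subsetI span_base) (metis (mono_tags, lifting)
        mem_Collect_eq mult_1)
qed

text \<open>The chain turns \<open>b ^ j * z\<close> into \<open>l ^ j * y j\<close>, and by
  polarization such products span \<open>G j\<close>. Hence in the quotient \<open>G j\<close> lies
  in the part of \<open>l ^ j S 1\<close> killed by \<open>l\<close>, which is what is lost on
  passing to the next power of \<open>l\<close>.\<close>

lemma G_osculating: "D (G j) + D ((*) (l ^ Suc j) ` S 1) \<le> D ((*) (l ^ j) ` S 1)"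
proof -
  let ?R = "ker_in l ((*) (l ^ j) ` S 1)"
  have subR: "subspace ?R" by (intro ker_in_subspace subspace_times subspace_S)
  have finR: "fin_span ?R" by (rule fin_span_mono[OF fin_times[OF fin_S] ker_in_subset])
  have subev: "fn.subspace (ev ` ?R)"
    using module_hom.subspace_image[OF Vector_Spaces.linear.axioms(3)[OF linear_ev] subR] .
  have pre: "subspace {x. ev x \<in> ev ` ?R}"
    using module_hom.subspace_linear_preimage[OF Vector_Spaces.linear.axioms(3)[OF linear_ev]
        subev] .
  have "G j \<subseteq> {x. ev x \<in> ev ` ?R}"
    unfolding G_def
  proof (rule span_minimal[OF _ pre], clarify)
    fix s z assume s: "s \<in> S j" and z: "z \<in> Z"
    have "s \<in> {s. ev (z * s) \<in> ev ` ?R}"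
    proof (rule polarization[OF _ _ s])
      show "subspace {s. ev (z * s) \<in> ev ` ?R}"
        using module_hom.subspace_linear_preimage[OF Vector_Spaces.linear.axioms(3)[OF
            linear_ev_mult] subev] .
      fix b assume b: "b \<in> S 1"
      obtain y where y: "y 0 = z" "\<And>k. y k \<in> S 1" "\<And>k. k < j \<Longrightarrow> ev (l * y (Suc k)) = ev (b * y k)"
        using chain[OF z b] by blast
      have eq: "ev (b ^ j * z) = ev (l ^ j * y j)"
        using chain_power[where y = y and K = j, OF y(1) y(3) order_refl] by blast
      have "ev (l * (l ^ j * y j)) = ev (l * (b ^ j * z))" using eq by (intro ev_mult_cong) simp
      also have "\<dots> = ev (b ^ j * (l * z))" by (simp only: mult.left_commute)
      also have "\<dots> = 0" using ev_mult_0[OF Z_ev[OF z]] .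
      finally have "l ^ j * y j \<in> ?R" using y(2) by (simp add: ker_in_def)
      then show "b ^ j \<in> {s. ev (z * s) \<in> ev ` ?R}"
        using eq by (simp add: mult.commute[of z])
    qed
    then show "ev (s * z) \<in> ev ` ?R" by (simp add: mult.commute)
  qed
  then have "ev ` G j \<subseteq> ev ` ?R" by blast
  then have "D (G j) \<le> D ?R"
    unfolding D_def by (rule fn.dim_mono_fin[OF fin_ev[OF finR]])
  moreover have "(*) l ` (*) (l ^ j) ` S 1 = (*) (l ^ Suc j) ` S 1"
    by (simp add: image_image mult.assoc)
  ultimately show ?thesis
    using D_split_ker[of "(*) (l ^ j) ` S 1" l, OF subspace_times[OF subspace_S] fin_times[OF
        fin_S]]
    by simp
qed

lemma sum_G_le: "(\<Sum>j<J. D (G j)) + D ((*) (l ^ J) ` S 1) \<le> D (S 1)"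
proof (induction J)
  case 0
  have "(*) 1 ` S 1 = S 1" by (simp add: image_def)
  then show ?case by simp
next
  case (Suc J)
  then show ?case using G_osculating[of J] by simp
qed

text \<open>
  The space \<open>b\<^sup>d\<^sup>-\<^sup>2 Z\<close> is isotropic for the quadratic form \<open>\<Phi> (l\<^sup>d\<^sup>-\<^sup>2 x y)\<close>, and orthogonal to the
  anisotropic vector \<open>l\<close>.
\<close>

lemma isotropic:
  assumes b: "b \<in> S 1" and d: "d \<ge> 3"
  shows "2 * D ((*) (b ^ (d - 2)) ` Z) + 1 \<le> D ((*) (l ^ (d - 2)) ` S 1)"
proof -
  define c where "c = l ^ (d - 2)"
  define E where "E = (*) (b ^ (d - 2)) ` Z"
  \<comment> \<open>The linear forms that represent \<open>E\<close> under the quadratic form;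
    \<open>N\<close> is their orthogonal complement.\<close>
  define Y where "Y = {y \<in> S 1. ev (c * y) \<in> ev ` E}"
  define f where "f = (\<lambda>x y. if y \<in> Y then \<Phi> (y * (c * x)) else 0)"
  define N where "N = {x \<in> S 1. f x = 0}"
  have finZ: "fin_span Z" using fin_span_mono[OF fin_S Z_subset] .
  have subE: "fn.subspace (ev ` E)"
    using module_hom.subspace_image[OF Vector_Spaces.linear.axioms(3)[OF linear_ev]
        subspace_times[OF Z_subspace]]
    unfolding E_def .
  have lift: "\<exists>y\<in>S 1. ev (c * y) = ev (b ^ (d - 2) * z) \<and> (\<forall>z'\<in>Z. ev (b ^ (d - 2) * z' * y) = 0)"
    if z: "z \<in> Z" for z
  proof -
    \<comment> \<open>One link more than the representative \<open>y (d - 2)\<close> needs: its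
      orthogonality to \<open>E\<close> uses \<open>y (d - 1)\<close>.\<close>
    obtain y where y: "y 0 = z" "\<And>k. y k \<in> S 1" "\<And>k. k < d - 1 \<Longrightarrow> ev (l * y (Suc k)) = ev (b * y k)"
      using chain[OF z b] by blast
    have "ev (b ^ (d - 2) * z) = ev (c * y (d - 2))"
      unfolding c_def using chain_power[where y = y and K = "d - 1", OF y(1) y(3)] by simp
    moreover have "ev (b ^ (d - 2) * z' * y (d - 2)) = 0" if "z' \<in> Z" for z'
    proof -
      have "ev (b * (z' * y (d - 2))) = 0"
        using chain_annihilates[OF y(3)[of "d - 2"] that] d by simp
      then have "ev (b ^ (d - 3) * (b * (z' * y (d - 2)))) = 0" by (rule ev_mult_0)
      moreover have "d - 2 = Suc (d - 3)" using d by simp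
      ultimately show ?thesis by (simp add: mult_ac)
    qed
    ultimately show ?thesis using y(2) by metis
  qed
  have Ysub: "subspace Y"
  proof -
    have "subspace {y. ev (c * y) \<in> ev ` E}"
      using module_hom.subspace_linear_preimage[OF Vector_Spaces.linear.axioms(3)[OF
          linear_ev_mult] subE] .
    moreover have "Y = S 1 \<inter> {y. ev (c * y) \<in> ev ` E}" by (auto simp: Y_def)
    ultimately show ?thesis by (simp add: subspace_inter)
  qed
  have "ev ` (*) c ` Y = ev ` E"
  proof
    show "ev ` (*) c ` Y \<subseteq> ev ` E" by (auto simp: Y_def)
    show "ev ` E \<subseteq> ev ` (*) c ` Y"
    proof
      fix h assume h: "h \<in> ev ` E"
      then obtain z where z: "z \<in> Z" "h = ev (b ^ (d - 2) * z)" unfolding E_def by blast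
      then obtain y where y: "y \<in> S 1" "ev (c * y) = h" using lift by metis
      then have "y \<in> Y" using h by (simp add: Y_def)
      then show "h \<in> ev ` (*) c ` Y" using y(2) by blast
    qed
  qed
  then have DY: "D ((*) c ` Y) = D E" by (simp add: D_def)
  have cS: "c \<in> S (d - 1 - 1)" unfolding c_def using S_power[OF l, of "d - 2"] d
      by (simp add: numeral_2_eq_2)
  have YS: "Y \<subseteq> S 1" by (auto simp: Y_def)
  have rank_f: "fn.dim (f ` S 1) = D E"
    unfolding f_def using pairing_rank[of 1 "d - 1" Y c, OF _ Ysub YS cS] d DY by simp
  have lin_f: "Vector_Spaces.linear scale fscale f"
    by (rule linear_fnI) (auto simp: f_def distrib_left \<Phi>_add mult_scale \<Phi>_scale)
  have subN: "subspace N"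
  proof -
    have "N = S 1 \<inter> {x. f x = 0}" by (auto simp: N_def)
    then show ?thesis
      using module_hom.subspace_kernel[OF Vector_Spaces.linear.axioms(3)[OF lin_f]]
      by (simp add: subspace_inter)
  qed
  have finN: "fin_span N" using fin_span_mono[OF fin_S[of 1]] by (auto simp: N_def)
  have f0: "f x = 0" if "ev (c * x) = 0" for x
  proof -
    have "\<Phi> (y * (c * x)) = 0" for y
      using that[unfolded ev_eq_0_iff, rule_format, of y] by (simp add: mult.commute)
    then show ?thesis by (auto simp: f_def)
  qed
  have "dim (S 1) = D E + dim N"
    using fnp.rank_nullity[OF lin_f subspace_S fin_S, of 1] rank_f by (simp add: N_def)
  moreover have "dim N = D ((*) c ` N) + dim {x \<in> N. ev (c * x) = 0}"
    using fnp.rank_nullity[OF linear_ev_mult subN finN, of c] by (simp add: D_def image_image)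
  moreover have "{x \<in> N. ev (c * x) = 0} = {x \<in> S 1. ev (c * x) = 0}"
    using f0 by (auto simp: N_def)
  moreover have "dim (S 1) = D ((*) c ` S 1) + dim {x \<in> S 1. ev (c * x) = 0}"
    using fnp.rank_nullity[OF linear_ev_mult[of c] subspace_S[of 1] fin_S]
        by (simp add: D_def image_image)
  ultimately have main: "D ((*) c ` S 1) = D E + D ((*) c ` N)" by simp
  have N_I: "x \<in> N" if x: "x \<in> S 1" "\<And>z. z \<in> Z \<Longrightarrow> ev (b ^ (d - 2) * z * x) = 0" for x
  proof -
    have "\<Phi> (y * (c * x)) = 0" if y: "y \<in> Y" for y
    proof -
      obtain z where z: "z \<in> Z" "ev (c * y) = ev (b ^ (d - 2) * z)" using y
          by (auto simp: Y_def E_def)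
      have "\<Phi> (y * (c * x)) = ev (c * y) x" by (simp add: ev_def mult_ac)
      also have "\<dots> = \<Phi> (b ^ (d - 2) * z * x)" unfolding z(2) by (simp add: ev_def)
      also have "\<dots> = 0" using x(2)[OF z(1), unfolded ev_eq_0_iff, rule_format, of 1] by simp
      finally show ?thesis .
    qed
    then show ?thesis using x(1) by (auto simp: N_def f_def fun_eq_iff)
  qed
  \<comment> \<open>By isotropy \<open>N\<close> contains representatives of all of
    \<open>E\<close>. It also contains \<open>l\<close>, whose value \<open>\<Phi> (l ^ d)\<close>
    under the form is nonzero, so that \<open>c * l\<close> is not in \<open>E\<close> modulo the
    kernel of \<open>ev\<close>.\<close>
  have "Suc (D E) \<le> D ((*) c ` N)"
    unfolding D_def
  proof (rule fn.dim_insert_ge[OF _ subE])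
    show "fn.fin_span (ev ` (*) c ` N)" by (intro fin_ev fin_times finN)
    show "ev ` E \<subseteq> ev ` (*) c ` N"
    proof
      fix h assume "h \<in> ev ` E"
      then obtain z where z: "z \<in> Z" "h = ev (b ^ (d - 2) * z)" unfolding E_def by blast
      then obtain y where "y \<in> S 1" "ev (c * y) = h" "\<forall>z'\<in>Z. ev (b ^ (d - 2) * z' * y) = 0"
        using lift by metis
      then show "h \<in> ev ` (*) c ` N" using N_I by blast
    qed
    have zl: "ev (b ^ (d - 2) * z * l) = 0" if "z \<in> Z" for z
      using ev_mult_0[OF Z_ev[OF that], of "b ^ (d - 2)"] by (simp add: mult_ac)
    show "ev (c * l) \<in> ev ` (*) c ` N" using N_I[OF l zl] by blast
    show "ev (c * l) \<notin> ev ` E"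
    proof
      assume "ev (c * l) \<in> ev ` E"
      then obtain z where z: "z \<in> Z" "ev (c * l) = ev (b ^ (d - 2) * z)" unfolding E_def by blast
      have "\<Phi> (c * l * l) = \<Phi> (b ^ (d - 2) * z * l)" using fun_cong[OF z(2), of l]
          by (simp add: ev_def)
      also have "\<dots> = 0" using zl[OF z(1), unfolded ev_eq_0_iff, rule_format, of 1] by simp
      finally have "\<Phi> (c * l * l) = 0" .
      moreover have "c * l * l = l ^ d"
      proof -
        have "d = Suc (Suc (d - 2))" using d by simp
        then show ?thesis unfolding c_def by (metis mult.assoc mult.commute power_Suc)
      qed
      ultimately show False using l_power by simp
    qed
  qed
  with main show ?thesis by (simp add: c_def E_def)
qed

text \<open>Indexed by the complementary degree: \<open>G (d - 1 - k)\<close> lies in degree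
  \<open>d - k\<close> and is treated as a space of forms of degree \<open>k\<close>.\<close>

definition g :: "nat \<Rightarrow> nat" where
  "g k = D (G (d - 1 - k))"

lemma g_top: "g (d - 1) = D Z"
  by (simp add: g_def G_0)

lemma G_index: "1 \<le> k \<Longrightarrow> k < d \<Longrightarrow> Suc (d - 1 - k) + k = d"
  by simp

lemma g_step_subset:
  assumes "a \<in> S 1" "2 \<le> k" "k < d"
  shows "D ((*) a ` G (d - 1 - k)) \<le> g (k - 1)"
proof -
  have "d - 1 - (k - 1) = Suc (d - 1 - k)" using assms by simp
  then have "g (k - 1) = D (G (Suc (d - 1 - k)))" unfolding g_def by (rule arg_cong)
  then show ?thesis using D_mono[OF times_G[OF assms(1)] fin_G] by simp
qed

lemma g_descends:
  assumes m: "1 \<le> m" and k: "2 \<le> k" "k < d" and "tau m k \<le> g k"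
  shows "tau m (k - 1) \<le> g (k - 1)"
proof -
  have "rank_descends m k" using rank_descends_and_green_bound[of k] m k by simp
  then obtain a where "a \<in> S 1" "tau m (k - 1) \<le> D ((*) a ` G (d - 1 - k))"
    using assms(4) G_index[of k] k G_subspace G_subset_S unfolding rank_descends_def g_def
    by (metis Suc_1 Suc_leD)
  then show ?thesis using g_step_subset[OF _ k] le_trans by blast
qed

lemma g_descends_all:
  assumes "1 \<le> m" "1 \<le> j" "j \<le> k" "k < d" "tau m k \<le> g k"
  shows "tau m j \<le> g j"
  using assms(3)
proof (induction rule: inc_induct)
  case base
  show ?case by (rule assms(5))
next
  case (step i)
  then show ?case using g_descends[of m "Suc i"] assms by simp
qed

text \<open>Each \<open>a\<close> maps the space counted by \<open>g k\<close> into the one counted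
  by \<open>g (k - 1)\<close>, so the difference bounds every kernel from below, as
  \<open>green_bound\<close> requires.\<close>

lemma g_jump:
  assumes m: "2 \<le> m" and k: "2 \<le> k" "k < d" and jump: "g (k - 1) + tau (m - 1) k \<le> g k"
  shows "tau m k \<le> g k"
proof -
  have "green_bound m k" using rank_descends_and_green_bound[of k] m k by simp
  moreover have "tau (m - 1) k \<le> D (ker_in a (G (d - 1 - k)))" if a: "a \<in> S 1" for a
    using D_split_ker[OF G_subspace fin_G, of "d - 1 - k" a] g_step_subset[OF a k] jump
    by (simp add: g_def)
  ultimately show ?thesis
    using G_index[of k] k G_subspace G_subset_S unfolding green_bound_def g_def
    by (metis Suc_1 Suc_leD)
qed

lemma g_le_cokernel:
  assumes "1 \<le> i" "i < d"
  shows "D ((*) l ` S (i - 1)) + g i \<le> D (S i)"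
proof -
  have "G (d - 1 - i) \<subseteq> ker_in l (S (d - i))"
    using G_subset[of "d - 1 - i"] assms by (simp add: Suc_diff_Suc)
  then have "g i \<le> D (ker_in l (S (d - i)))"
    unfolding g_def by (rule D_mono) (rule fin_span_mono[OF fin_S ker_in_subset])
  then show ?thesis using D_decompose[OF l assms(1)] assms(2) by simp
qed

text \<open>It suffices to reach \<open>tau m (d - 1)\<close> at the top and descend. For
  \<open>m \<ge> 2\<close> the hypotheses in degrees 1 and 2 say that from 2 to \<open>d - 1\<close>
  the function \<open>g\<close> grows at least as much as \<open>tau m\<close>. So it does in some
  single step, where \<open>g_jump\<close> makes \<open>g k\<close> large; descending bounds
  \<open>g 2\<close>, and the growth then bounds the top.\<close>

lemma tau_le_g:
  assumes d: "d \<ge> 4" and m: "m \<ge> 1"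
    and D1: "D (S 1) = Suc m + tau (Suc m) (d - 1)"
    and D2: "D (S 2) \<le> tau (Suc m) 2 + tau (Suc m) (d - 2)"
    and Z: "m = 1 \<Longrightarrow> D Z \<ge> 1"
    and k: "1 \<le> k" "k < d"
  shows "tau m k \<le> g k"
proof -
  have top: "tau m (d - 1) \<le> D Z"
  proof (cases "m = 1")
    case True
    then show ?thesis using Z by simp
  next
    case False
    have "D (S 1) = D ((*) l ` S 1) + D Z"
      unfolding Z_def using D_split_ker[OF subspace_S fin_S] .
    moreover have "D ((*) l ` S 1) + g 2 \<le> D (S 2)"
      using g_le_cokernel[of 2] d by simp
    moreover have "tau (Suc m) (d - 1) = tau m (d - 1) + tau (Suc m) (d - 2)"
      using tau_Suc_Suc[of m "d - 2"] d by (simp add: Suc_diff_Suc numeral_2_eq_2)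
    moreover have "tau (Suc m) 2 = tau m 2 + Suc m"
      using tau_Suc_Suc[of m 1] by (simp add: numeral_2_eq_2)
    ultimately have gap: "tau m (d - 1) + g 2 \<le> D Z + tau m 2"
      using D1 D2 by linarith
    have "\<exists>k. 3 \<le> k \<and> k < d \<and> g (k - 1) + tau (m - 1) k \<le> g k"
    proof (rule ccontr)
      assume neg: "\<not> ?thesis"
      have less: "K < d \<longrightarrow> g K + tau m 2 < g 2 + tau m K" if "K \<ge> 3" for K
        using that
      proof (induction K rule: nat_induct_at_least)
        case base
        have "\<not> g 2 + tau (m - 1) 3 \<le> g 3" if "3 < d" using neg[simplified, rule_format,
            of 3] that by simp
        moreover have "tau m 3 = tau (m - 1) 3 + tau m 2"
          using tau_Suc_Suc[of "m - 1" 2] m by (simp add: numeral_3_eq_3 numeral_2_eq_2)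
        ultimately show ?case by linarith
      next
        case (Suc K)
        have "\<not> g K + tau (m - 1) (Suc K) \<le> g (Suc K)" if "Suc K < d"
          using neg[simplified, rule_format, of "Suc K"] that Suc.hyps by simp
        moreover have "tau m (Suc K) = tau (m - 1) (Suc K) + tau m K"
          using tau_Suc_Suc[of "m - 1" K] m by simp
        ultimately show ?case using Suc.IH by linarith
      qed
      have "3 \<le> d - 1" "d - 1 < d" using d by simp_all
      then show False using less[of "d - 1"] gap g_top by simp
    qed
    then obtain k where k: "3 \<le> k" "k < d" "g (k - 1) + tau (m - 1) k \<le> g k" by blast
    then have "tau m k \<le> g k" using g_jump[of m k] False m by simp
    then have "tau m 2 \<le> g 2" using g_descends_all[of m 2 k] m k by simp
    then show ?thesis using gap by linarith
  qed
  then show ?thesis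
    using g_descends_all[of m k "d - 1"] m k g_top d by simp
qed

text \<open>Serves the case \<open>m = 1\<close>, \<open>D Z = 0\<close>. A nonzero class killed by
  \<open>l\<close> in a lower degree would have nonzero multiples, also killed, up to degree
  \<open>d - 2\<close>. So the kernels vanish and \<open>D_decompose\<close> has a single
  term.\<close>

lemma cokernel_constant:
  assumes d: "d \<ge> 3" and "D (ker_in l (S (d - 2))) = 0" and i: "1 \<le> i" "i < d"
  shows "D (S i) = D (S 1)"
proof -
  have zero: "D (ker_in l (S j)) = 0" if "j \<le> d - 2" for j
    using that
  proof (induction rule: inc_induct)
    case base
    show ?case by (rule assms(2))
  next
    case (step j)
    show ?case
    proof (rule D_eq_0I)
      fix x assume x: "x \<in> ker_in l (S j)"
      show "ev x = 0"
      proof (rule ev_nonzero_step[of j])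
        fix a assume a: "a \<in> S 1"
        have "a * x \<in> ker_in l (S (Suc j))"
          using x S_mult_Suc[OF a, of x j] ev_mult_0[of "l * x" a]
          by (auto simp: ker_in_def mult.left_commute)
        then show "ev (a * x) = 0"
          by (rule D_eq_0D[OF step.IH fin_span_mono[OF fin_S ker_in_subset]])
      qed (use x step.hyps ker_in_subset in auto)
    qed
  qed
  have step: "D (S (Suc j)) = D (S j)" if "1 \<le> j" "Suc j < d" for j
    using D_decompose[OF l, of "Suc j"] D_split_ker[OF subspace_S fin_S, of j l] zero[of j]
      zero[of "d - Suc j"] that by simp
  from i(1) have "i < d \<longrightarrow> D (S i) = D (S 1)"
    by (induction i rule: nat_induct_at_least) (auto simp: step)
  then show ?thesis using i(2) by blast
qed

lemma generic_restriction:
  assumes d: "d \<ge> 4" and m: "m \<ge> 1"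
    and D1: "D (S 1) = Suc m + tau (Suc m) (d - 1)"
    and D2: "D (S 2) \<le> tau (Suc m) 2 + tau (Suc m) (d - 2)"
    and Z: "m = 1 \<Longrightarrow> D Z \<ge> 1"
  shows "D ((*) l ` S 1) = Suc m + tau (Suc m) (d - 2)"
proof -
  note tau_g = tau_le_g[OF assms]
  have splitZ: "D (S 1) = D ((*) l ` S 1) + D Z"
    unfolding Z_def using D_split_ker[OF subspace_S fin_S] .
  have k1: "1 \<le> d - 1" "1 + (d - 1) = d" using d by simp_all
  then obtain b where b: "b \<in> S 1" "D Z \<le> tau (D ((*) (b ^ (d - 1 - 1)) ` Z)) (d - 1)"
    using D_le_tau_rank[OF _ _ Z_subspace Z_subset, of "d - 1"] k1 by blast
  define \<epsilon> where "\<epsilon> = D ((*) (b ^ (d - 2)) ` Z)"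
  have Z\<epsilon>: "D Z \<le> tau \<epsilon> (d - 1)" using b(2) by (simp add: \<epsilon>_def numeral_2_eq_2)
  have "(\<Sum>k=2..d - 1. tau m k) \<le> (\<Sum>k=2..d - 1. g k)"
    using tau_g by (intro sum_mono) auto
  also have "\<dots> = (\<Sum>j<d - 2. D (G j))"
    by (rule sum.reindex_bij_witness[of _ "\<lambda>j. d - 1 - j"
        "\<lambda>k. d - 1 - k"]) (use d in \<open>auto simp: g_def\<close>)
  finally have "(\<Sum>k=2..d - 1. tau m k) + (2 * \<epsilon> + 1) \<le> D (S 1)"
    using sum_G_le[of "d - 2"] isotropic[OF b(1)] d unfolding \<epsilon>_def by linarith
  \<comment> \<open>By \<open>tau_eq_sum\<close>, \<open>D (S 1)\<close> is the same sum plus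
    \<open>2 * Suc m\<close>; parity then leaves \<open>\<epsilon> \<le> m\<close>.\<close>
  then have "2 * \<epsilon> + 1 \<le> 2 * Suc m"
    using D1 tau_eq_sum[of "d - 1" m] d by simp
  then have "\<epsilon> \<le> m" by simp
  then have "D Z \<le> tau m (d - 1)" using Z\<epsilon> tau_mono[of \<epsilon> m "d - 1"] by simp
  moreover have "tau m (d - 1) \<le> D Z" using tau_g[of "d - 1"] g_top d by simp
  moreover have "tau (Suc m) (d - 1) = tau m (d - 1) + tau (Suc m) (d - 2)"
    using tau_Suc_Suc[of m "d - 2"] d by (simp add: Suc_diff_Suc numeral_2_eq_2)
  ultimately show ?thesis using splitZ D1 by simp
qed

end

context standard_graded
begin

theorem hilbert_function_minimal:
  assumes "graded_functional scale S \<Phi> d" "d \<ge> 3" "m \<ge> 1"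
    and "graded_functional.D \<Phi> (S 1) = tau (Suc m) 1 + tau (Suc m) (d - 1)"
    and "\<And>i. 2 \<le> i \<Longrightarrow> i < d \<Longrightarrow> graded_functional.D \<Phi> (S i) \<le> tau (Suc m) i + tau (Suc m) (d - i)"
    and "1 \<le> i" "i < d"
  shows "graded_functional.D \<Phi> (S i) = tau (Suc m) i + tau (Suc m) (d - i)"
  using assms(2,1,4-7)
proof (induction d arbitrary: \<Phi> i rule: nat_induct_at_least)
  \<comment> \<open>For \<open>d = 3\<close> degree 2 is dual to degree 1, where the value is
    given.\<close>
  case base
  interpret graded_functional scale S \<Phi> 3 by fact
  have "i = 1 \<or> i = 2" using base by auto
  then show ?case
    using D_sym[of 1] base(2) by (auto simp: numeral_2_eq_2 add.commute)
next
  case (Suc d)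
  interpret graded_functional scale S \<Phi> "Suc d" by fact
  have D1: "D (S 1) = Suc m + tau (Suc m) (Suc d - 1)" using Suc.prems(2) by simp
  have D2: "D (S 2) \<le> tau (Suc m) 2 + tau (Suc m) (Suc d - 2)"
    using Suc.prems(3)[of 2] Suc.hyps by simp
  obtain l where "l \<in> S 1" "\<And>a. a \<in> S 1 \<Longrightarrow> D ((*) a ` S 1) \<le> D ((*) l ` S 1)" "\<Phi> (l ^ Suc d) \<noteq> 0"
    using general_element D1 by (metis Suc_eq_plus1 add.commute le_add1 trans_le_add1)
  then interpret general_linear_form scale S \<Phi> "Suc d" l by unfold_locales auto
  show ?case
  proof (cases "m = 1 \<and> D Z = 0")
    \<comment> \<open>Since \<open>tau 2 k = Suc k\<close>, the claimed value does not depend on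
      \<open>i\<close>; the Hilbert function has to be constant.\<close>
    case True
    have "D (S 1) = D ((*) l ` S 1) + D Z"
      unfolding Z_def using D_split_ker[OF subspace_S fin_S] .
    moreover have "D (S 2) = D ((*) l ` S 1) + D (ker_in l (S (Suc d - 2)))"
      using D_decompose[OF l, of 2] Suc.hyps by simp
    moreover have "D (S 2) \<le> D (S 1)"
      using D1 D2 True tau_two Suc.hyps by (simp add: numeral_2_eq_2[symmetric])
    ultimately have "D (ker_in l (S (Suc d - 2))) = 0" using True by simp
    then have "D (S i) = D (S 1)"
      using Suc.hyps by (intro cokernel_constant Suc.prems(4,5)) simp_all
    then show ?thesis
      using D1 True tau_two Suc.hyps Suc.prems(4,5) by (simp add: numeral_2_eq_2[symmetric])
  next
    case False
    then have Z1: "m = 1 \<Longrightarrow> D Z \<ge> 1" by simp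
    have d4: "Suc d \<ge> 4" using Suc.hyps by simp
    have lower: "D ((*) l ` S j) + tau m (Suc j) \<le> D (S (Suc j))" if "j < d" for j
      using g_le_cokernel[of "Suc j"] tau_le_g[OF d4 assms(3) D1 D2 Z1, of "Suc j"] that by simp
    have sym: "tau (Suc m) (Suc j) = tau (Suc m) j + tau m (Suc j)" for j
      by (simp add: tau_Suc_Suc)
    have "graded_functional scale S (\<lambda>q. \<Phi> (l * q)) d"
      using graded_functional_mult[OF l] by simp
    note IH = Suc.IH[OF this, unfolded D_mult[OF l, simplified]]
    have IH': "D ((*) l ` S j) = tau (Suc m) j + tau (Suc m) (d - j)" if "1 \<le> j" "j < d" for j
    proof (rule IH[OF _ _ that])
      show "D ((*) l ` S 1) = tau (Suc m) 1 + tau (Suc m) (d - 1)"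
        using generic_restriction[OF d4 assms(3) D1 D2 Z1] by (simp add: numeral_2_eq_2)
      fix j assume j: "2 \<le> j" "j < d"
      then have "D (S (Suc j)) \<le> tau (Suc m) (Suc j) + tau (Suc m) (d - j)"
        using Suc.prems(3)[of "Suc j"] by simp
      then show "D ((*) l ` S j) \<le> tau (Suc m) j + tau (Suc m) (d - j)"
        using lower[OF j(2)] sym[of j] by simp
    qed
    show ?thesis
    proof (cases "i = 1")
      case True
      then show ?thesis using Suc.prems(2) by simp
    next
      case False
      then obtain j where j: "i = Suc j" "1 \<le> j" "j < d"
        using Suc.prems(4,5) by (metis Suc_le_D Suc_less_SucD le_antisym not_less_eq_eq One_nat_def)
      have "D (S i) \<le> tau (Suc m) i + tau (Suc m) (Suc d - i)"
        using Suc.prems(3)[of i] Suc.prems(5) j(1,2) by simp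
      moreover have "tau (Suc m) i + tau (Suc m) (Suc d - i) \<le> D (S i)"
        using lower[OF j(3)] IH'[OF j(2,3)] sym[of j] j(1) by simp
      ultimately show ?thesis by (rule antisym)
    qed
  qed
qed

end

section \<open>Polynomial rings and their Hilbert functions\<close>

definition mscale :: "'k \<Rightarrow> ('v, 'k::field) mpoly \<Rightarrow> ('v, 'k) mpoly" where
  "mscale c p = Const c * p"

lemma Const_add: "Const (a + b) = Const a + Const b"
  by (simp add: Const_def Poly_Mapping.single_add)

lemma Const_mult: "Const (a * b) = Const a * Const b"
  by (simp add: Const_def Poly_Mapping.mult_single)

lemma Const_1 [simp]: "Const 1 = 1"
  by (simp add: Const_def)

lemma Const_0 [simp]: "Const 0 = 0"
  by (simp add: Const_def)

global_interpretation mp: vspace "mscale :: 'k::field \<Rightarrow> ('v, 'k) mpoly \<Rightarrow> _"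
  by standard (simp_all add: mscale_def Const_add Const_mult algebra_simps)

lemma mdeg_superset:
  assumes "finite A" "Poly_Mapping.keys \<alpha> \<subseteq> A"
  shows "mdeg \<alpha> = (\<Sum>v\<in>A. Poly_Mapping.lookup \<alpha> v)"
  unfolding mdeg_def by (rule sum.mono_neutral_left) (use assms in \<open>auto simp: in_keys_iff\<close>)

lemma mdeg_add: "mdeg (\<alpha> + \<beta>) = mdeg \<alpha> + mdeg \<beta>"
proof -
  let ?A = "Poly_Mapping.keys \<alpha> \<union> Poly_Mapping.keys \<beta>"
  have "Poly_Mapping.keys (\<alpha> + \<beta>) \<subseteq> ?A" by (rule Poly_Mapping.keys_add)
  then show ?thesis
    by (simp add: mdeg_superset[of ?A] Poly_Mapping.lookup_add sum.distrib)
qed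

lemma mdeg_0 [simp]: "mdeg 0 = 0"
  by (simp add: mdeg_def)

lemma mdeg_single [simp]: "mdeg (Poly_Mapping.single v k) = k"
  by (simp add: mdeg_def)

lemma mdeg_eq_0_iff: "mdeg \<alpha> = 0 \<longleftrightarrow> \<alpha> = 0"
  by (auto simp: mdeg_def in_keys_iff intro: poly_mapping_eqI)

lemma keys_add_nat: "Poly_Mapping.keys (\<alpha> + \<beta>) = Poly_Mapping.keys \<alpha> \<union> Poly_Mapping.keys
    (\<beta> :: 'v \<Rightarrow>\<^sub>0 nat)"
  by (auto simp: in_keys_iff Poly_Mapping.lookup_add)

lemma mpoly_expand:
  "p = (\<Sum>\<alpha>\<in>Poly_Mapping.keys p. Poly_Mapping.single \<alpha> (Poly_Mapping.lookup p \<alpha>))"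
  by (rule poly_mapping_eqI)
    (simp add: Poly_Mapping.lookup_sum Poly_Mapping.lookup_single when_def in_keys_iff)

lemma homog_polys_iff:
  "p \<in> homog_polys V i \<longleftrightarrow> (\<forall>\<alpha>\<in>Poly_Mapping.keys p. Poly_Mapping.keys \<alpha> \<subseteq> V \<and> mdeg \<alpha> = i)"
  by (auto simp: homog_polys_def poly_ring_def)

lemma homog_polys_single:
  "Poly_Mapping.keys \<alpha> \<subseteq> V \<Longrightarrow> mdeg \<alpha> = i \<Longrightarrow> Poly_Mapping.single \<alpha> c \<in> homog_polys V i"
  by (simp add: homog_polys_iff)

lemma homog_polys_times:
  assumes "p \<in> homog_polys V i" "q \<in> homog_polys V j"
  shows "p * q \<in> homog_polys V (i + j)"
  unfolding homog_polys_iff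
proof
  fix \<gamma> assume "\<gamma> \<in> Poly_Mapping.keys (p * q)"
  then obtain \<alpha> \<beta> where "\<alpha> \<in> Poly_Mapping.keys p" "\<beta> \<in> Poly_Mapping.keys q" "\<gamma> = \<alpha> + \<beta>"
    using Poly_Mapping.keys_mult[of p q] by blast
  then show "Poly_Mapping.keys \<gamma> \<subseteq> V \<and> mdeg \<gamma> = i + j"
    using assms by (auto simp: homog_polys_iff mdeg_add keys_add_nat)
qed

lemma subspace_homog_polys: "mp.subspace (homog_polys V i :: ('v, 'k::field) mpoly set)"
proof (rule mp.subspaceI)
  show "0 \<in> homog_polys V i" by (simp add: homog_polys_iff)
  show "x + y \<in> homog_polys V i" if "x \<in> homog_polys V i" "y \<in> homog_polys V i"
    for x y :: "('v, 'k) mpoly"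
    using that Poly_Mapping.keys_add[of x y] by (auto simp: homog_polys_iff)
  have "(Const c :: ('v, 'k) mpoly) \<in> homog_polys V 0" for c
    by (simp add: Const_def homog_polys_single)
  then show "mscale c x \<in> homog_polys V i" if "x \<in> homog_polys V i" for c and x :: "('v, 'k) mpoly"
    using homog_polys_times[of "Const c" V 0 x i] that by (simp add: mscale_def)
qed

lemma mscale_single: "mscale c (Poly_Mapping.single \<alpha> a) = Poly_Mapping.single \<alpha> (c * a)"
  by (simp add: mscale_def Const_def Poly_Mapping.mult_single)

lemma monomial_split:
  assumes "mdeg \<alpha> = Suc i" "Poly_Mapping.keys \<alpha> \<subseteq> V"
  obtains v \<beta> where "v \<in> V" "\<alpha> = Poly_Mapping.single v 1 + \<beta>" "mdeg \<beta> = i" "Poly_Mapping.keys \<beta> \<subseteq> V"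
proof -
  have "\<alpha> \<noteq> 0" using assms(1) by auto
  then obtain v where v: "v \<in> Poly_Mapping.keys \<alpha>"
    by (metis ex_in_conv poly_mapping_eqI lookup_zero in_keys_iff)
  let ?\<beta> = "\<alpha> - Poly_Mapping.single v 1"
  have eq: "\<alpha> = Poly_Mapping.single v 1 + ?\<beta>"
    using v by (intro poly_mapping_eqI)
      (auto simp: Poly_Mapping.lookup_add Poly_Mapping.lookup_minus Poly_Mapping.lookup_single
          when_def in_keys_iff)
  then have "mdeg \<alpha> = 1 + mdeg ?\<beta>" "Poly_Mapping.keys ?\<beta> \<subseteq> Poly_Mapping.keys \<alpha>"
    by (metis mdeg_add mdeg_single, metis keys_add_nat Un_upper2)
  then show thesis using that[OF _ eq] v assms by auto
qed

lemma homog_polys_1_span: "homog_polys V 1 \<subseteq> mp.span (Var ` V :: ('a, 'k::field) mpoly set)"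
proof
  fix p :: "('a, 'k) mpoly" assume p: "p \<in> homog_polys V 1"
  have "Poly_Mapping.single \<alpha> (Poly_Mapping.lookup p \<alpha>) \<in> mp.span (Var ` V)"
    if "\<alpha> \<in> Poly_Mapping.keys p" for \<alpha>
  proof -
    have "mdeg \<alpha> = Suc 0" "Poly_Mapping.keys \<alpha> \<subseteq> V" using p that by (auto simp: homog_polys_iff)
    then obtain v \<beta> where v: "v \<in> V" "\<alpha> = Poly_Mapping.single v 1 + \<beta>" "mdeg \<beta> = 0"
      by (rule monomial_split)
    then have "Poly_Mapping.single \<alpha> (Poly_Mapping.lookup p \<alpha>) = mscale (Poly_Mapping.lookup p \<alpha>)
        (Var v)"
      by (simp add: mscale_single Var_def mdeg_eq_0_iff)
    then show ?thesis using v(1) mp.span_scale[OF mp.span_base[of "Var v" "Var ` V"]] by simp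
  qed
  then show "p \<in> mp.span (Var ` V)"
    by (subst mpoly_expand[of p]) (rule mp.span_sum)
qed

lemma standard_graded_homog_polys:
  assumes "finite V"
  shows "standard_graded (mscale :: 'k::field_char_0 \<Rightarrow> _) (homog_polys V)"
proof (unfold_locales)
  show "mscale c x * y = mscale c (x * y)" for c and x y :: "('a, 'k) mpoly"
    by (simp add: mscale_def mult.assoc)
  show "homog_polys V 0 = mp.span {1 :: ('a, 'k) mpoly}"
  proof
    show "homog_polys V 0 \<subseteq> mp.span {1 :: ('a, 'k) mpoly}"
    proof
      fix p :: "('a, 'k) mpoly" assume "p \<in> homog_polys V 0"
      then have "Poly_Mapping.keys p \<subseteq> {0}" by (auto simp: homog_polys_iff mdeg_eq_0_iff)
      then have "p = mscale (Poly_Mapping.lookup p 0) 1"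
        by (intro poly_mapping_eqI)
          (auto simp: mscale_def Const_def Poly_Mapping.lookup_single when_def in_keys_iff)
      then show "p \<in> mp.span {1}" by (metis mp.span_base mp.span_scale singletonI)
    qed
    show "mp.span {1 :: ('a, 'k) mpoly} \<subseteq> homog_polys V 0"
      by (rule mp.span_minimal[OF _ subspace_homog_polys]) (simp add: homog_polys_iff)
  qed
  show "homog_polys V (Suc i) =
      mp.span {a * s :: ('a, 'k) mpoly | a s. a \<in> homog_polys V 1 \<and> s \<in> homog_polys V i}"
    (is "_ = mp.span ?P") for i
  proof
    show "homog_polys V (Suc i) \<subseteq> mp.span ?P"
    proof
      fix p :: "('a, 'k) mpoly" assume p: "p \<in> homog_polys V (Suc i)"
      have "Poly_Mapping.single \<alpha> (Poly_Mapping.lookup p \<alpha>) \<in> mp.span ?P"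
        if "\<alpha> \<in> Poly_Mapping.keys p" for \<alpha>
      proof -
        have "mdeg \<alpha> = Suc i" "Poly_Mapping.keys \<alpha> \<subseteq> V" using p that by (auto simp: homog_polys_iff)
        then obtain v \<beta> where v: "v \<in> V" "\<alpha> = Poly_Mapping.single v 1 + \<beta>" "mdeg \<beta> = i"
          "Poly_Mapping.keys \<beta> \<subseteq> V" by (rule monomial_split)
        have "Poly_Mapping.single (Poly_Mapping.single v 1) 1 *
            Poly_Mapping.single \<beta> (Poly_Mapping.lookup p \<alpha>) \<in> ?P"
          using v by (intro CollectI exI conjI) (auto intro!: homog_polys_single)
        then show ?thesis
          by (intro mp.span_base) (simp only: Poly_Mapping.mult_single v(2)[symmetric] mult_1)
      qed
      then show "p \<in> mp.span ?P"
        by (subst mpoly_expand[of p]) (rule mp.span_sum)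
    qed
    have "?P \<subseteq> homog_polys V (Suc i)"
      using homog_polys_times[of _ V 1 _ i] by auto
    then show "mp.span ?P \<subseteq> homog_polys V (Suc i)"
      by (rule mp.span_minimal[OF _ subspace_homog_polys])
  qed
  show "mp.fin_span (homog_polys V 1 :: ('a, 'k) mpoly set)"
    unfolding mp.fin_span_def
  proof (intro exI conjI subsetI)
    show "finite (Var ` V :: ('a, 'k) mpoly set)" using assms by simp
    show "p \<in> mp.span (Var ` V)" if "p \<in> homog_polys V 1" for p :: "('a, 'k) mpoly"
      using homog_polys_1_span that by blast
  qed
qed

section \<open>Dimensions over the embedded field of constants\<close>

lemma subfield_range_Const: "subfield (range Const) (poly_ring V :: ('v, 'k::field) mpoly ring)"
proof -
  interpret R: cring "poly_ring V :: ('v, 'k) mpoly ring" by (rule cring_poly_ring)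
  have C: "range Const \<subseteq> carrier (poly_ring V :: ('v, 'k) mpoly ring)"
    by (auto simp: poly_ring_def Const_def split: if_splits)
  have "cring ((poly_ring V)\<lparr>carrier := range Const\<rparr> :: ('v, 'k) mpoly ring)"
  proof (rule cringI)
    show "abelian_group ((poly_ring V)\<lparr>carrier := range Const\<rparr> :: ('v, 'k) mpoly ring)"
    proof (rule abelian_groupI)
      fix p :: "('v, 'k) mpoly"
      assume "p \<in> carrier ((poly_ring V)\<lparr>carrier := range Const\<rparr>)"
      then obtain a where a: "p = Const a" by auto
      then show "\<exists>q\<in>carrier ((poly_ring V)\<lparr>carrier := range Const\<rparr>).
          q \<oplus>\<^bsub>(poly_ring V)\<lparr>carrier := range Const\<rparr>\<^esub> p = \<zero>\<^bsub>(poly_ring V)\<lparr>carrier := range Const\<rparr>\<^esub>"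
        by (intro bexI[of _ "Const (- a)"]) (simp_all add: poly_ring_def Const_add[symmetric])
    qed (auto simp: poly_ring_def Const_add[symmetric] algebra_simps intro: range_eqI[of _ _ 0])
    show "comm_monoid ((poly_ring V)\<lparr>carrier := range Const\<rparr> :: ('v, 'k) mpoly ring)"
      by (rule comm_monoidI)
        (auto simp: poly_ring_def Const_mult[symmetric] algebra_simps intro: range_eqI[of _ _ 1])
  qed (auto simp: poly_ring_def algebra_simps)
  then have "Ring.field ((poly_ring V)\<lparr>carrier := range Const\<rparr> :: ('v, 'k) mpoly ring)"
  proof (rule cring.cring_fieldI2)
    fix p :: "('v, 'k) mpoly"
    assume "p \<in> carrier ((poly_ring V)\<lparr>carrier := range Const\<rparr>)"
      "p \<noteq> \<zero>\<^bsub>(poly_ring V)\<lparr>carrier := range Const\<rparr>\<^esub>"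
    then obtain a where a: "p = Const a" "p \<noteq> 0" by (auto simp: poly_ring_def)
    then have "a \<noteq> 0" by auto
    note a = a(1) this
    then show "\<exists>q\<in>carrier ((poly_ring V)\<lparr>carrier := range Const\<rparr>).
        p \<otimes>\<^bsub>(poly_ring V)\<lparr>carrier := range Const\<rparr>\<^esub> q = \<one>\<^bsub>(poly_ring V)\<lparr>carrier := range Const\<rparr>\<^esub>"
      by (intro bexI[of _ "Const (inverse a)"]) (simp_all add: poly_ring_def Const_mult[symmetric])
  qed (simp add: poly_ring_def)
  then show ?thesis using R.subfield_iff(1) C by blast
qed

text \<open>On the piece of degree \<open>i\<close> the coset map and \<open>f\<close> have the same
  fibres. A list mapped by \<open>f\<close> to a basis of the image therefore gives independent
  cosets that span the piece.\<close>

lemma hilbert_fun_eq_dim: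
  fixes f :: "('v, 'k::field_char_0) mpoly \<Rightarrow> 'i \<Rightarrow> 'k"
  assumes V: "finite V" and I: "ideal I (poly_ring V)" and one: "1 \<notin> I"
    and lin: "Vector_Spaces.linear mscale fscale f"
    and ker: "\<And>s. s \<in> homog_polys V i \<Longrightarrow> s \<in> I \<longleftrightarrow> f s = 0"
  shows "hilbert_fun V I i = fn.dim (f ` homog_polys V i)"
proof -
  interpret A: standard_graded "mscale :: 'k \<Rightarrow> ('v, 'k) mpoly \<Rightarrow> _" "homog_polys V"
      by (rule standard_graded_homog_polys[OF V])
  interpret f: Vector_Spaces.linear mscale fscale f by fact
  let ?R = "poly_ring V :: ('v, 'k) mpoly ring" and ?S = "homog_polys V i :: ('v, 'k) mpoly set"
  define h where "h = (+>\<^bsub>?R\<^esub>) I"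
  define Q where "Q = ?R Quot I"
  interpret R: cring ?R by (rule cring_poly_ring)
  interpret h: ring_hom_ring ?R Q h
    unfolding h_def Q_def by (rule ideal.rcos_ring_hom_ring[OF I])
  have S_carrier: "?S \<subseteq> carrier ?R" by (auto simp: homog_polys_def)
  have h_eq: "h x = h y \<longleftrightarrow> x - y \<in> I" if "x \<in> carrier ?R" "y \<in> carrier ?R" for x y
  proof -
    have "x \<ominus>\<^bsub>?R\<^esub> y = x - y"
    proof -
      have my: "- y \<in> carrier ?R" using that by (simp add: poly_ring_def)
      have "y \<oplus>\<^bsub>?R\<^esub> (- y) = \<zero>\<^bsub>?R\<^esub>" by (simp add: poly_ring_def)
      then have "\<ominus>\<^bsub>?R\<^esub> y = - y" using that my by (metis R.minus_equality R.a_comm)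
      then show ?thesis by (simp add: a_minus_def) (simp add: poly_ring_def)
    qed
    then show ?thesis
      using R.quotient_eq_iff_same_a_r_cos[OF I that] by (simp add: h_def)
  qed
  have h_eq_S: "h x = h y \<longleftrightarrow> f x = f y" if "x \<in> ?S" "y \<in> ?S" for x y
    using h_eq[of x y] ker[OF mp.subspace_diff[OF A.subspace_S that]] that S_carrier
    by (auto simp: f.diff)
  define K where "K = h ` range Const"
  have "\<one>\<^bsub>Q\<^esub> \<noteq> \<zero>\<^bsub>Q\<^esub>"
  proof
    assume "\<one>\<^bsub>Q\<^esub> = \<zero>\<^bsub>Q\<^esub>"
    then have "h 1 = h 0" using h.hom_one h.hom_zero by (simp add: poly_ring_def)
    then show False using h_eq[of 1 0] one by (simp add: poly_ring_def)
  qed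
  then have K: "subfield K Q"
    unfolding K_def using h.img_is_subfield(2)[OF subfield_range_Const] by blast
  have span: "set us \<subseteq> ?S \<Longrightarrow> h.S.Span K (map h us) = h ` mp.span (set us)" for us
  proof (induction us)
    case Nil
    then show ?case using h.hom_zero by (simp add: poly_ring_def)
  next
    case (Cons u us)
    have sub: "mp.span (set us) \<subseteq> carrier ?R" "mp.span (set (u # us)) \<subseteq> carrier ?R" "u \<in> carrier ?R"
      using Cons.prems S_carrier mp.span_minimal[OF _ A.subspace_S, of "set us" i]
        mp.span_minimal[OF _ A.subspace_S, of "set (u # us)" i] by auto
    have CR: "Const c \<in> carrier ?R" for c by (auto simp: poly_ring_def Const_def split: if_splits)
    have lin_h: "h (Const c * u + w) = h (Const c) \<otimes>\<^bsub>Q\<^esub> h u \<oplus>\<^bsub>Q\<^esub> h w" if "w \<in> mp.span (set us)"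
        for c w
    proof -
      have "h (Const c \<otimes>\<^bsub>?R\<^esub> u \<oplus>\<^bsub>?R\<^esub> w) = h (Const c) \<otimes>\<^bsub>Q\<^esub> h u \<oplus>\<^bsub>Q\<^esub> h w"
        using CR sub that by (simp add: subset_iff)
      then show ?thesis by (simp add: poly_ring_def)
    qed
    have "h.S.Span K (map h (u # us)) = h.S.line_extension K (h u) (h ` mp.span (set us))"
      using Cons by simp
    also have "\<dots> = h ` mp.span (set (u # us))"
    proof
      show "h.S.line_extension K (h u) (h ` mp.span (set us)) \<subseteq> h ` mp.span (set (u # us))"
      proof
        fix x assume "x \<in> h.S.line_extension K (h u) (h ` mp.span (set us))"
        then obtain c w where cw: "w \<in> mp.span (set us)" "x = h (Const c) \<otimes>\<^bsub>Q\<^esub> h u \<oplus>\<^bsub>Q\<^esub> h w"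
          unfolding h.S.line_extension_mem_iff K_def by auto
        have "mscale c u + w \<in> mp.span (set (u # us))"
          using mp.span_base[of u "set (u # us)"] mp.span_mono[of "set us" "set (u # us)"] cw(1)
          by (intro mp.span_add mp.span_scale) auto
        then show "x \<in> h ` mp.span (set (u # us))"
          using lin_h[OF cw(1)] cw(2) by (auto simp: mscale_def)
      qed
      show "h ` mp.span (set (u # us)) \<subseteq> h.S.line_extension K (h u) (h ` mp.span (set us))"
      proof
        fix x assume "x \<in> h ` mp.span (set (u # us))"
        then obtain y where y: "y \<in> mp.span (insert u (set us))" "x = h y" by auto
        then obtain c where c: "y - mscale c u \<in> mp.span (set us)" unfolding mp.span_insert by blast
        have "x = h (Const c) \<otimes>\<^bsub>Q\<^esub> h u \<oplus>\<^bsub>Q\<^esub> h (y - mscale c u)"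
          using lin_h[OF c, of c] y(2) by (simp add: mscale_def)
        then show "x \<in> h.S.line_extension K (h u) (h ` mp.span (set us))"
          unfolding h.S.line_extension_mem_iff K_def using c by blast
      qed
    qed
    finally show ?case .
  qed
  have indep: "set us \<subseteq> ?S \<Longrightarrow> distinct (map f us) \<Longrightarrow> fn.independent (f ` set us) \<Longrightarrow>
      h.S.independent K (map h us)" for us
  proof (induction us)
    case (Cons u us)
    have notin: "f u \<notin> f ` set us" using Cons.prems(2) by auto
    then have ind: "fn.independent (f ` set us)" "f u \<notin> fn.span (f ` set us)"
      using Cons.prems(3) fn.independent_insert[of "f u" "f ` set us"] by auto
    have "h u \<notin> h.S.Span K (map h us)"
    proof
      assume "h u \<in> h.S.Span K (map h us)"
      then obtain w where w: "w \<in> mp.span (set us)" "h u = h w"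
        using span[of us] Cons.prems(1) by auto
      have "w \<in> ?S" using w(1) mp.span_minimal[OF _ A.subspace_S, of "set us" i] Cons.prems(1)
          by auto
      then have "f u = f w" using h_eq_S w(2) Cons.prems(1) by simp
      then show False using ind(2) w(1) f.span_image by blast
    qed
    moreover have "h u \<in> carrier Q" using Cons.prems(1) S_carrier by auto
    ultimately show ?case
      using Cons ind(1) by (auto intro: h.S.independent.intros)
  qed simp
  obtain B where B: "finite B" "B \<subseteq> f ` ?S" "fn.independent B" "f ` ?S \<subseteq> fn.span B"
      "card B = fn.dim (f ` ?S)"
    using fn.fin_span_basis[OF mp.fnp.fin_span_image[OF lin A.fin_S]] by blast
  obtain bs where bs: "set bs = B" "distinct bs" using finite_distinct_list[OF B(1)] by blast
  have "\<forall>b\<in>B. \<exists>s\<in>?S. f s = b" using B(2) by blast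
  then obtain r where r: "\<And>b. b \<in> B \<Longrightarrow> r b \<in> ?S" "\<And>b. b \<in> B \<Longrightarrow> f (r b) = b" by metis
  let ?us = "map r bs"
  have us: "set ?us \<subseteq> ?S" "map f ?us = bs"
    using r bs(1) by (auto intro: map_idI)
  have fus: "f ` set ?us = B" using us(2) bs(1) by (metis set_map)
  have "h.S.dimension (length ?us) K (h.S.Span K (map h ?us))"
    using h.S.dimension_independent[OF indep[OF us(1)]] us(2) bs(2) B(3) fus by simp
  moreover have "h.S.Span K (map h ?us) = h ` ?S"
    unfolding span[OF us(1)]
  proof
    have sp: "mp.span (set ?us) \<subseteq> ?S" by (rule mp.span_minimal[OF us(1) A.subspace_S])
    then show "h ` mp.span (set ?us) \<subseteq> h ` ?S" by blast
    show "h ` ?S \<subseteq> h ` mp.span (set ?us)"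
    proof
      fix x assume "x \<in> h ` ?S"
      then obtain s where s: "s \<in> ?S" "x = h s" by blast
      have "f s \<in> f ` mp.span (set ?us)"
        using B(4) s(1) unfolding fus[symmetric] f.span_image by blast
      then obtain w where w: "w \<in> mp.span (set ?us)" "f s = f w" by blast
      then show "x \<in> h ` mp.span (set ?us)" using h_eq_S s sp by blast
    qed
  qed
  ultimately have "h.S.dimension (card B) K (h ` ?S)"
    using distinct_card[OF bs(2)] bs(1) by simp
  then have "h.S.dim K (h ` ?S) = card B"
    using h.S.dimI[OF K] by (simp add: over_def)
  moreover have "scalars V I = K" "piece V I i = h ` ?S" "graded_alg V I = Q"
    by (auto simp: scalars_def K_def piece_def h_def graded_alg_def Q_def image_image)
  ultimately show ?thesis using B(5) by (simp add: hilbert_fun_def)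
qed

text \<open>
  The values \<open>c\<close> on monomials play the role of Macaulay's inverse system.
\<close>

definition coeff_functional :: "(('v \<Rightarrow>\<^sub>0 nat) \<Rightarrow> 'k) \<Rightarrow> ('v, 'k::field) mpoly \<Rightarrow> 'k" where
  "coeff_functional c p = (\<Sum>\<alpha>\<in>Poly_Mapping.keys p. Poly_Mapping.lookup p \<alpha> * c \<alpha>)"

lemma coeff_functional_superset:
  assumes "finite A" "Poly_Mapping.keys p \<subseteq> A"
  shows "coeff_functional c p = (\<Sum>\<alpha>\<in>A. Poly_Mapping.lookup p \<alpha> * c \<alpha>)"
  unfolding coeff_functional_def
  by (rule sum.mono_neutral_left) (use assms in \<open>auto simp: in_keys_iff\<close>)

lemma coeff_functional_add: "coeff_functional c (p + q) = coeff_functional c p + coeff_functional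
    c q"
proof -
  let ?A = "Poly_Mapping.keys p \<union> Poly_Mapping.keys q"
  have "Poly_Mapping.keys (p + q) \<subseteq> ?A" by (rule Poly_Mapping.keys_add)
  then show ?thesis
    by (simp add: coeff_functional_superset[of ?A] Poly_Mapping.lookup_add distrib_right
        sum.distrib)
qed

lemma coeff_functional_0 [simp]: "coeff_functional c 0 = 0"
  by (simp add: coeff_functional_def)

lemma coeff_functional_sum: "coeff_functional c (\<Sum>x\<in>A. f x) = (\<Sum>x\<in>A. coeff_functional c (f x))"
  by (induction A rule: infinite_finite_induct) (simp_all add: coeff_functional_add)

lemma coeff_functional_single [simp]: "coeff_functional c (Poly_Mapping.single \<alpha> a) = a * c \<alpha>"
  by (simp add: coeff_functional_def)

lemma lookup_mscale: "Poly_Mapping.lookup (mscale a p) \<alpha> = a * Poly_Mapping.lookup p \<alpha>"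
proof -
  have "mscale a p = (\<Sum>\<alpha>\<in>Poly_Mapping.keys p. Poly_Mapping.single \<alpha> (a * Poly_Mapping.lookup p \<alpha>))"
    by (subst mpoly_expand[of p]) (simp add: mp.scale_sum_right mscale_single)
  then show ?thesis
    by (simp add: Poly_Mapping.lookup_sum Poly_Mapping.lookup_single when_def in_keys_iff)
qed

lemma coeff_functional_mscale: "coeff_functional c (mscale a p) = a * coeff_functional c p"
proof -
  have "Poly_Mapping.keys (mscale a p) \<subseteq> Poly_Mapping.keys p"
    by (auto simp: in_keys_iff lookup_mscale)
  then show ?thesis
    by (simp add: coeff_functional_superset[of
        "Poly_Mapping.keys p"] lookup_mscale sum_distrib_left mult.assoc)
qed

lemma coeff_functional_times_single:
  "coeff_functional c (p * Poly_Mapping.single \<beta> a) =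
     (\<Sum>\<alpha>\<in>Poly_Mapping.keys p. Poly_Mapping.lookup p \<alpha> * a * c (\<alpha> + \<beta>))"
proof -
  have "p * Poly_Mapping.single \<beta> a =
      (\<Sum>\<alpha>\<in>Poly_Mapping.keys p. Poly_Mapping.single (\<alpha> + \<beta>) (Poly_Mapping.lookup p \<alpha> * a))"
    using arg_cong[OF mpoly_expand[of p], of "\<lambda>x. x * Poly_Mapping.single \<beta> a"]
    by (simp only: sum_distrib_right Poly_Mapping.mult_single)
  then show ?thesis by (simp add: coeff_functional_sum)
qed

lemma coeff_functional_expand:
  "coeff_functional c (p * q) =
     (\<Sum>\<beta>\<in>Poly_Mapping.keys q. coeff_functional c (p * Poly_Mapping.single \<beta>
         (Poly_Mapping.lookup q \<beta>)))"
proof -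
  have "p * q = (\<Sum>\<beta>\<in>Poly_Mapping.keys q. p * Poly_Mapping.single \<beta> (Poly_Mapping.lookup q \<beta>))"
    using arg_cong[OF mpoly_expand[of q], of "(*) p"] by (simp only: sum_distrib_left)
  then show ?thesis by (simp only: coeff_functional_sum)
qed

lemma coeff_functional_vanish_iff:
  "(\<forall>q. coeff_functional c (p * q) = 0) \<longleftrightarrow>
     (\<forall>\<beta>. (\<Sum>\<alpha>\<in>Poly_Mapping.keys p. Poly_Mapping.lookup p \<alpha> * c (\<alpha> + \<beta>)) = 0)"
proof
  assume "\<forall>q. coeff_functional c (p * q) = 0"
  then show "\<forall>\<beta>. (\<Sum>\<alpha>\<in>Poly_Mapping.keys p. Poly_Mapping.lookup p \<alpha> * c (\<alpha> + \<beta>)) = 0"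
    using coeff_functional_times_single[of c p _ 1] by simp
next
  assume *: "\<forall>\<beta>. (\<Sum>\<alpha>\<in>Poly_Mapping.keys p. Poly_Mapping.lookup p \<alpha> * c (\<alpha> + \<beta>)) = 0"
  have "coeff_functional c (p * Poly_Mapping.single \<beta> a) =
      a * (\<Sum>\<alpha>\<in>Poly_Mapping.keys p. Poly_Mapping.lookup p \<alpha> * c (\<alpha> + \<beta>))" for \<beta> a
    by (simp add: coeff_functional_times_single sum_distrib_left mult_ac)
  then have "coeff_functional c (p * Poly_Mapping.single \<beta> a) = 0" for \<beta> a
    using * by simp
  then show "\<forall>q. coeff_functional c (p * q) = 0"
    by (subst coeff_functional_expand) simp
qed

text \<open>Test polynomials range over the whole type, with any degree and with variables outside
  \<open>V\<close>. Their unsuitable monomials \<open>\<beta>\<close> contribute nothing, as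
  \<open>c\<close> vanishes at \<open>\<alpha> + \<beta>\<close>.\<close>

lemma graded_functional_coeff:
  fixes c :: "('v \<Rightarrow>\<^sub>0 nat) \<Rightarrow> 'k::field_char_0"
  assumes V: "finite V" and c: "\<And>\<alpha>. c \<alpha> \<noteq> 0 \<Longrightarrow> Poly_Mapping.keys \<alpha> \<subseteq> V \<and> mdeg \<alpha> = d"
  shows "graded_functional mscale (homog_polys V) (coeff_functional c) d"
proof -
  interpret standard_graded "mscale :: 'k \<Rightarrow> ('v, 'k) mpoly \<Rightarrow> _" "homog_polys V"
      by (rule standard_graded_homog_polys[OF V])
  show ?thesis
  proof unfold_locales
    fix i and s q :: "('v, 'k) mpoly"
    assume i: "i \<le> d" and s: "s \<in> homog_polys V i"
      and z: "\<And>q. q \<in> homog_polys V (d - i) \<Longrightarrow> coeff_functional c (s * q) = 0"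
    have "coeff_functional c (s * Poly_Mapping.single \<beta> a) = 0" for \<beta> a
    proof (cases "Poly_Mapping.keys \<beta> \<subseteq> V \<and> mdeg \<beta> = d - i")
      case True
      then show ?thesis using z homog_polys_single by blast
    next
      case False
      have "c (\<alpha> + \<beta>) = 0" if "\<alpha> \<in> Poly_Mapping.keys s" for \<alpha>
      proof (rule ccontr)
        assume "c (\<alpha> + \<beta>) \<noteq> 0"
        then have "Poly_Mapping.keys (\<alpha> + \<beta>) \<subseteq> V" "mdeg (\<alpha> + \<beta>) = d" using c by auto
        moreover have "mdeg \<alpha> = i" using s that by (auto simp: homog_polys_iff)
        ultimately show False using False by (auto simp: keys_add_nat mdeg_add)
      qed
      then show ?thesis by (simp add: coeff_functional_times_single)
    qed
    then show "coeff_functional c (s * q) = 0" by (subst coeff_functional_expand) simp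
  qed (simp_all add: coeff_functional_add coeff_functional_mscale)
qed

lemma ideal_mpoly_subspace:
  assumes "ideal I (poly_ring V :: ('v, 'k::field) mpoly ring)"
  shows "mp.subspace I" and "I \<subseteq> carrier (poly_ring V)"
    and "\<And>p q. p \<in> I \<Longrightarrow> q \<in> carrier (poly_ring V) \<Longrightarrow> p * q \<in> I"
proof -
  interpret ideal I "poly_ring V :: ('v, 'k) mpoly ring" by fact
  show "I \<subseteq> carrier (poly_ring V)" by (rule a_subset)
  show mult: "p * q \<in> I" if "p \<in> I" "q \<in> carrier (poly_ring V)" for p q
    using I_r_closed[OF that] by (simp add: poly_ring_def)
  show "mp.subspace I"
  proof (rule mp.subspaceI)
    show "0 \<in> I"
      using additive_subgroup.zero_closed[OF is_additive_subgroup] by (simp add: poly_ring_def)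
    show "x + y \<in> I" if "x \<in> I" "y \<in> I" for x y
      using additive_subgroup.a_closed[OF is_additive_subgroup that] by (simp add: poly_ring_def)
    have "Const a \<in> carrier (poly_ring V :: ('v, 'k) mpoly ring)" for a
      by (auto simp: poly_ring_def Const_def split: if_splits)
    then show "mscale a x \<in> I" if "x \<in> I" for a x
      using mult[OF that, of "Const a"] by (simp add: mscale_def mult.commute)
  qed
qed

text \<open>Coordinates in a basis that extends one of \<open>W\<close>, with those along
  \<open>W\<close> set to zero. This turns the quotient by an ideal into a space of
  functions.\<close>

lemma (in vspace) exists_linear_with_kernel:
  assumes "subspace W"
  obtains f :: "'b \<Rightarrow> 'b \<Rightarrow> 'a" where "Vector_Spaces.linear scale fscale f" "\<And>x. f x = 0 \<longleftrightarrow> x \<in> W"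
proof -
  obtain A where A: "A \<subseteq> W" "independent A" "W \<subseteq> span A"
    using maximal_independent_subset by blast
  let ?B = "extend_basis A"
  have B: "independent ?B" "span ?B = UNIV" "A \<subseteq> ?B"
    using independent_extend_basis[OF A(2)] span_extend_basis[OF A(2)] extend_basis_superset[OF
        A(2)]
    by blast+
  have WA: "W = span A" using A assms span_minimal by blast
  define f where "f x b = (if b \<in> A then 0 else representation ?B x b)" for x b
  have "Vector_Spaces.linear scale fscale f"
    using B by (intro linear_fnI) (auto simp: f_def representation_add representation_scale)
  moreover have "f x = 0 \<longleftrightarrow> x \<in> W" for x
  proof
    assume "x \<in> W"
    then have "representation ?B x = representation A x"
      using representation_extend[OF B(1) _ B(3)] WA by blast
    then show "f x = 0"
      using representation_ne_zero by (fastforce simp: f_def fun_eq_iff)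
  next
    assume f: "f x = 0"
    have "b \<in> A" if "representation ?B x b \<noteq> 0" for b
      using fun_cong[OF f, of b] that by (auto simp: f_def split: if_splits)
    then have "(\<Sum>b | representation ?B x b \<noteq> 0. scale (representation ?B x b) b) \<in> span A"
      by (intro span_sum span_scale span_base) auto
    then show "x \<in> W"
      using sum_nonzero_representation_eq[OF B(1)] B(2) WA by simp
  qed
  ultimately show thesis using that by blast
qed

lemma single_1_eq_iff: "Poly_Mapping.single v (1 :: 'b::zero_neq_one) = Poly_Mapping.single w 1
    \<longleftrightarrow> v = w"
proof
  assume "Poly_Mapping.single v (1 :: 'b) = Poly_Mapping.single w 1"
  then have "Poly_Mapping.keys (Poly_Mapping.single v (1 :: 'b)) = Poly_Mapping.keys
      (Poly_Mapping.single w (1 :: 'b))"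
    by (rule arg_cong)
  then show "v = w" by simp
qed simp

lemma dim_homog_polys_1:
  assumes V: "finite V"
  shows "mp.dim (homog_polys V 1 :: ('v, 'k::field) mpoly set) = card V"
proof -
  let ?B = "Var ` V :: ('v, 'k) mpoly set"
  have inj: "inj_on (Var :: 'v \<Rightarrow> ('v, 'k) mpoly) V"
    by (rule inj_onI) (simp only: Var_def single_1_eq_iff)
  have "mp.dim (homog_polys V 1 :: ('v, 'k) mpoly set) = card ?B"
  proof (rule mp.basis_card_eq_dim[symmetric])
    show "?B \<subseteq> homog_polys V 1"
      by (auto simp: Var_def intro!: homog_polys_single)
    show "homog_polys V 1 \<subseteq> mp.span ?B" by (rule homog_polys_1_span)
    show "mp.independent ?B"
    proof (rule mp.independent_if_scalars_zero)
      fix u x assume u: "(\<Sum>x\<in>?B. mscale (u x) x) = 0" and x: "x \<in> ?B"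
      then obtain v where v: "v \<in> V" "x = Var v" by blast
      have "0 = Poly_Mapping.lookup (\<Sum>w\<in>V. mscale (u (Var w)) (Var w)) (Poly_Mapping.single v 1)"
        using u inj by (simp add: sum.reindex)
      also have "\<dots> = (\<Sum>w\<in>V. if w = v then u (Var w) else 0)"
        unfolding Poly_Mapping.lookup_sum lookup_mscale Var_def
        by (intro sum.cong refl) (simp add: Poly_Mapping.lookup_single when_def single_1_eq_iff
            del: One_nat_def)
      also have "\<dots> = u x" using V v by simp
      finally show "u x = 0" by simp
    qed (use V in simp)
  qed
  also have "\<dots> = card V" using inj by (rule card_image)
  finally show ?thesis .
qed

text \<open>\<open>\<Phi>\<close> is a coordinate on the one-dimensional top piece, extended by zero
  to the other monomials. That \<open>ev s = 0\<close> implies \<open>s \<in> I\<close> is the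
  injectivity in the perfect pairing. For \<open>d = 0\<close> degree 1 is beyond the range of the
  pairing, hence the alternative.\<close>

lemma gorenstein_functional:
  fixes I :: "('v, 'k::field_char_0) mpoly set"
  assumes AG: "standard_AG V I d"
  obtains \<Phi> :: "('v, 'k) mpoly \<Rightarrow> 'k" where "graded_functional mscale (homog_polys V) \<Phi> d"
    "\<And>i. i \<le> d \<Longrightarrow> hilbert_fun V I i = graded_functional.D \<Phi> (homog_polys V i)"
    "graded_functional.D \<Phi> (homog_polys V 1) = card V \<or> d = 0"
proof -
  have V: "finite V" and I: "ideal I (poly_ring V)" and I1: "I \<inter> homog_polys V 1 = {0}"
    and soc: "piece V I d \<noteq> {\<zero>\<^bsub>graded_alg V I\<^esub>}" and h1: "hilbert_fun V I d = 1"
    and pp: "\<And>i. i \<le> d \<Longrightarrow> perfect_pairing (graded_alg V I) (scalars V I)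
                (piece V I i) (piece V I (d - i)) (piece V I d)"
    using AG by (auto simp: standard_AG_def homogeneous_ideal_def artinian_socle_degree_def)
  let ?R = "poly_ring V :: ('v, 'k) mpoly ring"
  interpret A: standard_graded "mscale :: 'k \<Rightarrow> ('v, 'k) mpoly \<Rightarrow> _" "homog_polys V"
      by (rule standard_graded_homog_polys[OF V])
  interpret I: ideal I ?R by fact
  interpret h: ring_hom_ring ?R "?R Quot I" "(+>\<^bsub>?R\<^esub>) I" by (rule I.rcos_ring_hom_ring)
  have S_carrier: "homog_polys V i \<subseteq> carrier ?R" for i by (auto simp: homog_polys_def)
  have coset0: "I +>\<^bsub>?R\<^esub> p = \<zero>\<^bsub>?R Quot I\<^esub> \<longleftrightarrow> p \<in> I" if "p \<in> carrier ?R" for p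
  proof -
    have "p \<ominus>\<^bsub>?R\<^esub> \<zero>\<^bsub>?R\<^esub> \<in> I \<longleftrightarrow> I +>\<^bsub>?R\<^esub> p = I +>\<^bsub>?R\<^esub> \<zero>\<^bsub>?R\<^esub>"
      by (rule I.quotient_eq_iff_same_a_r_cos[OF I that I.zero_closed])
    moreover have "I +>\<^bsub>?R\<^esub> \<zero>\<^bsub>?R\<^esub> = \<zero>\<^bsub>?R Quot I\<^esub>"
      by (rule h.hom_zero)
    moreover have "p \<ominus>\<^bsub>?R\<^esub> \<zero>\<^bsub>?R\<^esub> = p"
      using that by (simp add: a_minus_def)
    ultimately show ?thesis by simp
  qed
  have one: "1 \<notin> I"
  proof
    assume "1 \<in> I"
    have zero: "I +>\<^bsub>?R\<^esub> p = \<zero>\<^bsub>?R Quot I\<^esub>" if "p \<in> homog_polys V d" for p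
    proof -
      have p: "p \<in> carrier ?R" using that S_carrier by blast
      have "1 * p \<in> I" by (rule ideal_mpoly_subspace(3)[OF I \<open>1 \<in> I\<close> p])
      then show ?thesis using coset0[OF p] by simp
    qed
    have "(0 :: ('v, 'k) mpoly) \<in> homog_polys V d" by (rule mp.subspace_0[OF A.subspace_S])
    then have "piece V I d = {\<zero>\<^bsub>graded_alg V I\<^esub>}"
      unfolding piece_def graded_alg_def using zero by force
    then show False using soc by contradiction
  qed
  obtain f :: "('v, 'k) mpoly \<Rightarrow> ('v, 'k) mpoly \<Rightarrow> 'k"
    where f: "Vector_Spaces.linear mscale fscale f" "\<And>p. f p = 0 \<longleftrightarrow> p \<in> I"
    using mp.exists_linear_with_kernel[OF ideal_mpoly_subspace(1)[OF I]] by metis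
  interpret f: Vector_Spaces.linear mscale fscale f by (rule f(1))
  have "fn.dim (f ` homog_polys V d) = 1"
    using hilbert_fun_eq_dim[OF V I one f(1), of d] f(2) h1 by simp
  then obtain B where B: "B \<subseteq> f ` homog_polys V d" "fn.independent B"
      "f ` homog_polys V d \<subseteq> fn.span B" "card B = 1"
    using fn.basis_exists by metis
  then obtain e where e: "B = {e}" using card_1_singletonE by metis
  have "e \<noteq> 0" using B(2) e by (simp add: fn.dependent_single)
  then obtain b where b: "e b \<noteq> 0" by (auto simp: fun_eq_iff)
  have \<theta>: "f s b = 0 \<longleftrightarrow> s \<in> I" if s: "s \<in> homog_polys V d" for s
  proof -
    obtain a where a: "f s = fscale a e" using B(3) s e fn.span_singleton by blast
    then show ?thesis using b f(2)[of s] by (auto simp: fscale_apply fun_eq_iff)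
  qed
  define c where "c \<alpha> = (if Poly_Mapping.keys \<alpha> \<subseteq> V \<and> mdeg \<alpha> = d then f (Poly_Mapping.single \<alpha> 1)
      b else 0)" for \<alpha>
  have cf: "coeff_functional c s = f s b" if s: "s \<in> homog_polys V d" for s
  proof -
    have "f s = (\<Sum>\<alpha>\<in>Poly_Mapping.keys s. fscale (Poly_Mapping.lookup s \<alpha>)
        (f (Poly_Mapping.single \<alpha> 1)))"
    proof -
      have "s = (\<Sum>\<alpha>\<in>Poly_Mapping.keys s. mscale (Poly_Mapping.lookup s \<alpha>)
          (Poly_Mapping.single \<alpha> 1))"
        using mpoly_expand[of s] by (simp add: mscale_single)
      then have "f s = f (\<Sum>\<alpha>\<in>Poly_Mapping.keys s. mscale (Poly_Mapping.lookup s \<alpha>)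
          (Poly_Mapping.single \<alpha> 1))"
        by (rule arg_cong)
      then show ?thesis by (simp only: f.sum f.scale)
    qed
    then have "f s b = (\<Sum>\<alpha>\<in>Poly_Mapping.keys s. Poly_Mapping.lookup s \<alpha> * f
        (Poly_Mapping.single \<alpha> 1) b)"
      by (simp add: sum_fun_apply fscale_apply)
    then show ?thesis
      unfolding coeff_functional_def using s by (auto simp: c_def homog_polys_iff intro!: sum.cong)
  qed
  have gf: "graded_functional mscale (homog_polys V) (coeff_functional c) d"
    by (rule graded_functional_coeff[OF V]) (auto simp: c_def split: if_splits)
  interpret G: graded_functional mscale "homog_polys V" "coeff_functional c" d by (rule gf)
  have kernel: "s \<in> I \<longleftrightarrow> G.ev s = 0" if i: "i \<le> d" and s: "s \<in> homog_polys V i" for i s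
  proof
    assume "s \<in> I"
    then have "coeff_functional c (s * q) = 0" if "q \<in> homog_polys V (d - i)" for q
    proof -
      have "s * q \<in> homog_polys V d" using homog_polys_times[OF s that] i by simp
      moreover have "s * q \<in> I" using ideal_mpoly_subspace(3)[OF I \<open>s \<in> I\<close>] that S_carrier by blast
      ultimately show ?thesis using cf \<theta> by simp
    qed
    then show "G.ev s = 0" using G.ev_graded[OF i s] by blast
  next
    assume ev: "G.ev s = 0"
    let ?Q = "graded_alg V I"
    have sq: "s * q \<in> I" if "q \<in> homog_polys V (d - i)" for q
    proof -
      have "s * q \<in> homog_polys V d" using homog_polys_times[OF s that] i by simp
      then show ?thesis using ev G.ev_graded[OF i s] that cf \<theta> by metis
    qed
    have mult: "(I +>\<^bsub>?R\<^esub> p) \<otimes>\<^bsub>?Q\<^esub> (I +>\<^bsub>?R\<^esub> q) = I +>\<^bsub>?R\<^esub> (p * q)"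
      if "p \<in> carrier ?R" "q \<in> carrier ?R" for p q
      using h.hom_mult[OF that] by (simp add: graded_alg_def) (simp add: poly_ring_def)
    have inj: "inj_on (\<lambda>a. \<lambda>b\<in>piece V I (d - i). a \<otimes>\<^bsub>?Q\<^esub> b) (piece V I i)"
      using pp[OF i] by (simp add: perfect_pairing_def bij_betw_def)
    have s0: "(0 :: ('v, 'k) mpoly) \<in> homog_polys V i" by (rule mp.subspace_0[OF A.subspace_S])
    have "I +>\<^bsub>?R\<^esub> s = I +>\<^bsub>?R\<^esub> 0"
    proof (rule inj_onD[OF inj])
      show "(\<lambda>b\<in>piece V I (d - i). (I +>\<^bsub>?R\<^esub> s) \<otimes>\<^bsub>?Q\<^esub> b) = (\<lambda>b\<in>piece V I (d - i).
          (I +>\<^bsub>?R\<^esub> 0) \<otimes>\<^bsub>?Q\<^esub> b)"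
      proof (rule restrict_ext)
        fix x assume "x \<in> piece V I (d - i)"
        then obtain q where q: "q \<in> homog_polys V (d - i)" "x = I +>\<^bsub>?R\<^esub> q"
            by (auto simp: piece_def)
        have car: "s \<in> carrier ?R" "q \<in> carrier ?R" "0 \<in> carrier ?R" "s * q \<in> carrier ?R"
          using s q(1) S_carrier s0 sq[OF q(1)] I.a_subset by auto
        have "(I +>\<^bsub>?R\<^esub> s) \<otimes>\<^bsub>?Q\<^esub> x = \<zero>\<^bsub>?R Quot I\<^esub>"
          unfolding q(2) mult[OF car(1,2)] using coset0[OF car(4)] sq[OF q(1)] by simp
        moreover have "(I +>\<^bsub>?R\<^esub> 0) \<otimes>\<^bsub>?Q\<^esub> x = \<zero>\<^bsub>?R Quot I\<^esub>"
          unfolding q(2) mult[OF car(3,2)] using coset0[OF car(3)] mp.subspace_0[OF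
              ideal_mpoly_subspace(1)[OF I]]
          by simp
        ultimately show "(I +>\<^bsub>?R\<^esub> s) \<otimes>\<^bsub>?Q\<^esub> x = (I +>\<^bsub>?R\<^esub> 0) \<otimes>\<^bsub>?Q\<^esub> x" by simp
      qed
    qed (use s s0 in \<open>auto simp: piece_def\<close>)
    moreover have "I +>\<^bsub>?R\<^esub> 0 = \<zero>\<^bsub>?R Quot I\<^esub>"
      using coset0[of 0] s0 S_carrier mp.subspace_0[OF ideal_mpoly_subspace(1)[OF I]] by blast
    ultimately show "s \<in> I" using coset0[of s] s S_carrier by auto
  qed
  have "G.D (homog_polys V 1) = card V \<or> d = 0"
  proof (cases "d = 0")
    case False
    have "{s \<in> homog_polys V 1. G.ev s = 0} = {0}"
      using kernel[of 1] I1 False by auto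
    then have "mp.dim (homog_polys V 1 :: ('v, 'k) mpoly set) = G.D (homog_polys V 1)"
      using mp.fnp.rank_nullity[OF G.linear_ev A.subspace_S A.fin_S, of 1] mp.dim_subset_0[of "{0}"]
      by (simp add: G.D_def)
    moreover have "mp.dim (homog_polys V 1 :: ('v, 'k) mpoly set) = card V"
      by (rule dim_homog_polys_1[OF V])
    ultimately show ?thesis by simp
  qed simp
  note D1 = this
  have hilb: "hilbert_fun V I i = G.D (homog_polys V i)" if "i \<le> d" for i
    unfolding G.D_def by (rule hilbert_fun_eq_dim[OF V I one G.linear_ev kernel[OF that]])
  show thesis
    by (rule that[OF gf]) (use hilb D1 in auto)
qed

section \<open>Full Perazzo algebras\<close>

definition mfact :: "('v \<Rightarrow>\<^sub>0 nat) \<Rightarrow> 'k::field_char_0" where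
  "mfact \<alpha> = (\<Prod>v\<in>Poly_Mapping.keys \<alpha>. fact (Poly_Mapping.lookup \<alpha> v))"

lemma mfact_nonzero [simp]: "mfact \<alpha> \<noteq> 0"
  by (simp add: mfact_def)

lemma mfact_superset:
  assumes "finite A" "Poly_Mapping.keys \<alpha> \<subseteq> A"
  shows "mfact \<alpha> = (\<Prod>v\<in>A. fact (Poly_Mapping.lookup \<alpha> v))"
  unfolding mfact_def by (rule prod.mono_neutral_left) (use assms in \<open>auto simp: in_keys_iff\<close>)

lemma mfact_add_single:
  "mfact (\<beta> + Poly_Mapping.single v 1) = of_nat (Poly_Mapping.lookup \<beta> v + 1) * mfact \<beta>"
proof -
  let ?A = "insert v (Poly_Mapping.keys \<beta>)" and ?e = "Poly_Mapping.single v (1 :: nat)"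
  have "mfact (\<beta> + ?e) = (\<Prod>w\<in>?A. fact (Poly_Mapping.lookup (\<beta> + ?e) w))"
    by (rule mfact_superset) (auto simp: keys_add_nat)
  also have "\<dots> = fact (Poly_Mapping.lookup \<beta> v + 1) *
      (\<Prod>w\<in>?A - {v}. fact (Poly_Mapping.lookup (\<beta> + ?e) w))"
    by (subst prod.remove[of _ v]) (auto simp: Poly_Mapping.lookup_add)
  also have "(\<Prod>w\<in>?A - {v}. fact (Poly_Mapping.lookup (\<beta> + ?e) w)) =
      (\<Prod>w\<in>?A - {v}. fact (Poly_Mapping.lookup \<beta> w))"
    by (rule prod.cong) (auto simp: Poly_Mapping.lookup_add Poly_Mapping.lookup_single when_def)
  also have "fact (Poly_Mapping.lookup \<beta> v + 1) * \<dots> =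
      of_nat (Poly_Mapping.lookup \<beta> v + 1) *
      (fact (Poly_Mapping.lookup \<beta> v) * (\<Prod>w\<in>?A - {v}. fact (Poly_Mapping.lookup \<beta> w)))"
    by (simp add: mult.assoc)
  also have "fact (Poly_Mapping.lookup \<beta> v) * (\<Prod>w\<in>?A - {v}. fact (Poly_Mapping.lookup \<beta> w)) =
      (\<Prod>w\<in>?A. fact (Poly_Mapping.lookup \<beta> w))"
    by (rule prod.remove[symmetric]) auto
  also have "\<dots> = mfact \<beta>" by (rule mfact_superset[symmetric]) auto
  finally show ?thesis .
qed

text \<open>
  In the divided power basis a derivative is a shift of coefficients.
\<close>

definition divided_coeff :: "('v, 'k::field_char_0) mpoly \<Rightarrow> ('v \<Rightarrow>\<^sub>0 nat) \<Rightarrow> 'k" where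
  "divided_coeff p \<beta> = mfact \<beta> * Poly_Mapping.lookup p \<beta>"

lemma divided_coeff_partial:
  "divided_coeff (partial v p) \<beta> = divided_coeff p (\<beta> + Poly_Mapping.single v 1)"
  unfolding divided_coeff_def lookup_partial mfact_add_single by (simp add: mult_ac)

lemma divided_coeff_partial_funpow:
  "divided_coeff ((partial v ^^ k) p) \<beta> = divided_coeff p (\<beta> + Poly_Mapping.single v k)"
proof (induction k arbitrary: \<beta>)
  case (Suc k)
  have "Poly_Mapping.single v (1 :: nat) + Poly_Mapping.single v k = Poly_Mapping.single v (Suc k)"
    by (simp add: Poly_Mapping.single_add[symmetric])
  then show ?case
    by (simp only: funpow.simps o_apply divided_coeff_partial Suc.IH add.assoc)
qed simp

lemma divided_coeff_deriv_monom:
  fixes p :: "('v, 'k::field_char_0) mpoly"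
  shows "divided_coeff (deriv_monom \<alpha> p) \<beta> = divided_coeff p (\<beta> + \<alpha>)"
proof -
  interpret comp_fun_commute "\<lambda>v. (partial v :: ('v, 'k) mpoly \<Rightarrow> _) ^^ Poly_Mapping.lookup \<alpha> v"
    by (rule comp_fun_commute_partial_funpow)
  have fold: "divided_coeff (Finite_Set.fold (\<lambda>v. partial v ^^ Poly_Mapping.lookup \<alpha> v) p A) \<beta> =
      divided_coeff p (\<beta> + (\<Sum>v\<in>A. Poly_Mapping.single v (Poly_Mapping.lookup \<alpha> v)))" if "finite A"
          for A \<beta>
    using that
    by (induction A arbitrary: \<beta> rule: finite_induct) (simp_all add: divided_coeff_partial_funpow
        add.assoc)
  have "\<alpha> = (\<Sum>v\<in>Poly_Mapping.keys \<alpha>. Poly_Mapping.single v (Poly_Mapping.lookup \<alpha> v))"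
    by (rule poly_mapping_eqI)
      (simp add: Poly_Mapping.lookup_sum Poly_Mapping.lookup_single when_def in_keys_iff)
  then show ?thesis
    unfolding deriv_monom_def using fold[of "Poly_Mapping.keys \<alpha>" \<beta>] by simp
qed

lemma divided_coeff_apply_op:
  "divided_coeff (apply_op D p) \<beta> =
     (\<Sum>\<alpha>\<in>Poly_Mapping.keys D. Poly_Mapping.lookup D \<alpha> * divided_coeff p (\<alpha> + \<beta>))"
proof -
  have "divided_coeff (apply_op D p) \<beta> =
      (\<Sum>\<alpha>\<in>Poly_Mapping.keys D. Poly_Mapping.lookup D \<alpha> * divided_coeff (deriv_monom \<alpha> p) \<beta>)"
    by (simp add: apply_op_def mscale_def[symmetric] divided_coeff_def Poly_Mapping.lookup_sum
        lookup_mscale sum_distrib_left mult.left_commute)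
  then show ?thesis by (simp add: divided_coeff_deriv_monom add.commute)
qed

text \<open>Apolarity: the divided coefficients of \<open>apply_op D p\<close> are the values of the
  functional of \<open>p\<close> at the products of \<open>D\<close> with monomials.\<close>

lemma apply_op_eq_0_iff:
  "apply_op D p = 0 \<longleftrightarrow> (\<forall>q. coeff_functional (divided_coeff p) (D * q) = 0)"
proof -
  have "apply_op D p = 0 \<longleftrightarrow> (\<forall>\<beta>. divided_coeff (apply_op D p) \<beta> = 0)"
    by (auto simp: divided_coeff_def intro!: poly_mapping_eqI)
  then show ?thesis
    by (simp add: divided_coeff_apply_op coeff_functional_vanish_iff)
qed

text \<open>Through the functional, annihilating \<open>p\<close> becomes orthogonality of all
  multiples, a condition stable under multiplication.\<close>

lemma ideal_Ann: "ideal (Ann V p) (poly_ring V :: ('v, 'k::field_char_0) mpoly ring)"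
proof -
  interpret R: cring "poly_ring V :: ('v, 'k) mpoly ring" by (rule cring_poly_ring)
  have Ann: "x \<in> Ann V p \<longleftrightarrow> x \<in> carrier (poly_ring V) \<and> (\<forall>q. coeff_functional (divided_coeff p)
      (x * q) = 0)"
    for x by (simp add: Ann_def apply_op_eq_0_iff)
  show ?thesis
  proof (rule idealI[OF R.ring_axioms])
    show "subgroup (Ann V p) (add_monoid (poly_ring V :: ('v, 'k) mpoly ring))"
    proof (rule R.add.subgroupI)
      show "Ann V p \<subseteq> carrier (poly_ring V)" by (auto simp: Ann)
      show "Ann V p \<noteq> {}" using Ann[of 0] by (auto simp: poly_ring_def)
      fix a b :: "('v, 'k) mpoly" assume ab: "a \<in> Ann V p"
      have neg: "- a \<in> carrier (poly_ring V)" using ab by (simp add: Ann poly_ring_def)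
      have "a \<oplus>\<^bsub>poly_ring V\<^esub> (- a) = \<zero>\<^bsub>poly_ring V\<^esub>" by (simp add: poly_ring_def)
      then have "\<ominus>\<^bsub>poly_ring V\<^esub> a = - a"
        using ab neg by (metis Ann R.minus_equality R.a_comm)
      moreover have "coeff_functional (divided_coeff p) (- a * q) = 0" for q
        using ab[unfolded Ann] by (metis minus_mult_commute)
      ultimately show "\<ominus>\<^bsub>poly_ring V\<^esub> a \<in> Ann V p" using neg by (simp add: Ann)
      assume "b \<in> Ann V p"
      then show "a \<oplus>\<^bsub>poly_ring V\<^esub> b \<in> Ann V p"
        using ab R.a_closed[of a b] by (simp add: Ann) (simp add: poly_ring_def distrib_right
            coeff_functional_add)
    qed
  next
    fix a x :: "('v, 'k) mpoly" assume ax: "a \<in> Ann V p" "x \<in> carrier (poly_ring V)"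
    have "coeff_functional (divided_coeff p) (a * x * q) = 0" for q
      using ax(1) by (simp add: Ann mult.assoc)
    moreover have "a * x = a \<otimes>\<^bsub>poly_ring V\<^esub> x" by (simp add: poly_ring_def)
    ultimately have "a * x \<in> Ann V p"
      unfolding Ann using ax R.m_closed[of a x] by (simp only: Ann simp_thms)
    then show "x \<otimes>\<^bsub>poly_ring V\<^esub> a \<in> Ann V p" "a \<otimes>\<^bsub>poly_ring V\<^esub> x \<in> Ann V p"
      by (simp_all add: poly_ring_def mult.commute)
  qed
qed

lemma finite_monomials: "finite (monomials n k)"
proof (induction k)
  case 0
  have "monomials n 0 \<subseteq> {0}" by (auto simp: monomials_def mdeg_eq_0_iff)
  then show ?case by (rule finite_subset) simp
next
  case (Suc k)
  have "monomials n (Suc k) \<subseteq> (\<lambda>(j, \<beta>). Poly_Mapping.single j 1 + \<beta>) ` ({..<n} \<times> monomials n k)"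
  proof
    fix \<alpha> assume "\<alpha> \<in> monomials n (Suc k)"
    then have "mdeg \<alpha> = Suc k" "Poly_Mapping.keys \<alpha> \<subseteq> {..<n}" by (auto simp: monomials_def)
    then obtain v \<beta> where "v \<in> {..<n}" "\<alpha> = Poly_Mapping.single v 1 + \<beta>" "mdeg \<beta> = k"
        "Poly_Mapping.keys \<beta> \<subseteq> {..<n}" by (rule monomial_split)
    then show "\<alpha> \<in> (\<lambda>(j, \<beta>). Poly_Mapping.single j 1 + \<beta>) ` ({..<n} \<times> monomials n k)"
      by (intro image_eqI[of _ _ "(v, \<beta>)"]) (auto simp: monomials_def)
  qed
  then show ?case by (rule finite_subset) (use Suc in simp)
qed

definition perazzo_exp :: "nat \<Rightarrow> (nat \<Rightarrow>\<^sub>0 nat) \<Rightarrow> ((nat \<Rightarrow>\<^sub>0 nat) + nat) \<Rightarrow>\<^sub>0 nat" where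
  "perazzo_exp n M = Poly_Mapping.single (Inl M) 1 + (\<Sum>j<n. Poly_Mapping.single (Inr j)
      (Poly_Mapping.lookup M j))"

lemma Var_power: "Var v ^ k = Poly_Mapping.single (Poly_Mapping.single v k) 1"
  by (induction k) (simp_all add: Var_def Poly_Mapping.mult_single
      Poly_Mapping.single_add[symmetric])

lemma prod_single:
  "(\<Prod>j\<in>A. Poly_Mapping.single (g j) (1 :: 'k::comm_ring_1)) = Poly_Mapping.single (\<Sum>j\<in>A. g j) 1"
  by (induction A rule: infinite_finite_induct) (simp_all add: Poly_Mapping.mult_single)

lemma mdeg_sum: "mdeg (\<Sum>j\<in>A. g j) = (\<Sum>j\<in>A. mdeg (g j))"
  by (induction A rule: infinite_finite_induct) (simp_all add: mdeg_add)

lemma perazzo_poly_eq: "perazzo_poly n d = (\<Sum>M\<in>monomials n (d - 1). Poly_Mapping.single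
    (perazzo_exp n M) 1)"
  unfolding perazzo_poly_def Var_power prod_single perazzo_exp_def
  by (simp add: Var_def Poly_Mapping.mult_single)

lemma lookup_perazzo_exp_Inl:
  "Poly_Mapping.lookup (perazzo_exp n M) (Inl M') = (if M = M' then 1 else 0)"
  by (simp add: perazzo_exp_def Poly_Mapping.lookup_add Poly_Mapping.lookup_sum
      Poly_Mapping.lookup_single when_def)

lemma lookup_perazzo_exp_Inr:
  "Poly_Mapping.lookup (perazzo_exp n M) (Inr j) = (if j < n then Poly_Mapping.lookup M j else 0)"
  by (simp add: perazzo_exp_def Poly_Mapping.lookup_add Poly_Mapping.lookup_sum
      Poly_Mapping.lookup_single when_def)

lemma perazzo_exp_inj: "perazzo_exp n M = perazzo_exp n M' \<longleftrightarrow> M = M'"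
  using lookup_perazzo_exp_Inl[of n M M'] lookup_perazzo_exp_Inl[of n M' M']
      by (auto split: if_splits)

lemma lookup_perazzo_poly:
  "Poly_Mapping.lookup (perazzo_poly n d) \<gamma> = (\<Sum>M\<in>monomials n (d - 1).
      if perazzo_exp n M = \<gamma> then 1 else 0)"
  by (simp add: perazzo_poly_eq Poly_Mapping.lookup_sum Poly_Mapping.lookup_single when_def)

lemma perazzo_support:
  assumes "d \<ge> 1" "Poly_Mapping.lookup (perazzo_poly n d :: (_, 'k::comm_ring_1) mpoly) \<gamma> \<noteq> 0"
  obtains M where "M \<in> monomials n (d - 1)" "\<gamma> = perazzo_exp n M"
    "Poly_Mapping.keys \<gamma> \<subseteq> perazzo_vars n d" "mdeg \<gamma> = d"
proof -
  have "\<exists>M\<in>monomials n (d - 1). perazzo_exp n M = \<gamma>"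
  proof (rule ccontr)
    assume "\<not> ?thesis"
    then have "Poly_Mapping.lookup (perazzo_poly n d :: (_, 'k) mpoly) \<gamma> = 0"
      unfolding lookup_perazzo_poly by (intro sum.neutral) auto
    with assms(2) show False by contradiction
  qed
  then obtain M where M: "M \<in> monomials n (d - 1)" "perazzo_exp n M = \<gamma>" by blast
  have "Poly_Mapping.keys \<gamma> \<subseteq> perazzo_vars n d"
  proof
    fix x assume "x \<in> Poly_Mapping.keys \<gamma>"
    then show "x \<in> perazzo_vars n d"
      unfolding M(2)[symmetric] in_keys_iff using M(1)
      by (cases x) (auto simp: lookup_perazzo_exp_Inl lookup_perazzo_exp_Inr perazzo_vars_def
          split: if_splits)
  qed
  moreover have "mdeg \<gamma> = d"
  proof -
    have "mdeg M = (\<Sum>j<n. Poly_Mapping.lookup M j)"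
      by (rule mdeg_superset) (use M(1) in \<open>auto simp: monomials_def\<close>)
    then have "mdeg \<gamma> = 1 + mdeg M"
      unfolding M(2)[symmetric] perazzo_exp_def by (simp add: mdeg_add mdeg_sum)
    then show ?thesis using M(1) assms(1) by (simp add: monomials_def)
  qed
  ultimately show thesis using that M by blast
qed

lemma perazzo_poly_nonzero:
  assumes "n \<ge> 1"
  shows "\<exists>\<gamma>. Poly_Mapping.lookup (perazzo_poly n d :: (_, 'k::comm_ring_1) mpoly) \<gamma> \<noteq> 0"
proof -
  let ?M = "Poly_Mapping.single 0 (d - 1) :: nat \<Rightarrow>\<^sub>0 nat"
  have M: "?M \<in> monomials n (d - 1)" using assms by (auto simp: monomials_def)
  have "Poly_Mapping.lookup (perazzo_poly n d :: (_, 'k) mpoly) (perazzo_exp n ?M) = 1"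
    using M finite_monomials by (simp add: lookup_perazzo_poly perazzo_exp_inj)
  then show ?thesis by (metis zero_neq_one)
qed

text \<open>Pair \<open>S i\<close> with the space \<open>T\<close> of multiples of \<open>X\<close>
  in degree \<open>d - i\<close>. As \<open>X\<close> kills \<open>T\<close>, the rank is at most
  \<open>tau (card U) i\<close>. An element orthogonal to \<open>T\<close> is killed by
  \<open>X\<close>, so the kernel lies in \<open>W\<close> and contributes at most
  \<open>tau (card U) (d - i)\<close>. Both bounds are \<open>D_le_tau\<close> with \<open>U\<close>
  as the variables.\<close>

lemma (in graded_functional) D_le_two_block:
  assumes U: "finite U" "U \<subseteq> S 1" and X: "X \<subseteq> S 1" and gen: "S 1 \<subseteq> span (U \<union> X)"
    and XX: "\<And>x x'. x \<in> X \<Longrightarrow> x' \<in> X \<Longrightarrow> ev (x * x') = 0" and i: "1 \<le> i" "i < d"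
  shows "D (S i) \<le> tau (card U) i + tau (card U) (d - i)"
proof -
  define W where "W = {s \<in> S i. \<forall>x\<in>X. ev (x * s) = 0}"
  define T where "T = span {x * t | x t. x \<in> X \<and> t \<in> S (d - i - 1)}"
  define f where "f = (\<lambda>s w. if w \<in> T then \<Phi> (w * s) else 0)"
  have subT: "subspace T" by (simp add: T_def)
  have TS: "T \<subseteq> S (d - i)"
    unfolding T_def
  proof (rule span_minimal[OF _ subspace_S])
    have "Suc (d - i - 1) = d - i" using i by simp
    then show "{x * t | x t. x \<in> X \<and> t \<in> S (d - i - 1)} \<subseteq> S (d - i)"
      using S_mult_Suc[of _ _ "d - i - 1"] X by auto
  qed
  have ker0: "subspace {w. ev (x * w) = 0}" for x
    using module_hom.subspace_kernel[OF Vector_Spaces.linear.axioms(3)[OF linear_ev_mult]] .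
  have "ev (x * w) = 0" if x: "x \<in> X" and w: "w \<in> T" for x w
  proof -
    have "T \<subseteq> {w. ev (x * w) = 0}"
      unfolding T_def
    proof (rule span_minimal[OF _ ker0], clarify)
      fix y t assume "y \<in> X" "t \<in> S (d - i - 1)"
      have "ev (t * (x * y)) = 0" by (rule ev_mult_0[OF XX[OF x \<open>y \<in> X\<close>]])
      then show "ev (x * (y * t)) = 0" by (simp only: mult_ac)
    qed
    then show ?thesis using w by blast
  qed
  then have DT: "D T \<le> tau (card U) i"
    using i by (intro D_le_tau[OF U(1) _ TS subT U(2) gen]) auto
  have subW: "subspace W"
  proof -
    have "W = S i \<inter> (\<Inter>x\<in>X. {w. ev (x * w) = 0})" by (auto simp: W_def)
    then show ?thesis using ker0 by (auto intro!: subspace_inter subspace_Int)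
  qed
  have WS: "W \<subseteq> S i" by (auto simp: W_def)
  have DW: "D W \<le> tau (card U) (d - i)"
    using i by (intro D_le_tau[OF U(1) _ WS subW U(2) gen]) (auto simp: W_def)
  have lin: "Vector_Spaces.linear scale fscale f"
    by (rule linear_fnI) (auto simp: f_def distrib_left \<Phi>_add mult_scale \<Phi>_scale)
  have rank: "fn.dim (f ` S i) = D T"
    using D_pairing[OF _ TS subT] i by (simp add: f_def)
  have kernel: "{s \<in> S i. f s = 0} \<subseteq> W"
  proof clarify
    fix s assume s: "s \<in> S i" "f s = 0"
    have "ev (x * s) = 0" if x: "x \<in> X" for x
    proof -
      have xs: "x * s \<in> S (Suc i)" using S_mult_Suc[OF _ s(1)] x X by blast
      have "\<Phi> (x * s * q) = 0" if "q \<in> S (d - Suc i)" for q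
      proof -
        have "x * q \<in> T" unfolding T_def using x that by (intro span_base) auto
        then have "\<Phi> (x * q * s) = 0" using fun_cong[OF s(2), of "x * q"] by (simp add: f_def)
        then show ?thesis by (simp only: mult_ac)
      qed
      then show ?thesis using ev_graded[OF _ xs] i by simp
    qed
    then show "s \<in> W" using s(1) by (simp add: W_def)
  qed
  have finW: "fin_span W" by (rule fin_span_mono[OF fin_S WS])
  have "dim (S i) = D T + dim {s \<in> S i. f s = 0}"
    using fnp.rank_nullity[OF lin subspace_S fin_S, of i] rank by simp
  moreover have "dim {s \<in> S i. f s = 0} \<le> dim W" by (rule dim_mono_fin[OF finW kernel])
  moreover have "dim W = D W + dim {w \<in> W. ev w = 0}"
    unfolding D_def by (rule fnp.rank_nullity[OF linear_ev subW finW])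
  moreover have "dim {w \<in> W. ev w = 0} \<le> dim {w \<in> S i. ev w = 0}"
    by (rule dim_mono_fin[OF fin_span_mono[OF fin_S[of i]]]) (auto simp: W_def)
  moreover have "dim (S i) = D (S i) + dim {w \<in> S i. ev w = 0}"
    unfolding D_def by (rule fnp.rank_nullity[OF linear_ev subspace_S fin_S])
  ultimately show ?thesis using DT DW by linarith
qed

lemma perazzo_functional:
  assumes d: "d \<ge> 2" and n: "n \<ge> 1"
  obtains \<Phi> :: "((nat \<Rightarrow>\<^sub>0 nat) + nat, 'k::field_char_0) mpoly \<Rightarrow> 'k"
  where "graded_functional mscale (homog_polys (perazzo_vars n d)) \<Phi> d"
    "\<And>i. hilbert_fun (perazzo_vars n d) (perazzo_ideal n d :: (_, 'k) mpoly set) i =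
       graded_functional.D \<Phi> (homog_polys (perazzo_vars n d) i)"
    "\<And>i. 1 \<le> i \<Longrightarrow> i < d \<Longrightarrow>
       graded_functional.D \<Phi> (homog_polys (perazzo_vars n d) i) \<le> tau n i + tau n (d - i)"
proof -
  let ?V = "perazzo_vars n d" and ?f = "perazzo_poly n d :: ((nat \<Rightarrow>\<^sub>0 nat) + nat, 'k) mpoly"
  let ?c = "divided_coeff ?f"
  have V: "finite ?V" by (simp add: perazzo_vars_def finite_monomials)
  have c: "\<exists>M. \<alpha> = perazzo_exp n M \<and> Poly_Mapping.keys \<alpha> \<subseteq> ?V \<and> mdeg \<alpha> = d" if "?c \<alpha> \<noteq> 0" for \<alpha>
  proof -
    have "Poly_Mapping.lookup ?f \<alpha> \<noteq> 0" using that by (simp add: divided_coeff_def)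
    with d show ?thesis by (elim perazzo_support[rotated]) auto
  qed
  have gf: "graded_functional mscale (homog_polys ?V) (coeff_functional ?c) d"
    by (rule graded_functional_coeff[OF V]) (use c in blast)
  interpret G: graded_functional mscale "homog_polys ?V" "coeff_functional ?c" d by (rule gf)
  have Ann: "D \<in> Ann ?V ?f \<longleftrightarrow> D \<in> carrier (poly_ring ?V) \<and> G.ev D = 0" for D
    by (simp add: Ann_def apply_op_eq_0_iff G.ev_eq_0_iff)
  have one: "1 \<notin> Ann ?V ?f"
  proof
    assume "1 \<in> Ann ?V ?f"
    then have "coeff_functional ?c (1 * Poly_Mapping.single \<gamma> 1) = 0" for \<gamma>
      unfolding Ann G.ev_eq_0_iff by blast
    then have "?c \<gamma> = 0" for \<gamma> by simp
    then show False using perazzo_poly_nonzero[OF n, of d] by (auto simp: divided_coeff_def)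
  qed
  have hilb: "hilbert_fun ?V (perazzo_ideal n d :: (_, 'k) mpoly set) i = G.D (homog_polys ?V i)"
      for i
    unfolding G.D_def perazzo_ideal_def
    by (rule hilbert_fun_eq_dim[OF V ideal_Ann one G.linear_ev]) (auto simp: Ann homog_polys_def)
  let ?U = "(\<lambda>j. Var (Inr j)) ` {..<n} :: ((nat \<Rightarrow>\<^sub>0 nat) + nat, 'k) mpoly set"
  let ?X = "(\<lambda>M. Var (Inl M)) ` monomials n (d - 1) :: ((nat \<Rightarrow>\<^sub>0 nat) + nat, 'k) mpoly set"
  have "G.D (homog_polys ?V i) \<le> tau n i + tau n (d - i)" if i: "1 \<le> i" "i < d" for i
  proof -
    have "G.D (homog_polys ?V i) \<le> tau (card ?U) i + tau (card ?U) (d - i)"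
    proof (rule G.D_le_two_block[OF _ _ _ _ _ i])
      show "?U \<subseteq> homog_polys ?V 1" "?X \<subseteq> homog_polys ?V 1"
        by (auto simp: Var_def perazzo_vars_def intro!: homog_polys_single)
      have "Var ` ?V = ?U \<union> ?X" by (auto simp: perazzo_vars_def image_image image_Un)
      then show "homog_polys ?V 1 \<subseteq> mp.span (?U \<union> ?X)" using homog_polys_1_span[of ?V] by metis
      fix x x' assume "x \<in> ?X" "x' \<in> ?X"
      then obtain M M' where M: "x = Var (Inl M)" "x' = Var (Inl M')" by blast
      let ?e = "Poly_Mapping.single (Inl M) 1 + Poly_Mapping.single (Inl M') (1::nat) ::
          ((nat \<Rightarrow>\<^sub>0 nat) + nat) \<Rightarrow>\<^sub>0 nat"
      have xx: "x * x' = Poly_Mapping.single ?e 1"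
        by (simp add: M Var_def Poly_Mapping.mult_single)
      have "?c (?e + \<beta>) = 0" for \<beta>
      proof (rule ccontr)
        assume "?c (?e + \<beta>) \<noteq> 0"
        then obtain N where N: "?e + \<beta> = perazzo_exp n N" using c by blast
        \<comment> \<open>A term of the Perazzo polynomial has exactly one \<open>x\<close>
          variable, with exponent 1. Equal \<open>M\<close> and \<open>M'\<close> would force
          exponent 2, distinct ones two such variables.\<close>
        have "Poly_Mapping.lookup (?e + \<beta>) (Inl M) \<ge> (if M = M' then 2 else 1)"
          "Poly_Mapping.lookup (?e + \<beta>) (Inl M') \<ge> (if M = M' then 2 else 1)"
          by (auto simp: Poly_Mapping.lookup_add Poly_Mapping.lookup_single when_def)
        then show False unfolding N lookup_perazzo_exp_Inl by (auto split: if_splits)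
      qed
      then show "G.ev (x * x') = 0"
        unfolding G.ev_eq_0_iff coeff_functional_vanish_iff xx by simp
    qed simp
    moreover have "card ?U \<le> n" using card_image_le[of "{..<n}"] by simp
    ultimately show ?thesis
      using tau_mono[of "card ?U" n i] tau_mono[of "card ?U" n "d - i"] by linarith
  qed
  then show thesis
    by (intro that[OF gf]) (use hilb in auto)
qed

theorem theorem5p9:
  fixes d n :: nat
    and I :: "(nat, 'k::{alg_closed_field, field_char_0}) mpoly set"
    and H :: "nat list"
  assumes "d \<ge> 4" and "n \<ge> 2"
    and "H = hilbert_vector d (perazzo_vars n d)
               (perazzo_ideal n d :: ((nat \<Rightarrow>\<^sub>0 nat) + nat, 'k) mpoly set)"
    and "standard_AG {..<n + tau n (d - 1)} I d"
    and "hilbert_vector d {..<n + tau n (d - 1)} I \<preceq>\<^sub>H H"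
  shows "hilbert_vector d {..<n + tau n (d - 1)} I = H"
proof -
  let ?V = "{..<n + tau n (d - 1)}"
  let ?P = "perazzo_ideal n d :: ((nat \<Rightarrow>\<^sub>0 nat) + nat, 'k) mpoly set"
  let ?h = "hilbert_fun ?V I" and ?H = "hilbert_fun (perazzo_vars n d) ?P"
  obtain \<Phi> :: "(nat, 'k) mpoly \<Rightarrow> 'k" where \<Phi>: "graded_functional mscale (homog_polys ?V) \<Phi> d"
    "\<And>i. i \<le> d \<Longrightarrow> ?h i = graded_functional.D \<Phi> (homog_polys ?V i)"
    "graded_functional.D \<Phi> (homog_polys ?V 1) = card ?V \<or> d = 0"
    by (rule gorenstein_functional[OF assms(4)]) blast
  have "2 \<le> d" "1 \<le> n" using assms(1,2) by simp_all
  then obtain \<Psi> :: "((nat \<Rightarrow>\<^sub>0 nat) + nat, 'k) mpoly \<Rightarrow> 'k"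
    where \<Psi>: "graded_functional mscale (homog_polys (perazzo_vars n d)) \<Psi> d"
    "\<And>i. ?H i = graded_functional.D \<Psi> (homog_polys (perazzo_vars n d) i)"
    "\<And>i. 1 \<le> i \<Longrightarrow> i < d \<Longrightarrow>
       graded_functional.D \<Psi> (homog_polys (perazzo_vars n d) i) \<le> tau n i + tau n (d - i)"
    by (rule perazzo_functional) blast
  interpret A: graded_functional mscale "homog_polys ?V" \<Phi> d by (rule \<Phi>(1))
  interpret P: graded_functional mscale "homog_polys (perazzo_vars n d)" \<Psi> d by (rule \<Psi>(1))
  have h_sym: "?h i = ?h (d - i)" if "i \<le> d" for i
    using A.D_sym[OF that] \<Phi>(2) that by simp
  have H_sym: "?H i = ?H (d - i)" if "i \<le> d" for i
    using P.D_sym[OF that] \<Psi>(2) by simp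
  have half: "?h i \<le> ?H i" if "i \<le> d div 2" for i
  proof -
    have "i < d + 1" using that by simp
    then show ?thesis
      using assms(5) that unfolding hilbert_le_def assms(3) hilbert_vector_def
          by (auto simp del: upt_Suc)
  qed
  \<comment> \<open>The order compares the lower half only; the symmetry of both vectors gives the
    upper half.\<close>
  have le: "?h i \<le> ?H i" if "i \<le> d" for i
  proof (cases "i \<le> d div 2")
    case False
    then have "d - i \<le> d div 2" by linarith
    then show ?thesis using half[of "d - i"] h_sym[OF that] H_sym[OF that] by simp
  qed (rule half)
  define m where "m = n - 1"
  have n: "n = Suc m" "m \<ge> 1" using assms(2) by (auto simp: m_def)
  have H_le: "?H i \<le> tau n i + tau n (d - i)" if "1 \<le> i" "i < d" for i
    using \<Psi>(2,3) that by simp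
  have mid: "?h i = tau n i + tau n (d - i)" if i: "1 \<le> i" "i < d" for i
  proof -
    have "A.D (homog_polys ?V i) = tau (Suc m) i + tau (Suc m) (d - i)"
    proof (rule A.hilbert_function_minimal[OF \<Phi>(1) _ n(2) _ _ i])
      show "A.D (homog_polys ?V 1) = tau (Suc m) 1 + tau (Suc m) (d - 1)"
        using \<Phi>(3) assms(1) n(1) by simp
      fix j assume "2 \<le> j" "j < d"
      then show "A.D (homog_polys ?V j) \<le> tau (Suc m) j + tau (Suc m) (d - j)"
        using le[of j] H_le[of j] \<Phi>(2)[of j] n(1) by simp
    qed (use assms(1) in simp)
    then show ?thesis using \<Phi>(2)[of i] i n(1) by simp
  qed
  have ends: "?h i = ?H i" if i: "i = 0 \<or> i = d" for i
  proof -
    have "?h d = 1" using assms(4) by (simp add: standard_AG_def)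
    moreover have "?H 0 \<le> 1" using P.D_S0_le \<Psi>(2) by simp
    ultimately show ?thesis using le[of 0] h_sym[of 0] H_sym[of 0] i by auto
  qed
  \<comment> \<open>In the inner degrees \<open>?h i\<close> equals the binomial sum by
    \<open>mid\<close>, while \<open>?H i\<close> lies between \<open>?h i\<close> and that sum by
    \<open>le\<close> and \<open>H_le\<close>.\<close>
  have "?h i = ?H i" if "i \<le> d" for i
  proof (cases "i = 0 \<or> i = d")
    case False
    then show ?thesis using le[OF that] mid[of i] H_le[of i] that by simp
  qed (rule ends)
  then show ?thesis unfolding assms(3) hilbert_vector_def by (auto simp del: upt_Suc)
qed

end
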